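(* Let $\Gamma\vdash\Delta$ be a sequent of $\mathrm{HFL}_{\mathbb{N}}$ without higher-order free variables, i.e. every free variable has type $\mathbf{N}$ or type $\mathbf{N}\to\cdots\to\mathbf{N}\to\mathbf{\Omega}$ (with $k\ge 0$ arguments). If $\Gamma\models\Delta$, then $\Gamma\vdash\Delta$ is provable in the infinitary proof system described in the context.
   Context: $\mathrm{HFL}_{\mathbb{N}}$. Types: $A ::= \mathbf{N} \mid T$, $T ::= \mathbf{\Omega} \mid A \to T$. Terms: $s,t ::= x \mid \mathbf{Z} \mid \mathbf{S}t$. Formulas: $\varphi,\psi ::= s=t \mid \varphi\lor\psi \mid \varphi\land\psi \mid x \mid \lambda x^A.\varphi \mid \varphi\,\psi \mid \varphi\,t \mid \mu x^T.\varphi \mid \nu x^T.\varphi$, simply typed in the usual way ($s=t$, $\lor$, $\land$ of type $\mathbf{\Omega}$; fixed points only at types $T$). Semantics: $[\![\mathbf{N}]\!]=\mathbb{N}$ discretely ordered, $[\![\mathbf{\Omega}]\!]=\{\bot\le\top\}$, $[\![A\to T]\!]$ = monotone functions ordered pointwise; $\mu,\nu$ are least/greatest fixed points. A sequent $\Gamma\vdash\Delta$ is a pair of finite sequences of formulas of type $\mathbf{\Omega}$; $\Gamma\models\Delta$ (valid) means: for every valuation $\rho$, $[\![\varphi]\!]_\rho=\bot$ for some $\varphi\in\Gamma$ or $[\![\psi]\!]_\rho=\top$ for some $\psi\in\Delta$. Write $\exists x'.\theta$ for $(\mu Y^{\mathbf{N}\to\mathbf{\Omega}}.\lambda x'.\theta\lor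 Y(\mathbf{S}x'))\,\mathbf{Z}$ and $N \equiv \mu X.\lambda x.(x=\mathbf{Z})\lor(\exists x'.x=\mathbf{S}x'\land X\,x')$. Rules ($\sigma\in\{\mu,\nu\}$): (Axiom) $\varphi\vdash\varphi$; (Cut); weakening, contraction, exchange on both sides; (Subst) from $\Gamma\vdash\Delta$ infer $\Gamma[\varphi/x]\vdash\Delta[\varphi/x]$; (Mono) from $k$ copies of $\Gamma,\psi\,\vec y\vdash\chi\,\vec y,\Delta$ ($k$ = number of occurrences of $x$ in $\varphi$, $\vec y$ fresh) infer $\Gamma,\varphi[\psi/x^T]\vdash\varphi[\chi/x^T],\Delta$; ($=L$) from $\Gamma[t/x,s/y]\vdash\Delta[t/x,s/y]$ infer $\Gamma[s/x,t/y],s=t\vdash\Delta[s/x,t/y]$; ($=R$) $\Gamma\vdash t=t,\Delta$; standard ($\lor L$), ($\lor R$) (from $\Gamma\vdash\varphi,\psi,\Delta$), ($\land L$) (from $\Gamma,\varphi,\psi\vdash\Delta$), ($\land R$); ($\lambda L/R$) replace $(\lambda x.\varphi)\psi\vec\psi$ on the left/right by $\varphi[\psi/x]\vec\psi$; ($\sigma L/R$) replace $(\sigma x.\varphi)\vec\psi$ by $\varphi[\sigma x.\varphi/x]\vec\psi$; (Nat) from $\Gamma,N\,x^{\mathbf{N}}\vdash\Delta$ infer $\Gamma\vdash\Delta$; (P1) $\mathbf{S}s=\mathbf{Z}\vdash$; (P2) from $\Gamma,s=t\vdash\Delta$ infer $\Gamma,\mathbf{S}s=\mathbf{S}t\vdash\Delta$.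 The ($=$),($\lor$),($\land$),($\lambda$),($\sigma$) rules are logical; an occurrence in a conclusion is principal if not in $\Gamma$ or $\Delta$. Relevant occurrences between a conclusion and a premise: side formulas correspond (via substitution in (Subst),($=L$)); contraction copies correspond; in ($\land L$),($\lor R$) both components, in ($\lor L$),($\land R$) the component in the premise, in ($\lambda$),($\sigma$) the reduct/unfolding, in (Mono) $\psi\vec y,\chi\vec y$ to $\varphi[\psi/x],\varphi[\chi/x]$, in (P2) $s=t$ to $\mathbf{S}s=\mathbf{S}t$; cut formula and $N\,x$ of (Nat) have no predecessor. A trace along an infinite branch $(n_i)$ is a sequence $(\tau_i)$ of occurrences, $\tau_{i+1}$ relevant to $\tau_i$, principal in a logical rule infinitely often. Annotation: operators in $\tau_0$ get $\epsilon$; unfolding $(\sigma_p x.\varphi)\vec\psi$ gives $\varphi[\sigma_{p.k}x.\varphi/x]\vec\psi$ with fresh $k$; for (Mono) with $\tau_i=\varphi[\psi_1/x_1,\dots,\psi_k/x_k]$ and $\tau_{i+1}$ in the $j$-th premise, $\tau_{i+1}=\psi_j\vec y$ keeps $\psi_j$'s annotations; otherwise inherited. It is a $\mu$-trace (resp. $\nu$-trace) if some infinite sequence $p$ has each finite prefix assigned to a $\mu$ (resp. $\nu$) in some $\tau_i$; left/right according to the side of $\tau_0$. An infinitary proof is a possibly infinite derivation tree built from these rules with all leaves axioms, such that every infinite branch has a tail carrying a left $\mu$-trace or a right $\nu$-trace. *)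

theory Defs
  imports Main
begin

section \<open>Syntax\<close>

datatype ty = TNat | TForm fty
and fty = TOmega | TFun ty fty

type_synonym var = "nat \<times> ty"

datatype fixkind = Mu | Nu

text \<open>
  Terms and formulas share one datatype and are told apart by typing: the expressions of type
  \<open>TNat\<close> are exactly the terms, those of type \<open>TForm T\<close> exactly the formulas. Bound variables are
  de Bruijn indices, free variables are names carrying their type, so \<open>\<alpha>\<close>-equivalent
  formulas are equal and a well-typed expression can be substituted without capture.
  The parameter \<open>'a\<close> is an annotation on each fixed-point operator: plain formulas use \<open>unit\<close>,
  the formulas along a trace use \<open>nat list\<close>.
\<close>

datatype 'a exp =
    FV var
  | BV nat
  | Zero
  | Succ "'a exp"
  | Eq "'a exp" "'a exp"
  | Or "'a exp" "'a exp"
  | And "'a exp" "'a exp"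
  | Lam ty "'a exp"
  | App "'a exp" "'a exp"
  | Fix fixkind 'a fty "'a exp"

type_synonym fm = "unit exp"
type_synonym afm = "nat list exp"

inductive has_type :: "ty list \<Rightarrow> 'a exp \<Rightarrow> ty \<Rightarrow> bool" where
  "has_type \<Theta> (FV x) (snd x)"
| "i < length \<Theta> \<Longrightarrow> has_type \<Theta> (BV i) (\<Theta> ! i)"
| "has_type \<Theta> Zero TNat"
| "has_type \<Theta> t TNat \<Longrightarrow> has_type \<Theta> (Succ t) TNat"
| "has_type \<Theta> s TNat \<Longrightarrow> has_type \<Theta> t TNat \<Longrightarrow> has_type \<Theta> (Eq s t) (TForm TOmega)"
| "has_type \<Theta> \<phi> (TForm TOmega) \<Longrightarrow> has_type \<Theta> \<psi> (TForm TOmega) \<Longrightarrow>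
    has_type \<Theta> (Or \<phi> \<psi>) (TForm TOmega)"
| "has_type \<Theta> \<phi> (TForm TOmega) \<Longrightarrow> has_type \<Theta> \<psi> (TForm TOmega) \<Longrightarrow>
    has_type \<Theta> (And \<phi> \<psi>) (TForm TOmega)"
| "has_type (A # \<Theta>) \<phi> (TForm T) \<Longrightarrow> has_type \<Theta> (Lam A \<phi>) (TForm (TFun A T))"
| "has_type \<Theta> \<phi> (TForm (TFun A T)) \<Longrightarrow> has_type \<Theta> \<psi> A \<Longrightarrow> has_type \<Theta> (App \<phi> \<psi>) (TForm T)"
| "has_type (TForm T # \<Theta>) \<phi> (TForm T) \<Longrightarrow> has_type \<Theta> (Fix \<sigma> p T \<phi>) (TForm T)"

primrec fvs :: "'a exp \<Rightarrow> var set" where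
  "fvs (FV x) = {x}"
| "fvs (BV i) = {}"
| "fvs Zero = {}"
| "fvs (Succ t) = fvs t"
| "fvs (Eq s t) = fvs s \<union> fvs t"
| "fvs (Or \<phi> \<psi>) = fvs \<phi> \<union> fvs \<psi>"
| "fvs (And \<phi> \<psi>) = fvs \<phi> \<union> fvs \<psi>"
| "fvs (Lam A \<phi>) = fvs \<phi>"
| "fvs (App \<phi> \<psi>) = fvs \<phi> \<union> fvs \<psi>"
| "fvs (Fix \<sigma> p T \<phi>) = fvs \<phi>"

abbreviation apps :: "'a exp \<Rightarrow> 'a exp list \<Rightarrow> 'a exp" where
  "apps \<phi> \<psi>s \<equiv> foldl App \<phi> \<psi>s"

text \<open>\<open>inst n u e\<close> replaces the index \<open>n\<close> in \<open>e\<close> by \<open>u\<close>; as \<open>u\<close> has no dangling indices, nothing is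
  shifted. Thus \<open>inst 0 u \<phi>\<close> is \<open>\<phi>[u/x]\<close> for the body \<open>\<phi>\<close> of a binder of \<open>x\<close>.\<close>

primrec inst :: "nat \<Rightarrow> 'a exp \<Rightarrow> 'a exp \<Rightarrow> 'a exp" where
  "inst n u (FV x) = FV x"
| "inst n u (BV i) = (if i = n then u else BV i)"
| "inst n u Zero = Zero"
| "inst n u (Succ t) = Succ (inst n u t)"
| "inst n u (Eq s t) = Eq (inst n u s) (inst n u t)"
| "inst n u (Or \<phi> \<psi>) = Or (inst n u \<phi>) (inst n u \<psi>)"
| "inst n u (And \<phi> \<psi>) = And (inst n u \<phi>) (inst n u \<psi>)"
| "inst n u (Lam A \<phi>) = Lam A (inst (Suc n) u \<phi>)"
| "inst n u (App \<phi> \<psi>) = App (inst n u \<phi>) (inst n u \<psi>)"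
| "inst n u (Fix \<sigma> p T \<phi>) = Fix \<sigma> p T (inst (Suc n) u \<phi>)"

primrec subst :: "(var \<Rightarrow> 'a exp) \<Rightarrow> 'a exp \<Rightarrow> 'a exp" where
  "subst f (FV x) = f x"
| "subst f (BV i) = BV i"
| "subst f Zero = Zero"
| "subst f (Succ t) = Succ (subst f t)"
| "subst f (Eq s t) = Eq (subst f s) (subst f t)"
| "subst f (Or \<phi> \<psi>) = Or (subst f \<phi>) (subst f \<psi>)"
| "subst f (And \<phi> \<psi>) = And (subst f \<phi>) (subst f \<psi>)"
| "subst f (Lam A \<phi>) = Lam A (subst f \<phi>)"
| "subst f (App \<phi> \<psi>) = App (subst f \<phi>) (subst f \<psi>)"
| "subst f (Fix \<sigma> p T \<phi>) = Fix \<sigma> p T (subst f \<phi>)"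

abbreviation subst1 :: "var \<Rightarrow> 'a exp \<Rightarrow> 'a exp \<Rightarrow> 'a exp" where
  "subst1 x u \<equiv> subst (FV(x := u))"

abbreviation subst2 :: "var \<Rightarrow> 'a exp \<Rightarrow> var \<Rightarrow> 'a exp \<Rightarrow> 'a exp \<Rightarrow> 'a exp" where
  "subst2 x u y v \<equiv> subst (FV(x := u, y := v))"

primrec nocc :: "var \<Rightarrow> 'a exp \<Rightarrow> nat" where
  "nocc x (FV y) = (if y = x then 1 else 0)"
| "nocc x (BV i) = 0"
| "nocc x Zero = 0"
| "nocc x (Succ t) = nocc x t"
| "nocc x (Eq s t) = nocc x s + nocc x t"
| "nocc x (Or \<phi> \<psi>) = nocc x \<phi> + nocc x \<psi>"
| "nocc x (And \<phi> \<psi>) = nocc x \<phi> + nocc x \<psi>"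
| "nocc x (Lam A \<phi>) = nocc x \<phi>"
| "nocc x (App \<phi> \<psi>) = nocc x \<phi> + nocc x \<psi>"
| "nocc x (Fix \<sigma> p T \<phi>) = nocc x \<phi>"

text \<open>\<open>subst_occ x f e\<close> replaces the \<open>i\<close>-th free occurrence of \<open>x\<close>, counted from the left and from
  \<open>0\<close>, by \<open>f i\<close>. Copies of one formula may carry different annotations along a trace.\<close>

primrec subst_occ :: "var \<Rightarrow> (nat \<Rightarrow> 'a exp) \<Rightarrow> 'a exp \<Rightarrow> 'a exp" where
  "subst_occ x f (FV y) = (if y = x then f 0 else FV y)"
| "subst_occ x f (BV i) = BV i"
| "subst_occ x f Zero = Zero"
| "subst_occ x f (Succ t) = Succ (subst_occ x f t)"
| "subst_occ x f (Eq s t) = Eq (subst_occ x f s) (subst_occ x (\<lambda>i. f (nocc x s + i)) t)"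
| "subst_occ x f (Or \<phi> \<psi>) = Or (subst_occ x f \<phi>) (subst_occ x (\<lambda>i. f (nocc x \<phi> + i)) \<psi>)"
| "subst_occ x f (And \<phi> \<psi>) = And (subst_occ x f \<phi>) (subst_occ x (\<lambda>i. f (nocc x \<phi> + i)) \<psi>)"
| "subst_occ x f (Lam A \<phi>) = Lam A (subst_occ x f \<phi>)"
| "subst_occ x f (App \<phi> \<psi>) = App (subst_occ x f \<phi>) (subst_occ x (\<lambda>i. f (nocc x \<phi> + i)) \<psi>)"
| "subst_occ x f (Fix \<sigma> p T \<phi>) = Fix \<sigma> p T (subst_occ x f \<phi>)"

lemma subst_occ_const: "subst_occ x (\<lambda>_. u) e = subst1 x u e"
  by (induction e) auto


section \<open>Semantics\<close>

text \<open>
  The full monotone function spaces over all types have unbounded cardinality, so no single HOL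
  type contains them all. Function values are therefore represented by codes in a type \<open>'u\<close>. The
  coding must lose no function (\<open>full\<close> below) at the types at hand; \<open>full_zero\<close> and \<open>full_step\<close> show
  that for any given bound on the height of types a suitable \<open>'u\<close> exists.
\<close>

datatype 'u val = Num nat | Truth bool | Fn 'u

record 'u universe =
  code :: "('u val \<Rightarrow> 'u val) \<Rightarrow> 'u"
  decode :: "'u \<Rightarrow> 'u val \<Rightarrow> 'u val"

primrec apply_val :: "'u universe \<Rightarrow> 'u val \<Rightarrow> 'u val \<Rightarrow> 'u val" where
  "apply_val U (Num n) v = undefined"
| "apply_val U (Truth b) v = undefined"
| "apply_val U (Fn u) v = decode U u v"

text \<open>Monotone functions between two ordered sets; a function is normalised to \<open>Num 0\<close> outside its
  domain.\<close>

definition mono_funs ::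
  "'v val set \<times> ('v val \<Rightarrow> 'v val \<Rightarrow> bool) \<Rightarrow> 'v val set \<times> ('v val \<Rightarrow> 'v val \<Rightarrow> bool) \<Rightarrow>
    ('v val \<Rightarrow> 'v val) set" where
  "mono_funs P Q = {f. (\<forall>v\<in>fst P. f v \<in> fst Q) \<and> (\<forall>v. v \<notin> fst P \<longrightarrow> f v = Num 0) \<and>
    (\<forall>v\<in>fst P. \<forall>w\<in>fst P. snd P v w \<longrightarrow> snd Q (f v) (f w))}"

primrec interp :: "'u universe \<Rightarrow> ty \<Rightarrow> 'u val set \<times> ('u val \<Rightarrow> 'u val \<Rightarrow> bool)"
  and interpF :: "'u universe \<Rightarrow> fty \<Rightarrow> 'u val set \<times> ('u val \<Rightarrow> 'u val \<Rightarrow> bool)" where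
  "interp U TNat = (range Num, (=))"
| "interp U (TForm T) = interpF U T"
| "interpF U TOmega = (range Truth, \<lambda>v w. v = Truth True \<longrightarrow> w = Truth True)"
| "interpF U (TFun A T) =
    ({Fn (code U f) |f. f \<in> mono_funs (interp U A) (interpF U T)},
     \<lambda>v w. \<forall>x\<in>fst (interp U A). snd (interpF U T) (apply_val U v x) (apply_val U w x))"

abbreviation dom_ty :: "'u universe \<Rightarrow> ty \<Rightarrow> 'u val set" where
  "dom_ty U A \<equiv> fst (interp U A)"

abbreviation le_ty :: "'u universe \<Rightarrow> ty \<Rightarrow> 'u val \<Rightarrow> 'u val \<Rightarrow> bool" where
  "le_ty U A \<equiv> snd (interp U A)"

text \<open>If \<open>full U A\<close> holds, then hereditarily the carrier of each function type in \<open>A\<close> is in bijection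
  with all monotone functions between the carriers of its components.\<close>

primrec full :: "'u universe \<Rightarrow> ty \<Rightarrow> bool" and fullF :: "'u universe \<Rightarrow> fty \<Rightarrow> bool" where
  "full U TNat \<longleftrightarrow> True"
| "full U (TForm T) \<longleftrightarrow> fullF U T"
| "fullF U TOmega \<longleftrightarrow> True"
| "fullF U (TFun A T) \<longleftrightarrow> full U A \<and> fullF U T \<and>
    (\<forall>f\<in>mono_funs (interp U A) (interpF U T). decode U (code U f) = f)"

definition least_fp :: "'u universe \<Rightarrow> fty \<Rightarrow> ('u val \<Rightarrow> 'u val) \<Rightarrow> 'u val" where
  "least_fp U T f = (THE v. v \<in> dom_ty U (TForm T) \<and> f v = v \<and>
    (\<forall>w\<in>dom_ty U (TForm T). f w = w \<longrightarrow> le_ty U (TForm T) v w))"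

definition greatest_fp :: "'u universe \<Rightarrow> fty \<Rightarrow> ('u val \<Rightarrow> 'u val) \<Rightarrow> 'u val" where
  "greatest_fp U T f = (THE v. v \<in> dom_ty U (TForm T) \<and> f v = v \<and>
    (\<forall>w\<in>dom_ty U (TForm T). f w = w \<longrightarrow> le_ty U (TForm T) w v))"

primrec num_of :: "'u val \<Rightarrow> nat" where
  "num_of (Num n) = n"
| "num_of (Truth b) = undefined"
| "num_of (Fn u) = undefined"

text \<open>\<open>\<rho>\<close> interprets the free variables, the list \<open>\<eta>\<close> the de Bruijn indices.\<close>

primrec sem :: "'u universe \<Rightarrow> (var \<Rightarrow> 'u val) \<Rightarrow> 'u val list \<Rightarrow> 'a exp \<Rightarrow> 'u val" where
  "sem U \<rho> \<eta> (FV x) = \<rho> x"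
| "sem U \<rho> \<eta> (BV i) = \<eta> ! i"
| "sem U \<rho> \<eta> Zero = Num 0"
| "sem U \<rho> \<eta> (Succ t) = Num (Suc (num_of (sem U \<rho> \<eta> t)))"
| "sem U \<rho> \<eta> (Eq s t) = Truth (sem U \<rho> \<eta> s = sem U \<rho> \<eta> t)"
| "sem U \<rho> \<eta> (Or \<phi> \<psi>) = Truth (sem U \<rho> \<eta> \<phi> = Truth True \<or> sem U \<rho> \<eta> \<psi> = Truth True)"
| "sem U \<rho> \<eta> (And \<phi> \<psi>) = Truth (sem U \<rho> \<eta> \<phi> = Truth True \<and> sem U \<rho> \<eta> \<psi> = Truth True)"
| "sem U \<rho> \<eta> (Lam A \<phi>) =
    Fn (code U (\<lambda>v. if v \<in> dom_ty U A then sem U \<rho> (v # \<eta>) \<phi> else Num 0))"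
| "sem U \<rho> \<eta> (App \<phi> \<psi>) = apply_val U (sem U \<rho> \<eta> \<phi>) (sem U \<rho> \<eta> \<psi>)"
| "sem U \<rho> \<eta> (Fix \<sigma> p T \<phi>) =
    (case \<sigma> of Mu \<Rightarrow> least_fp U T (\<lambda>v. sem U \<rho> (v # \<eta>) \<phi>)
             | Nu \<Rightarrow> greatest_fp U T (\<lambda>v. sem U \<rho> (v # \<eta>) \<phi>))"

text \<open>The types of the subexpressions of an expression, where \<open>\<Theta>\<close> types the indices. The types \<open>TNat\<close>
  and \<open>TForm TOmega\<close> (always full) are left out where they are the type of a compound expression,
  and so is the type of an application, which is a component of the type of its head.\<close>

primrec types_of :: "ty list \<Rightarrow> 'a exp \<Rightarrow> ty set" where
  "types_of \<Theta> (FV x) = {snd x}"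
| "types_of \<Theta> (BV i) = {\<Theta> ! i}"
| "types_of \<Theta> Zero = {}"
| "types_of \<Theta> (Succ t) = types_of \<Theta> t"
| "types_of \<Theta> (Eq s t) = types_of \<Theta> s \<union> types_of \<Theta> t"
| "types_of \<Theta> (Or \<phi> \<psi>) = types_of \<Theta> \<phi> \<union> types_of \<Theta> \<psi>"
| "types_of \<Theta> (And \<phi> \<psi>) = types_of \<Theta> \<phi> \<union> types_of \<Theta> \<psi>"
| "types_of \<Theta> (Lam A \<phi>) = {B. has_type \<Theta> (Lam A \<phi>) B} \<union> types_of (A # \<Theta>) \<phi>"
| "types_of \<Theta> (App \<phi> \<psi>) = types_of \<Theta> \<phi> \<union> types_of \<Theta> \<psi>"
| "types_of \<Theta> (Fix \<sigma> p T \<phi>) = {TForm T} \<union> types_of (TForm T # \<Theta>) \<phi>"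


subsection \<open>Existence of full universes\<close>

primrec height :: "ty \<Rightarrow> nat" and heightF :: "fty \<Rightarrow> nat" where
  "height TNat = 0"
| "height (TForm T) = heightF T"
| "heightF TOmega = 0"
| "heightF (TFun A T) = Suc (max (height A) (heightF T))"

lemma full_zero: "height A = 0 \<Longrightarrow> full U A"
proof (cases A)
  case (TForm T)
  assume "height A = 0"
  then show ?thesis using TForm by (cases T) auto
qed simp

lemma full_step:
  fixes U :: "'u universe"
  assumes full: "\<And>A. height A \<le> n \<Longrightarrow> full U A"
  shows "\<exists>U' :: ('u + ('u val \<Rightarrow> 'u val)) universe. \<forall>A. height A \<le> Suc n \<longrightarrow> full U' A"
proof -
  define inc :: "'u val \<Rightarrow> ('u + ('u val \<Rightarrow> 'u val)) val" where "inc = map_val Inl"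
  define out :: "('u + ('u val \<Rightarrow> 'u val)) val \<Rightarrow> 'u val" where "out = inv inc"
  define up where "up = (\<lambda>g w. if w \<in> range inc then inc (g (out w)) else Num 0)"
  define down where "down = (\<lambda>f v. out (f (inc v)))"
  define U' where "U' = \<lparr>code = (\<lambda>f. if decode U (code U (down f)) = down f
      then Inl (code U (down f)) else Inr (down f)),
    decode = case_sum (\<lambda>u. up (decode U u)) up\<rparr>"
  have inj: "inj inc"
    unfolding inc_def by (intro val.inj_map) auto
  have out_inc [simp]: "out (inc v) = v" for v
    unfolding out_def using inj by simp
  have inc_inj [simp]: "inc v = inc w \<longleftrightarrow> v = w" for v w
    using inj by (auto dest: injD)
  have inc_Num: "inc (Num m) = Num m" and inc_Truth: "inc (Truth b) = Truth b"
    and inc_Fn: "inc (Fn u) = Fn (Inl u)" for m b u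
    by (simp_all add: inc_def)
  have up_inc [simp]: "up g (inc v) = inc (g v)" for g v
    by (simp add: up_def)
  have down_up [simp]: "down (up g) = g" for g
    by (simp add: down_def)
  have code_up: "decode U' (code U' (up g)) = up g" for g
    by (simp add: U'_def)
  have funs: "mono_funs P' Q' = up ` mono_funs P Q"
    if P: "fst P' = inc ` fst P" "\<And>v w. v \<in> fst P \<Longrightarrow> w \<in> fst P \<Longrightarrow> snd P' (inc v) (inc w) = snd P v w"
      and Q: "fst Q' = inc ` fst Q" "\<And>v w. v \<in> fst Q \<Longrightarrow> w \<in> fst Q \<Longrightarrow> snd Q' (inc v) (inc w) = snd Q v w"
    for P Q P' Q'
  proof (intro subset_antisym subsetI)
    fix f assume f: "f \<in> mono_funs P' Q'"
    have val: "\<exists>u\<in>fst Q. f (inc v) = inc u" if "v \<in> fst P" for v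
      using f P Q that unfolding mono_funs_def by auto
    have zero: "f w = Num 0" if "w \<notin> inc ` fst P" for w
      using f P that unfolding mono_funs_def by auto
    have "f w = up (down f) w" for w
    proof (cases "w \<in> range inc")
      case True
      then obtain v where v: "w = inc v" by auto
      show ?thesis
      proof (cases "v \<in> fst P")
        case True
        then show ?thesis using val[OF True] v by (auto simp: down_def)
      next
        case False
        then have "f w = inc (Num 0)"
          using v zero[of w] by (auto simp: inc_Num image_iff)
        then show ?thesis using v by (simp add: down_def)
      qed
    next
      case False
      then show ?thesis using zero[of w] by (auto simp: up_def image_iff)
    qed
    then have "f = up (down f)" by blast
    moreover have "down f \<in> mono_funs P Q"
    proof -
      have "down f v \<in> fst Q" if "v \<in> fst P" for v
        using val[OF that] by (auto simp: down_def)
      moreover have "down f v = Num 0" if "v \<notin> fst P" for v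
      proof -
        have "f (inc v) = inc (Num 0)" using zero[of "inc v"] that by (auto simp: inc_Num image_iff)
        then show ?thesis by (simp add: down_def)
      qed
      moreover have "snd Q (down f v) (down f w)" if vw: "v \<in> fst P" "w \<in> fst P" "snd P v w" for v w
      proof -
        have "snd Q' (f (inc v)) (f (inc w))"
          using f P vw unfolding mono_funs_def by auto
        then show ?thesis
          using val[OF vw(1)] val[OF vw(2)] Q by (auto simp: down_def)
      qed
      ultimately show ?thesis by (auto simp: mono_funs_def)
    qed
    ultimately show "f \<in> up ` mono_funs P Q" by blast
  next
    fix f assume "f \<in> up ` mono_funs P Q"
    then obtain g where g: "f = up g" "g \<in> mono_funs P Q" by blast
    have "up g w = Num 0" if "w \<notin> inc ` fst P" for w
      using that g(2) by (cases "w \<in> range inc") (auto simp: up_def mono_funs_def inc_Num)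
    then show "f \<in> mono_funs P' Q'"
      using g P Q by (auto simp: mono_funs_def)
  qed
  have iso: "height A \<le> n \<Longrightarrow> dom_ty U' A = inc ` dom_ty U A \<and>
      (\<forall>v\<in>dom_ty U A. \<forall>w\<in>dom_ty U A. le_ty U' A (inc v) (inc w) = le_ty U A v w)"
    and isoF: "heightF T \<le> n \<Longrightarrow> fst (interpF U' T) = inc ` fst (interpF U T) \<and>
      (\<forall>v\<in>fst (interpF U T). \<forall>w\<in>fst (interpF U T).
        snd (interpF U' T) (inc v) (inc w) = snd (interpF U T) v w)" for A T
  proof (induction A and T rule: ty.induct fty.induct)
    case TNat
    show ?case by (auto simp: inc_Num image_image)
  next
    case TOmega
    show ?case by (auto simp: inc_Truth image_image)
  next
    case (TFun A T)
    have h: "height A \<le> n" "heightF T \<le> n" using TFun.prems by auto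
    note IH = TFun.IH(1)[OF h(1)] TFun.IH(2)[OF h(2)]
    have funs': "mono_funs (interp U' A) (interpF U' T) = up ` mono_funs (interp U A) (interpF U T)"
      using IH by (intro funs) auto
    have dec: "decode U (code U g) = g" if "g \<in> mono_funs (interp U A) (interpF U T)" for g
      using full[of "TForm (TFun A T)"] TFun.prems that by auto
    have code: "Fn (code U' (up g)) = inc (Fn (code U g))"
      if "g \<in> mono_funs (interp U A) (interpF U T)" for g
      using dec[OF that] by (simp add: U'_def inc_Fn)
    have ap: "apply_val U' (inc (Fn u)) (inc x) = inc (apply_val U (Fn u) x)" for u x
      by (simp add: U'_def inc_Fn)
    have dom: "fst (interpF U' (TFun A T)) = inc ` fst (interpF U (TFun A T))"
      using code by (force simp: funs')
    have in_dom: "decode U (code U g) x \<in> fst (interpF U T)"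
      if "g \<in> mono_funs (interp U A) (interpF U T)" "x \<in> dom_ty U A" for g x
      using that dec by (auto simp: mono_funs_def)
    have "snd (interpF U' (TFun A T)) (inc v) (inc w) = snd (interpF U (TFun A T)) v w"
      if vw: "v \<in> fst (interpF U (TFun A T))" "w \<in> fst (interpF U (TFun A T))" for v w
    proof -
      obtain f g where fg: "f \<in> mono_funs (interp U A) (interpF U T)" "v = Fn (code U f)"
          "g \<in> mono_funs (interp U A) (interpF U T)" "w = Fn (code U g)"
        using vw by auto
      have "snd (interpF U' T) (apply_val U' (inc v) (inc x)) (apply_val U' (inc w) (inc x)) =
          snd (interpF U T) (apply_val U v x) (apply_val U w x)" if "x \<in> dom_ty U A" for x
        using in_dom[OF fg(1) that] in_dom[OF fg(3) that] IH(2) fg(2,4) unfolding fg(2,4) ap by simp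
      then show ?thesis using IH(1) by auto
    qed
    then show ?case using dom by blast
  qed auto
  have "height A \<le> Suc n \<Longrightarrow> full U' A" and "heightF T \<le> Suc n \<Longrightarrow> fullF U' T" for A T
  proof (induction A and T rule: ty.induct fty.induct)
    case (TFun A T)
    have h: "height A \<le> n" "heightF T \<le> n" using TFun.prems by auto
    have "mono_funs (interp U' A) (interpF U' T) = up ` mono_funs (interp U A) (interpF U T)"
      using iso[OF h(1)] isoF[OF h(2)] by (intro funs) auto
    then show ?case using TFun h code_up by auto
  qed auto
  then show ?thesis by blast
qed


section \<open>Sequents\<close>

type_synonym sequent = "fm list \<times> fm list"

definition fvs_seq :: "sequent \<Rightarrow> var set" where
  "fvs_seq S = (\<Union>\<phi>\<in>set (fst S) \<union> set (snd S). fvs \<phi>)"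

definition typed_seq :: "sequent \<Rightarrow> bool" where
  "typed_seq S \<longleftrightarrow> (\<forall>\<phi>\<in>set (fst S) \<union> set (snd S). has_type [] \<phi> (TForm TOmega))"

definition full_seq :: "'u universe \<Rightarrow> sequent \<Rightarrow> bool" where
  "full_seq U S \<longleftrightarrow> (\<forall>\<phi>\<in>set (fst S) \<union> set (snd S). \<forall>A\<in>types_of [] \<phi>. full U A)"

definition valid :: "'u universe \<Rightarrow> sequent \<Rightarrow> bool" where
  "valid U S \<longleftrightarrow> (\<forall>\<rho>. (\<forall>x\<in>fvs_seq S. \<rho> x \<in> dom_ty U (snd x)) \<longrightarrow>
    (\<exists>\<phi>\<in>set (fst S). sem U \<rho> [] \<phi> = Truth False) \<or>
    (\<exists>\<psi>\<in>set (snd S). sem U \<rho> [] \<psi> = Truth True))"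

definition no_higher_order_fvs :: "sequent \<Rightarrow> bool" where
  "no_higher_order_fvs S \<longleftrightarrow>
    (\<forall>x\<in>fvs_seq S. snd x = TNat \<or> (\<exists>k. snd x = TForm ((TFun TNat ^^ k) TOmega)))"


section \<open>Rules\<close>

text \<open>\<open>ex_nat \<theta>\<close> is \<open>(\<mu>Y. \<lambda>x'. \<theta> \<or> Y (S x')) Z\<close>; in \<open>\<theta>\<close>, index \<open>0\<close> is \<open>x'\<close> and index \<open>1\<close> is the binder
  of \<open>Y\<close>, which \<open>\<theta>\<close> must not use. In \<open>nat_pred\<close>, the indices \<open>2\<close> and \<open>3\<close> are \<open>x\<close> and \<open>X\<close>.\<close>

definition ex_nat :: "fm \<Rightarrow> fm" where
  "ex_nat \<theta> = App (Fix Mu () (TFun TNat TOmega)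
    (Lam TNat (Or \<theta> (App (BV 1) (Succ (BV 0)))))) Zero"

definition nat_pred :: fm where
  "nat_pred = Fix Mu () (TFun TNat TOmega) (Lam TNat (Or (Eq (BV 0) Zero)
    (ex_nat (And (Eq (BV 2) (Succ (BV 0))) (App (BV 3) (BV 0))))))"

lemma nat_pred_type: "has_type [] nat_pred (TForm (TFun TNat TOmega))"
proof -
  have var: "i < length \<Theta> \<Longrightarrow> \<Theta> ! i = A \<Longrightarrow> has_type \<Theta> (BV i) A" for i \<Theta> A
    using has_type.intros(2) by blast
  show ?thesis
    unfolding nat_pred_def ex_nat_def
    by (rule has_type.intros var | simp)+
qed

text \<open>Rule instances. A sequent \<open>\<Gamma>, \<phi> \<turnstile> \<psi>, \<Delta>\<close> is the pair \<open>(\<Gamma> @ [\<phi>], \<psi> # \<Delta>)\<close>. The instantiating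
  expressions of \<open>Subst\<close>, \<open>LamL\<close> and \<open>LamR\<close> are formulas or terms, according to the type of the
  variable.\<close>

datatype rule =
    Axiom fm
  | Cut "fm list" fm "fm list"
  | WeakL "fm list" fm "fm list"
  | WeakR "fm list" fm "fm list"
  | ContrL "fm list" fm "fm list"
  | ContrR "fm list" fm "fm list"
  | ExchL "fm list" fm fm "fm list" "fm list"
  | ExchR "fm list" "fm list" fm fm "fm list"
  | Subst "fm list" "fm list" var fm
  | Mono "fm list" "fm list" var fm fm fm "var list"
  | EqL "fm list" "fm list" var var fm fm
  | EqR "fm list" fm "fm list"
  | OrL "fm list" fm fm "fm list"
  | OrR "fm list" fm fm "fm list"
  | AndL "fm list" fm fm "fm list"
  | AndR "fm list" fm fm "fm list"
  | LamL "fm list" ty fm fm "fm list" "fm list"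
  | LamR "fm list" ty fm fm "fm list" "fm list"
  | FixL "fm list" fixkind fty fm "fm list" "fm list"
  | FixR "fm list" fixkind fty fm "fm list" "fm list"
  | NatIntro "fm list" nat "fm list"
  | P1 fm
  | P2 "fm list" fm fm "fm list"

primrec concl :: "rule \<Rightarrow> sequent" where
  "concl (Axiom \<phi>) = ([\<phi>], [\<phi>])"
| "concl (Cut \<Gamma> \<phi> \<Delta>) = (\<Gamma>, \<Delta>)"
| "concl (WeakL \<Gamma> \<phi> \<Delta>) = (\<Gamma> @ [\<phi>], \<Delta>)"
| "concl (WeakR \<Gamma> \<phi> \<Delta>) = (\<Gamma>, \<phi> # \<Delta>)"
| "concl (ContrL \<Gamma> \<phi> \<Delta>) = (\<Gamma> @ [\<phi>], \<Delta>)"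
| "concl (ContrR \<Gamma> \<phi> \<Delta>) = (\<Gamma>, \<phi> # \<Delta>)"
| "concl (ExchL \<Gamma> \<phi> \<psi> \<Gamma>' \<Delta>) = (\<Gamma> @ [\<phi>, \<psi>] @ \<Gamma>', \<Delta>)"
| "concl (ExchR \<Gamma> \<Delta> \<phi> \<psi> \<Delta>') = (\<Gamma>, \<Delta> @ [\<phi>, \<psi>] @ \<Delta>')"
| "concl (Subst \<Gamma> \<Delta> x \<phi>) = (map (subst1 x \<phi>) \<Gamma>, map (subst1 x \<phi>) \<Delta>)"
| "concl (Mono \<Gamma> \<Delta> x \<phi> \<psi> \<chi> ys) = (\<Gamma> @ [subst1 x \<psi> \<phi>], subst1 x \<chi> \<phi> # \<Delta>)"
| "concl (EqL \<Gamma> \<Delta> x y s t) = (map (subst2 x s y t) \<Gamma> @ [Eq s t], map (subst2 x s y t) \<Delta>)"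
| "concl (EqR \<Gamma> t \<Delta>) = (\<Gamma>, Eq t t # \<Delta>)"
| "concl (OrL \<Gamma> \<phi> \<psi> \<Delta>) = (\<Gamma> @ [Or \<phi> \<psi>], \<Delta>)"
| "concl (OrR \<Gamma> \<phi> \<psi> \<Delta>) = (\<Gamma>, Or \<phi> \<psi> # \<Delta>)"
| "concl (AndL \<Gamma> \<phi> \<psi> \<Delta>) = (\<Gamma> @ [And \<phi> \<psi>], \<Delta>)"
| "concl (AndR \<Gamma> \<phi> \<psi> \<Delta>) = (\<Gamma>, And \<phi> \<psi> # \<Delta>)"
| "concl (LamL \<Gamma> A \<phi> \<psi> \<psi>s \<Delta>) = (\<Gamma> @ [apps (App (Lam A \<phi>) \<psi>) \<psi>s], \<Delta>)"
| "concl (LamR \<Gamma> A \<phi> \<psi> \<psi>s \<Delta>) = (\<Gamma>, apps (App (Lam A \<phi>) \<psi>) \<psi>s # \<Delta>)"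
| "concl (FixL \<Gamma> \<sigma> T \<phi> \<psi>s \<Delta>) = (\<Gamma> @ [apps (Fix \<sigma> () T \<phi>) \<psi>s], \<Delta>)"
| "concl (FixR \<Gamma> \<sigma> T \<phi> \<psi>s \<Delta>) = (\<Gamma>, apps (Fix \<sigma> () T \<phi>) \<psi>s # \<Delta>)"
| "concl (NatIntro \<Gamma> x \<Delta>) = (\<Gamma>, \<Delta>)"
| "concl (P1 s) = ([Eq (Succ s) Zero], [])"
| "concl (P2 \<Gamma> s t \<Delta>) = (\<Gamma> @ [Eq (Succ s) (Succ t)], \<Delta>)"

primrec prems :: "rule \<Rightarrow> sequent list" where
  "prems (Axiom \<phi>) = []"
| "prems (Cut \<Gamma> \<phi> \<Delta>) = [(\<Gamma>, \<phi> # \<Delta>), (\<Gamma> @ [\<phi>], \<Delta>)]"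
| "prems (WeakL \<Gamma> \<phi> \<Delta>) = [(\<Gamma>, \<Delta>)]"
| "prems (WeakR \<Gamma> \<phi> \<Delta>) = [(\<Gamma>, \<Delta>)]"
| "prems (ContrL \<Gamma> \<phi> \<Delta>) = [(\<Gamma> @ [\<phi>, \<phi>], \<Delta>)]"
| "prems (ContrR \<Gamma> \<phi> \<Delta>) = [(\<Gamma>, \<phi> # \<phi> # \<Delta>)]"
| "prems (ExchL \<Gamma> \<phi> \<psi> \<Gamma>' \<Delta>) = [(\<Gamma> @ [\<psi>, \<phi>] @ \<Gamma>', \<Delta>)]"
| "prems (ExchR \<Gamma> \<Delta> \<phi> \<psi> \<Delta>') = [(\<Gamma>, \<Delta> @ [\<psi>, \<phi>] @ \<Delta>')]"
| "prems (Subst \<Gamma> \<Delta> x \<phi>) = [(\<Gamma>, \<Delta>)]"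
| "prems (Mono \<Gamma> \<Delta> x \<phi> \<psi> \<chi> ys) =
    replicate (nocc x \<phi>) (\<Gamma> @ [apps \<psi> (map FV ys)], apps \<chi> (map FV ys) # \<Delta>)"
| "prems (EqL \<Gamma> \<Delta> x y s t) = [(map (subst2 x t y s) \<Gamma>, map (subst2 x t y s) \<Delta>)]"
| "prems (EqR \<Gamma> t \<Delta>) = []"
| "prems (OrL \<Gamma> \<phi> \<psi> \<Delta>) = [(\<Gamma> @ [\<phi>], \<Delta>), (\<Gamma> @ [\<psi>], \<Delta>)]"
| "prems (OrR \<Gamma> \<phi> \<psi> \<Delta>) = [(\<Gamma>, \<phi> # \<psi> # \<Delta>)]"
| "prems (AndL \<Gamma> \<phi> \<psi> \<Delta>) = [(\<Gamma> @ [\<phi>, \<psi>], \<Delta>)]"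
| "prems (AndR \<Gamma> \<phi> \<psi> \<Delta>) = [(\<Gamma>, \<phi> # \<Delta>), (\<Gamma>, \<psi> # \<Delta>)]"
| "prems (LamL \<Gamma> A \<phi> \<psi> \<psi>s \<Delta>) = [(\<Gamma> @ [apps (inst 0 \<psi> \<phi>) \<psi>s], \<Delta>)]"
| "prems (LamR \<Gamma> A \<phi> \<psi> \<psi>s \<Delta>) = [(\<Gamma>, apps (inst 0 \<psi> \<phi>) \<psi>s # \<Delta>)]"
| "prems (FixL \<Gamma> \<sigma> T \<phi> \<psi>s \<Delta>) = [(\<Gamma> @ [apps (inst 0 (Fix \<sigma> () T \<phi>) \<phi>) \<psi>s], \<Delta>)]"
| "prems (FixR \<Gamma> \<sigma> T \<phi> \<psi>s \<Delta>) = [(\<Gamma>, apps (inst 0 (Fix \<sigma> () T \<phi>) \<phi>) \<psi>s # \<Delta>)]"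
| "prems (NatIntro \<Gamma> x \<Delta>) = [(\<Gamma> @ [App nat_pred (FV (x, TNat))], \<Delta>)]"
| "prems (P1 s) = []"
| "prems (P2 \<Gamma> s t \<Delta>) = [(\<Gamma> @ [Eq s t], \<Delta>)]"

text \<open>Conditions not implied by typing of the conclusion and of the premises.\<close>

definition rule_ok :: "rule \<Rightarrow> bool" where
  "rule_ok r = (case r of
     Subst \<Gamma> \<Delta> x \<phi> \<Rightarrow> has_type [] \<phi> (snd x)
   | Mono \<Gamma> \<Delta> x \<phi> \<psi> \<chi> ys \<Rightarrow>
       snd x = TForm (foldr TFun (map snd ys) TOmega) \<and>
       has_type [] \<phi> (TForm TOmega) \<and> has_type [] \<psi> (snd x) \<and> has_type [] \<chi> (snd x) \<and>
       distinct ys \<and> set ys \<inter> (fvs_seq (\<Gamma>, \<Delta>) \<union> fvs \<phi> \<union> fvs \<psi> \<union> fvs \<chi>) = {}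
   | EqL \<Gamma> \<Delta> x y s t \<Rightarrow> x \<noteq> y \<and> snd x = TNat \<and> snd y = TNat
   | _ \<Rightarrow> True)"

primrec logical :: "rule \<Rightarrow> bool" where
  "logical (Axiom \<phi>) = False"
| "logical (Cut \<Gamma> \<phi> \<Delta>) = False"
| "logical (WeakL \<Gamma> \<phi> \<Delta>) = False"
| "logical (WeakR \<Gamma> \<phi> \<Delta>) = False"
| "logical (ContrL \<Gamma> \<phi> \<Delta>) = False"
| "logical (ContrR \<Gamma> \<phi> \<Delta>) = False"
| "logical (ExchL \<Gamma> \<phi> \<psi> \<Gamma>' \<Delta>) = False"
| "logical (ExchR \<Gamma> \<Delta> \<phi> \<psi> \<Delta>') = False"
| "logical (Subst \<Gamma> \<Delta> x \<phi>) = False"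
| "logical (Mono \<Gamma> \<Delta> x \<phi> \<psi> \<chi> ys) = False"
| "logical (EqL \<Gamma> \<Delta> x y s t) = True"
| "logical (EqR \<Gamma> t \<Delta>) = True"
| "logical (OrL \<Gamma> \<phi> \<psi> \<Delta>) = True"
| "logical (OrR \<Gamma> \<phi> \<psi> \<Delta>) = True"
| "logical (AndL \<Gamma> \<phi> \<psi> \<Delta>) = True"
| "logical (AndR \<Gamma> \<phi> \<psi> \<Delta>) = True"
| "logical (LamL \<Gamma> A \<phi> \<psi> \<psi>s \<Delta>) = True"
| "logical (LamR \<Gamma> A \<phi> \<psi> \<psi>s \<Delta>) = True"
| "logical (FixL \<Gamma> \<sigma> T \<phi> \<psi>s \<Delta>) = True"
| "logical (FixR \<Gamma> \<sigma> T \<phi> \<psi>s \<Delta>) = True"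
| "logical (NatIntro \<Gamma> x \<Delta>) = False"
| "logical (P1 s) = False"
| "logical (P2 \<Gamma> s t \<Delta>) = False"


section \<open>Occurrences and traces\<close>

datatype side = Lhs | Rhs

type_synonym occ = "side \<times> nat"

primrec occs :: "sequent \<Rightarrow> side \<Rightarrow> fm list" where
  "occs S Lhs = fst S"
| "occs S Rhs = snd S"

abbreviation fm_at :: "sequent \<Rightarrow> occ \<Rightarrow> fm" where
  "fm_at S q \<equiv> occs S (fst q) ! snd q"

text \<open>The lengths of \<open>\<Gamma>\<close> and of \<open>\<Delta>\<close>. These are the first formulas on the left and the last ones on the
  right, in the conclusion and in each premise. On the side on which an exchange acts, \<open>0\<close> is used
  and the correspondence is given by separate clauses of \<open>relevant\<close>.\<close>

primrec ctx_len :: "rule \<Rightarrow> side \<Rightarrow> nat" where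
  "ctx_len (Axiom \<phi>) = (\<lambda>_. 0)"
| "ctx_len (Cut \<Gamma> \<phi> \<Delta>) = case_side (length \<Gamma>) (length \<Delta>)"
| "ctx_len (WeakL \<Gamma> \<phi> \<Delta>) = case_side (length \<Gamma>) (length \<Delta>)"
| "ctx_len (WeakR \<Gamma> \<phi> \<Delta>) = case_side (length \<Gamma>) (length \<Delta>)"
| "ctx_len (ContrL \<Gamma> \<phi> \<Delta>) = case_side (length \<Gamma>) (length \<Delta>)"
| "ctx_len (ContrR \<Gamma> \<phi> \<Delta>) = case_side (length \<Gamma>) (length \<Delta>)"
| "ctx_len (ExchL \<Gamma> \<phi> \<psi> \<Gamma>' \<Delta>) = case_side 0 (length \<Delta>)"
| "ctx_len (ExchR \<Gamma> \<Delta> \<phi> \<psi> \<Delta>') = case_side (length \<Gamma>) 0"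
| "ctx_len (Subst \<Gamma> \<Delta> x \<phi>) = case_side (length \<Gamma>) (length \<Delta>)"
| "ctx_len (Mono \<Gamma> \<Delta> x \<phi> \<psi> \<chi> ys) = case_side (length \<Gamma>) (length \<Delta>)"
| "ctx_len (EqL \<Gamma> \<Delta> x y s t) = case_side (length \<Gamma>) (length \<Delta>)"
| "ctx_len (EqR \<Gamma> t \<Delta>) = case_side (length \<Gamma>) (length \<Delta>)"
| "ctx_len (OrL \<Gamma> \<phi> \<psi> \<Delta>) = case_side (length \<Gamma>) (length \<Delta>)"
| "ctx_len (OrR \<Gamma> \<phi> \<psi> \<Delta>) = case_side (length \<Gamma>) (length \<Delta>)"
| "ctx_len (AndL \<Gamma> \<phi> \<psi> \<Delta>) = case_side (length \<Gamma>) (length \<Delta>)"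
| "ctx_len (AndR \<Gamma> \<phi> \<psi> \<Delta>) = case_side (length \<Gamma>) (length \<Delta>)"
| "ctx_len (LamL \<Gamma> A \<phi> \<psi> \<psi>s \<Delta>) = case_side (length \<Gamma>) (length \<Delta>)"
| "ctx_len (LamR \<Gamma> A \<phi> \<psi> \<psi>s \<Delta>) = case_side (length \<Gamma>) (length \<Delta>)"
| "ctx_len (FixL \<Gamma> \<sigma> T \<phi> \<psi>s \<Delta>) = case_side (length \<Gamma>) (length \<Delta>)"
| "ctx_len (FixR \<Gamma> \<sigma> T \<phi> \<psi>s \<Delta>) = case_side (length \<Gamma>) (length \<Delta>)"
| "ctx_len (NatIntro \<Gamma> x \<Delta>) = case_side (length \<Gamma>) (length \<Delta>)"
| "ctx_len (P1 s) = (\<lambda>_. 0)"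
| "ctx_len (P2 \<Gamma> s t \<Delta>) = case_side (length \<Gamma>) (length \<Delta>)"

text \<open>\<open>ctx_occ r S q i\<close> is the occurrence in \<open>S\<close>, the conclusion or a premise of \<open>r\<close>, of the \<open>i\<close>-th formula
  of \<open>\<Gamma>\<close> or \<open>\<Delta>\<close>, depending on the side \<open>q\<close>.\<close>

definition ctx_occ :: "rule \<Rightarrow> sequent \<Rightarrow> side \<Rightarrow> nat \<Rightarrow> occ" where
  "ctx_occ r S q i =
    (q, case q of Lhs \<Rightarrow> i | Rhs \<Rightarrow> length (snd S) - ctx_len r Rhs + i)"

definition principal :: "rule \<Rightarrow> occ \<Rightarrow> bool" where
  "principal r q \<longleftrightarrow> snd q < length (occs (concl r) (fst q)) \<and>
    \<not> (\<exists>i < ctx_len r (fst q). q = ctx_occ r (concl r) (fst q) i)"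

definition swap_at :: "nat \<Rightarrow> nat \<Rightarrow> nat" where
  "swap_at n i = (if i = n then Suc n else if i = Suc n then n else i)"

text \<open>\<open>relevant r j q q'\<close>: the occurrence \<open>q'\<close> in the \<open>j\<close>-th premise of \<open>r\<close> is relevant to the occurrence
  \<open>q\<close> in its conclusion.\<close>

inductive relevant :: "rule \<Rightarrow> nat \<Rightarrow> occ \<Rightarrow> occ \<Rightarrow> bool" where
  side: "j < length (prems r) \<Longrightarrow> i < ctx_len r q \<Longrightarrow>
    relevant r j (ctx_occ r (concl r) q i) (ctx_occ r (prems r ! j) q i)"
| contrL: "i < 2 \<Longrightarrow> relevant (ContrL \<Gamma> \<phi> \<Delta>) 0 (Lhs, length \<Gamma>) (Lhs, length \<Gamma> + i)"
| contrR: "i < 2 \<Longrightarrow> relevant (ContrR \<Gamma> \<phi> \<Delta>) 0 (Rhs, 0) (Rhs, i)"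
| exchL: "i < length (\<Gamma> @ [\<phi>, \<psi>] @ \<Gamma>') \<Longrightarrow>
    relevant (ExchL \<Gamma> \<phi> \<psi> \<Gamma>' \<Delta>) 0 (Lhs, i) (Lhs, swap_at (length \<Gamma>) i)"
| exchR: "i < length (\<Delta> @ [\<phi>, \<psi>] @ \<Delta>') \<Longrightarrow>
    relevant (ExchR \<Gamma> \<Delta> \<phi> \<psi> \<Delta>') 0 (Rhs, i) (Rhs, swap_at (length \<Delta>) i)"
| monoL: "j < nocc x \<phi> \<Longrightarrow>
    relevant (Mono \<Gamma> \<Delta> x \<phi> \<psi> \<chi> ys) j (Lhs, length \<Gamma>) (Lhs, length \<Gamma>)"
| monoR: "j < nocc x \<phi> \<Longrightarrow> relevant (Mono \<Gamma> \<Delta> x \<phi> \<psi> \<chi> ys) j (Rhs, 0) (Rhs, 0)"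
| orL: "j < 2 \<Longrightarrow> relevant (OrL \<Gamma> \<phi> \<psi> \<Delta>) j (Lhs, length \<Gamma>) (Lhs, length \<Gamma>)"
| orR: "i < 2 \<Longrightarrow> relevant (OrR \<Gamma> \<phi> \<psi> \<Delta>) 0 (Rhs, 0) (Rhs, i)"
| andL: "i < 2 \<Longrightarrow> relevant (AndL \<Gamma> \<phi> \<psi> \<Delta>) 0 (Lhs, length \<Gamma>) (Lhs, length \<Gamma> + i)"
| andR: "j < 2 \<Longrightarrow> relevant (AndR \<Gamma> \<phi> \<psi> \<Delta>) j (Rhs, 0) (Rhs, 0)"
| lamL: "relevant (LamL \<Gamma> A \<phi> \<psi> \<psi>s \<Delta>) 0 (Lhs, length \<Gamma>) (Lhs, length \<Gamma>)"
| lamR: "relevant (LamR \<Gamma> A \<phi> \<psi> \<psi>s \<Delta>) 0 (Rhs, 0) (Rhs, 0)"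
| fixL: "relevant (FixL \<Gamma> \<sigma> T \<phi> \<psi>s \<Delta>) 0 (Lhs, length \<Gamma>) (Lhs, length \<Gamma>)"
| fixR: "relevant (FixR \<Gamma> \<sigma> T \<phi> \<psi>s \<Delta>) 0 (Rhs, 0) (Rhs, 0)"
| p2: "relevant (P2 \<Gamma> s t \<Delta>) 0 (Lhs, length \<Gamma>) (Lhs, length \<Gamma>)"

abbreviation erase :: "'a exp \<Rightarrow> fm" where
  "erase \<equiv> map_exp (\<lambda>_. ())"

abbreviation eps :: "fm \<Rightarrow> afm" where
  "eps \<equiv> map_exp (\<lambda>_. [])"

text \<open>
  \<open>annot r j k q q' a a'\<close>: if \<open>a\<close> is the annotated formula at \<open>q\<close> and the trace proceeds to \<open>q'\<close> in the
  \<open>j\<close>-th premise, then \<open>a'\<close> is the annotated formula there; \<open>k\<close> is the fresh number of an unfolding.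
  In \<open>Subst\<close> the formula in the premise keeps the annotations outside the substituted copies; in \<open>EqL\<close>
  both formulas arise from \<open>c\<close> by substituting terms, which contain no operators.
\<close>

definition annot :: "rule \<Rightarrow> nat \<Rightarrow> nat \<Rightarrow> occ \<Rightarrow> occ \<Rightarrow> afm \<Rightarrow> afm \<Rightarrow> bool" where
  "annot r j k q q' a a' =
    (if \<not> principal r q
     then (case r of
         Subst \<Gamma> \<Delta> x \<phi> \<Rightarrow> \<exists>f. a = subst_occ x f a'
       | EqL \<Gamma> \<Delta> x y s t \<Rightarrow>
           \<exists>c. a = subst2 x (eps s) y (eps t) c \<and> a' = subst2 x (eps t) y (eps s) c
       | _ \<Rightarrow> a' = a)
     else (case r of
         Mono \<Gamma> \<Delta> x \<phi> \<psi> \<chi> ys \<Rightarrow>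
           \<exists>c f. erase c = \<phi> \<and> a = subst_occ x f c \<and> a' = apps (f j) (map FV ys)
       | OrL \<Gamma> \<phi> \<psi> \<Delta> \<Rightarrow> \<exists>c d. a = Or c d \<and> a' = (if j = 0 then c else d)
       | OrR \<Gamma> \<phi> \<psi> \<Delta> \<Rightarrow> \<exists>c d. a = Or c d \<and> a' = (if snd q' = 0 then c else d)
       | AndL \<Gamma> \<phi> \<psi> \<Delta> \<Rightarrow> \<exists>c d. a = And c d \<and> a' = (if snd q' = length \<Gamma> then c else d)
       | AndR \<Gamma> \<phi> \<psi> \<Delta> \<Rightarrow> \<exists>c d. a = And c d \<and> a' = (if j = 0 then c else d)
       | LamL \<Gamma> A \<phi> \<psi> \<psi>s \<Delta> \<Rightarrow>
           \<exists>c d ds. a = apps (App (Lam A c) d) ds \<and> a' = apps (inst 0 d c) ds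
       | LamR \<Gamma> A \<phi> \<psi> \<psi>s \<Delta> \<Rightarrow>
           \<exists>c d ds. a = apps (App (Lam A c) d) ds \<and> a' = apps (inst 0 d c) ds
       | FixL \<Gamma> \<sigma> T \<phi> \<psi>s \<Delta> \<Rightarrow>
           \<exists>p c ds. a = apps (Fix \<sigma> p T c) ds \<and> a' = apps (inst 0 (Fix \<sigma> (p @ [k]) T c) c) ds
       | FixR \<Gamma> \<sigma> T \<phi> \<psi>s \<Delta> \<Rightarrow>
           \<exists>p c ds. a = apps (Fix \<sigma> p T c) ds \<and> a' = apps (inst 0 (Fix \<sigma> (p @ [k]) T c) c) ds
       | P2 \<Gamma> s t \<Delta> \<Rightarrow> \<exists>c d. a = Eq (Succ c) (Succ d) \<and> a' = Eq c d
       | _ \<Rightarrow> a' = a))"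

primrec anns :: "fixkind \<Rightarrow> 'a exp \<Rightarrow> 'a set" where
  "anns \<sigma> (FV x) = {}"
| "anns \<sigma> (BV i) = {}"
| "anns \<sigma> Zero = {}"
| "anns \<sigma> (Succ t) = anns \<sigma> t"
| "anns \<sigma> (Eq s t) = anns \<sigma> s \<union> anns \<sigma> t"
| "anns \<sigma> (Or \<phi> \<psi>) = anns \<sigma> \<phi> \<union> anns \<sigma> \<psi>"
| "anns \<sigma> (And \<phi> \<psi>) = anns \<sigma> \<phi> \<union> anns \<sigma> \<psi>"
| "anns \<sigma> (Lam A \<phi>) = anns \<sigma> \<phi>"
| "anns \<sigma> (App \<phi> \<psi>) = anns \<sigma> \<phi> \<union> anns \<sigma> \<psi>"
| "anns \<sigma> (Fix \<sigma>' p T \<phi>) = (if \<sigma>' = \<sigma> then {p} else {}) \<union> anns \<sigma> \<phi>"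


section \<open>Infinitary proofs\<close>

codatatype deriv = Infer (root: rule) (subs: "deriv list")

coinductive derivation :: "deriv \<Rightarrow> bool" where
  "rule_ok r \<Longrightarrow> typed_seq (concl r) \<Longrightarrow> map (\<lambda>d. concl (root d)) ds = prems r \<Longrightarrow>
    (\<forall>d\<in>set ds. derivation d) \<Longrightarrow> derivation (Infer r ds)"

text \<open>An infinite branch: its nodes \<open>b i\<close>, and the number \<open>j i\<close> of the premise it continues with.\<close>

definition branch :: "deriv \<Rightarrow> (nat \<Rightarrow> deriv) \<Rightarrow> (nat \<Rightarrow> nat) \<Rightarrow> bool" where
  "branch d b j \<longleftrightarrow> b 0 = d \<and> (\<forall>i. j i < length (subs (b i)) \<and> b (Suc i) = subs (b i) ! j i)"

definition trace :: "(nat \<Rightarrow> deriv) \<Rightarrow> (nat \<Rightarrow> nat) \<Rightarrow> (nat \<Rightarrow> occ) \<Rightarrow> bool" where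
  "trace b j \<tau> \<longleftrightarrow>
    (\<forall>i. snd (\<tau> i) < length (occs (concl (root (b i))) (fst (\<tau> i)))) \<and>
    (\<forall>i. relevant (root (b i)) (j i) (\<tau> i) (\<tau> (Suc i))) \<and>
    (\<forall>n. \<exists>i\<ge>n. logical (root (b i)) \<and> principal (root (b i)) (\<tau> i))"

text \<open>\<open>k i\<close> is fresh in that it occurs in no annotation of \<open>a 0, \<dots>, a i\<close>.\<close>

definition annotation :: "(nat \<Rightarrow> deriv) \<Rightarrow> (nat \<Rightarrow> nat) \<Rightarrow> (nat \<Rightarrow> occ) \<Rightarrow> (nat \<Rightarrow> afm) \<Rightarrow> bool" where
  "annotation b j \<tau> a \<longleftrightarrow>
    a 0 = eps (fm_at (concl (root (b 0))) (\<tau> 0)) \<and>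
    (\<forall>i. erase (a i) = fm_at (concl (root (b i))) (\<tau> i)) \<and>
    (\<exists>k. \<forall>i. (\<forall>m\<le>i. \<forall>p\<in>set_exp (a m). k i \<notin> set p) \<and>
       annot (root (b i)) (j i) (k i) (\<tau> i) (\<tau> (Suc i)) (a i) (a (Suc i)))"

definition fix_trace :: "fixkind \<Rightarrow> (nat \<Rightarrow> deriv) \<Rightarrow> (nat \<Rightarrow> nat) \<Rightarrow> (nat \<Rightarrow> occ) \<Rightarrow> bool" where
  "fix_trace \<sigma> b j \<tau> \<longleftrightarrow> trace b j \<tau> \<and>
    (\<exists>a p. annotation b j \<tau> a \<and> (\<forall>n. \<exists>i. map p [0..<n] \<in> anns \<sigma> (a i)))"

definition infinitary_proof :: "deriv \<Rightarrow> bool" where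
  "infinitary_proof d \<longleftrightarrow> derivation d \<and>
    (\<forall>b j. branch d b j \<longrightarrow> (\<exists>m \<tau>.
       fst (\<tau> 0) = Lhs \<and> fix_trace Mu (\<lambda>i. b (m + i)) (\<lambda>i. j (m + i)) \<tau> \<or>
       fst (\<tau> 0) = Rhs \<and> fix_trace Nu (\<lambda>i. b (m + i)) (\<lambda>i. j (m + i)) \<tau>))"

definition provable :: "sequent \<Rightarrow> bool" where
  "provable S \<longleftrightarrow> (\<exists>d. infinitary_proof d \<and> concl (root d) = S)"

end

theory Submission
  imports Defs
begin

text \<open>
  The rule (Nat) yields an omega rule: in \<open>\<Gamma>, N x \<turnstile> \<Delta>\<close> the predicate \<open>N\<close> can be unfolded forever, each
  finite stage fixing \<open>x\<close> to be a numeral, and the only new infinite branch carries a left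
  \<open>\<mu>\<close>-trace. Hence free variables of type \<open>N\<close> can be replaced by numerals.

  For the remaining sequents a fair search applies the logical rules to all formulas. Suppose an
  infinite branch of unprovable sequents has neither a left \<open>\<mu>\<close>-trace nor a right \<open>\<nu>\<close>-trace. Let
  \<open>\<rho>\<close> make true exactly the atoms \<open>f n\<^sub>1 \<dots> n\<^sub>k\<close> occurring on the left of the branch. Then \<open>\<rho>\<close> makes
  all left formulas true and all right formulas false, contradicting validity. For the left, this
  is shown by a logical relation between annotated formulas \<open>\<phi>\<close> and semantic values, which at type
  \<open>\<Omega>\<close> says that the value is true if \<open>\<phi>\<close> occurs on the left of the branch. Numbering unfoldings by
  the time at which they happen makes annotations unique along the branch, so the absence of a
  left \<open>\<mu>\<close>-trace means that the extension relation on the annotations of \<open>\<mu>\<close>-operators is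
  well-founded; induction along it handles \<open>\<mu>\<close>. For \<open>\<nu>\<close>, the infimum of all values related to every
  annotated copy of the operator is a post-fixed point and hence below the greatest fixed point;
  no ordinal approximants are needed. The right side is dual.
\<close>


section \<open>Semantics\<close>

text \<open>Variables of type N are removed beforehand because the search has no rule for equations:
  once every closed term is a numeral, each equation is decided, and a false one on the left or a
  true one on the right makes the sequent provable. The search never applies (Axiom) either:
  provable sequents are cut off, so a remaining branch never shows an atom on both sides, and one
  valuation serves both. Free variables are first-order because that valuation is read off the
  syntax and must consist of monotone functions. Functions from numbers are monotone for free, the
  order on numbers being discrete; at an argument of formula type, membership of atoms need not
  respect the semantic order. Lack of traces makes annotation extension well-founded but says
  nothing about formulas, which may recur with new annotations; hence the relation lives on
  annotated formulas, and the fixed-point case treats all annotations of an operator at once. The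
  side \<open>b\<close>, with \<open>leb\<close> reversed on the right, lets one argument cover left
  \<mu> and right \<nu>.\<close>

abbreviation domF :: "'u universe \<Rightarrow> fty \<Rightarrow> 'u val set" where
  "domF U T \<equiv> fst (interpF U T)"

abbreviation leF :: "'u universe \<Rightarrow> fty \<Rightarrow> 'u val \<Rightarrow> 'u val \<Rightarrow> bool" where
  "leF U T \<equiv> snd (interpF U T)"

text \<open>Orders and relations at a function type are pointwise, so the inductions need a
  hypothesis for the result type only; the argument type gets the trivial predicate.\<close>

lemma fty_induct: "P TOmega \<Longrightarrow> (\<And>A T. P T \<Longrightarrow> P (TFun A T)) \<Longrightarrow> P T"
  by (rule fty.induct[of "\<lambda>_. True"]) auto

lemma full_type: "has_type \<Theta> e A \<Longrightarrow> \<forall>B\<in>types_of \<Theta> e. full U B \<Longrightarrow> full U A"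
proof (induction rule: has_type.induct)
  case (8 A \<Theta> \<phi> T)
  then have "has_type \<Theta> (Lam A \<phi>) (TForm (TFun A T))" by (auto intro: has_type.intros)
  then have "TForm (TFun A T) \<in> types_of \<Theta> (Lam A \<phi>)" by simp
  then show ?case using 8(3) by blast
qed auto

lemma apply_code:
  "fullF U (TFun A T) \<Longrightarrow> f \<in> mono_funs (interp U A) (interpF U T) \<Longrightarrow> apply_val U (Fn (code U f)) = f"
  by (rule ext) (metis apply_val.simps(3) fullF.simps(2))

lemma domF_FunE:
  assumes "fullF U (TFun A T)" "v \<in> domF U (TFun A T)"
  obtains f where "f \<in> mono_funs (interp U A) (interpF U T)" "v = Fn (code U f)" "apply_val U v = f"
proof -
  obtain f where f: "f \<in> mono_funs (interp U A) (interpF U T)" "v = Fn (code U f)"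
    using assms(2) by auto
  show thesis by (rule that[OF f]) (simp only: f(2) apply_code[OF assms(1) f(1)])
qed

lemma apply_mono_funs:
  assumes "fullF U (TFun A T)" "v \<in> domF U (TFun A T)"
  shows "apply_val U v \<in> mono_funs (interp U A) (interpF U T)"
  using domF_FunE[OF assms] by metis

lemma apply_in_domF:
  "fullF U (TFun A T) \<Longrightarrow> v \<in> domF U (TFun A T) \<Longrightarrow> x \<in> dom_ty U A \<Longrightarrow> apply_val U v x \<in> domF U T"
  using apply_mono_funs[of U A T v] by (auto simp: mono_funs_def)

lemma apply_mono:
  "fullF U (TFun A T) \<Longrightarrow> v \<in> domF U (TFun A T) \<Longrightarrow> x \<in> dom_ty U A \<Longrightarrow> y \<in> dom_ty U A \<Longrightarrow>
    le_ty U A x y \<Longrightarrow> leF U T (apply_val U v x) (apply_val U v y)"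
  using apply_mono_funs[of U A T v] by (auto simp: mono_funs_def)

lemma leF_refl: "fullF U T \<Longrightarrow> v \<in> domF U T \<Longrightarrow> leF U T v v"
proof (induction T arbitrary: v rule: fty_induct)
  case (2 A T)
  have "leF U T (apply_val U v x) (apply_val U v x)" if x: "x \<in> dom_ty U A" for x
    using 2(1)[OF _ apply_in_domF[OF 2(2,3) x]] 2(2) by simp
  then show ?case by simp
qed simp

lemma leF_trans:
  "fullF U T \<Longrightarrow> u \<in> domF U T \<Longrightarrow> v \<in> domF U T \<Longrightarrow> w \<in> domF U T \<Longrightarrow>
    leF U T u v \<Longrightarrow> leF U T v w \<Longrightarrow> leF U T u w"
proof (induction T arbitrary: u v w rule: fty_induct)
  case (2 A T)
  have "leF U T (apply_val U u x) (apply_val U w x)" if x: "x \<in> dom_ty U A" for x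
    by (rule 2(1)[OF _ apply_in_domF[OF 2(2,3) x] apply_in_domF[OF 2(2,4) x] apply_in_domF[OF 2(2,5) x]])
      (use 2(2,6,7) x in simp_all)
  then show ?case by simp
qed auto

lemma leF_antisym:
  "fullF U T \<Longrightarrow> v \<in> domF U T \<Longrightarrow> w \<in> domF U T \<Longrightarrow> leF U T v w \<Longrightarrow> leF U T w v \<Longrightarrow> v = w"
proof (induction T arbitrary: v w rule: fty_induct)
  case (2 A T)
  obtain f where f: "f \<in> mono_funs (interp U A) (interpF U T)" "v = Fn (code U f)" "apply_val U v = f"
    using domF_FunE[OF 2(2,3)] .
  obtain g where g: "g \<in> mono_funs (interp U A) (interpF U T)" "w = Fn (code U g)" "apply_val U w = g"
    using domF_FunE[OF 2(2,4)] .
  have "f x = g x" for x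
  proof (cases "x \<in> dom_ty U A")
    case True
    show ?thesis
      unfolding f(3)[symmetric] g(3)[symmetric]
      by (rule 2(1)[OF _ apply_in_domF[OF 2(2,3) True] apply_in_domF[OF 2(2,4) True]])
        (use 2(2,5,6) True in simp_all)
  next
    case False
    then show ?thesis using f(1) g(1) by (simp add: mono_funs_def)
  qed
  then show ?case using f(2) g(2) by (metis ext)
qed auto

lemma le_ty_refl: "full U A \<Longrightarrow> v \<in> dom_ty U A \<Longrightarrow> le_ty U A v v"
  by (cases A) (auto simp: leF_refl)

text \<open>The order read from the point of view of one side of a sequent: on the left (\<open>b = True\<close>) one
  wants formulas to be true, on the right (\<open>b = False\<close>) to be false.\<close>

definition leb :: "'u universe \<Rightarrow> bool \<Rightarrow> fty \<Rightarrow> 'u val \<Rightarrow> 'u val \<Rightarrow> bool" where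
  "leb U b T v w = (if b then leF U T v w else leF U T w v)"

text \<open>Infimum for \<open>leb U b\<close>, hence a supremum in the ordinary order when
  \<open>b = False\<close>. \<open>Truth b\<close> is the top element at \<open>TOmega\<close>, also
  obtained from the empty set.\<close>

fun meet :: "'u universe \<Rightarrow> bool \<Rightarrow> fty \<Rightarrow> 'u val set \<Rightarrow> 'u val" where
  "meet U b TOmega V = Truth (if V \<subseteq> {Truth b} then b else \<not> b)"
| "meet U b (TFun A T) V =
    Fn (code U (\<lambda>x. if x \<in> dom_ty U A then meet U b T ((\<lambda>v. apply_val U v x) ` V) else Num 0))"

text \<open>At a function type the pointwise infimum has to be monotone before its code can be
  decoded. Monotonicity follows from the bound properties at the result type, so membership, the
  bounds and the rule for application go through one induction.\<close>

lemma meet_is_inf: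
  "fullF U T \<Longrightarrow> V \<subseteq> domF U T \<Longrightarrow> meet U b T V \<in> domF U T \<and> (\<forall>v\<in>V. leb U b T (meet U b T V) v) \<and>
    (\<forall>w\<in>domF U T. (\<forall>v\<in>V. leb U b T w v) \<longrightarrow> leb U b T w (meet U b T V)) \<and>
    (\<forall>A T'. T = TFun A T' \<longrightarrow> (\<forall>x\<in>dom_ty U A.
      apply_val U (meet U b T V) x = meet U b T' ((\<lambda>v. apply_val U v x) ` V)))"
proof (induction T arbitrary: V rule: fty_induct)
  case 1
  then show ?case by (cases b) (auto simp: leb_def subset_iff)
next
  case (2 A T)
  let ?V = "\<lambda>x. (\<lambda>v. apply_val U v x) ` V"
  let ?g = "\<lambda>x. if x \<in> dom_ty U A then meet U b T (?V x) else Num 0"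
  have T: "fullF U T" using 2 by simp
  have V: "?V x \<subseteq> domF U T" if "x \<in> dom_ty U A" for x
    using apply_in_domF[OF 2(2) subsetD[OF 2(3)] that] by blast
  have IHd: "?g x \<in> domF U T"
    and IHl: "\<And>v. v \<in> V \<Longrightarrow> leb U b T (?g x) (apply_val U v x)"
    and IHg: "\<And>w. w \<in> domF U T \<Longrightarrow> (\<And>v. v \<in> V \<Longrightarrow> leb U b T w (apply_val U v x)) \<Longrightarrow> leb U b T w (?g x)"
    if "x \<in> dom_ty U A" for x
    using 2(1)[OF T V[OF that]] that by simp_all
  have g: "?g \<in> mono_funs (interp U A) (interpF U T)"
  proof -
    have "leF U T (?g x) (?g y)" if xy: "x \<in> dom_ty U A" "y \<in> dom_ty U A" "le_ty U A x y" for x y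
    proof -
      have m: "leF U T (apply_val U v x) (apply_val U v y)" if "v \<in> V" for v
        using apply_mono[OF 2(2) subsetD[OF 2(3) that] xy] .
      have d: "apply_val U v z \<in> domF U T" if "v \<in> V" "z \<in> dom_ty U A" for v z
        using apply_in_domF[OF 2(2) subsetD[OF 2(3) that(1)] that(2)] .
      show ?thesis
      \<comment> \<open>For \<open>b = True\<close> the value at \<open>x\<close> is a lower bound
        of the values at \<open>y\<close>; for \<open>b = False\<close> the order is reversed and
        \<open>x\<close> and \<open>y\<close> exchange roles.\<close>
      proof (cases b)
        case True
        have "leF U T (?g x) (apply_val U v y)" if v: "v \<in> V" for v
          by (rule leF_trans[OF T IHd[OF xy(1)] d[OF v xy(1)] d[OF v xy(2)] _ m[OF v]])
            (use IHl[OF xy(1) v] True in \<open>simp only: leb_def if_True\<close>)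
        then show ?thesis using IHg[OF xy(2) IHd[OF xy(1)]] True by (simp only: leb_def if_True)
      next
        case False
        have "leF U T (apply_val U v x) (?g y)" if v: "v \<in> V" for v
          by (rule leF_trans[OF T d[OF v xy(1)] d[OF v xy(2)] IHd[OF xy(2)] m[OF v]])
            (use IHl[OF xy(2) v] False in \<open>simp only: leb_def if_False\<close>)
        then show ?thesis using IHg[OF xy(1) IHd[OF xy(2)]] False by (simp only: leb_def if_False)
      qed
    qed
    then show ?thesis using IHd unfolding mono_funs_def by simp
  qed
  have ap: "apply_val U (meet U b (TFun A T) V) = ?g"
    unfolding meet.simps by (rule apply_code[OF 2(2) g])
  have leb_Fun: "leb U b (TFun A T) v w \<longleftrightarrow>
      (\<forall>x\<in>dom_ty U A. leb U b T (apply_val U v x) (apply_val U w x))" for v w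
    by (simp add: leb_def)
  have "meet U b (TFun A T) V \<in> domF U (TFun A T)"
    using g unfolding meet.simps interpF.simps fst_conv by blast
  moreover have "leb U b (TFun A T) (meet U b (TFun A T) V) v" if "v \<in> V" for v
    unfolding leb_Fun ap using IHl that by blast
  moreover have "leb U b (TFun A T) w (meet U b (TFun A T) V)"
    if w: "w \<in> domF U (TFun A T)" "\<forall>v\<in>V. leb U b (TFun A T) w v" for w
    unfolding leb_Fun ap using IHg[OF _ apply_in_domF[OF 2(2) w(1)]] w(2) unfolding leb_Fun by blast
  moreover have "apply_val U (meet U b (TFun A T) V) x = meet U b T ((\<lambda>v. apply_val U v x) ` V)"
    if "x \<in> dom_ty U A" for x
    unfolding ap using that by simp
  ultimately show ?case by blast
qed

lemma leb_refl: "fullF U T \<Longrightarrow> v \<in> domF U T \<Longrightarrow> leb U b T v v"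
  by (simp add: leb_def leF_refl)

lemma leb_trans:
  "fullF U T \<Longrightarrow> u \<in> domF U T \<Longrightarrow> v \<in> domF U T \<Longrightarrow> w \<in> domF U T \<Longrightarrow>
    leb U b T u v \<Longrightarrow> leb U b T v w \<Longrightarrow> leb U b T u w"
  using leF_trans[of U T] unfolding leb_def by metis

lemma leb_antisym:
  "fullF U T \<Longrightarrow> v \<in> domF U T \<Longrightarrow> w \<in> domF U T \<Longrightarrow> leb U b T v w \<Longrightarrow> leb U b T w v \<Longrightarrow> v = w"
  using leF_antisym[of U T] unfolding leb_def by metis

text \<open>The operator whose infinite unfolding on side \<open>b\<close> is accepted as a trace.
  For the order \<open>leb U b\<close> it is the least fixed point on either side.\<close>

definition kind :: "bool \<Rightarrow> fixkind" where
  "kind b = (if b then Mu else Nu)"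

definition fixpt :: "'u universe \<Rightarrow> fixkind \<Rightarrow> fty \<Rightarrow> ('u val \<Rightarrow> 'u val) \<Rightarrow> 'u val" where
  "fixpt U \<sigma> T F = (case \<sigma> of Mu \<Rightarrow> least_fp U T F | Nu \<Rightarrow> greatest_fp U T F)"

text \<open>Knaster-Tarski for both operators at once. The semantics compares the fixed point with
  fixed points only; the third claim strengthens this to pre-fixed points, which is what fixed-point
  induction needs.\<close>

lemma fixpt_least:
  assumes T: "fullF U T" and F': "\<forall>v\<in>domF U T. F v \<in> domF U T"
    and mono: "\<forall>v\<in>domF U T. \<forall>w\<in>domF U T. leF U T v w \<longrightarrow> leF U T (F v) (F w)"
  shows "fixpt U (kind b) T F \<in> domF U T" "F (fixpt U (kind b) T F) = fixpt U (kind b) T F"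
    "\<And>w. w \<in> domF U T \<Longrightarrow> leb U b T (F w) w \<Longrightarrow> leb U b T (fixpt U (kind b) T F) w"
proof -
  let ?V = "{w \<in> domF U T. leb U b T (F w) w}"
  note F = bspec[OF F']
  define m where "m = meet U b T ?V"
  have mono': "leb U b T (F v) (F w)" if "v \<in> domF U T" "w \<in> domF U T" "leb U b T v w" for v w
    using mono that unfolding leb_def by metis
  have m: "m \<in> domF U T" and lower: "\<And>v. v \<in> domF U T \<Longrightarrow> leb U b T (F v) v \<Longrightarrow> leb U b T m v"
    and greatest: "\<And>w. w \<in> domF U T \<Longrightarrow> (\<And>v. v \<in> ?V \<Longrightarrow> leb U b T w v) \<Longrightarrow> leb U b T w m"
    using meet_is_inf[OF T, of ?V b] unfolding m_def by blast+
  have pre: "leb U b T (F m) m"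
  proof (rule greatest[OF F[OF m]])
    fix v assume v: "v \<in> ?V"
    then have dv: "v \<in> domF U T" "leb U b T (F v) v" by simp_all
    show "leb U b T (F m) v"
      by (rule leb_trans[OF T F[OF m] F[OF dv(1)] dv(1) mono'[OF m dv(1) lower[OF dv]] dv(2)])
  qed
  have fix_m: "F m = m"
    using leb_antisym[OF T F[OF m] m pre] lower[OF F[OF m] mono'[OF F[OF m] m pre]] by simp
  have uniq: "v = m" if "v \<in> domF U T" "F v = v" "\<forall>w\<in>domF U T. F w = w \<longrightarrow> leb U b T v w" for v
  proof (rule leb_antisym[OF T that(1) m])
    show "leb U b T v m" using that(3) m fix_m by blast
    show "leb U b T m v" using lower[OF that(1)] leb_refl[OF T that(1)] by (simp only: that(2))
  qed
  have least: "\<forall>w\<in>domF U T. F w = w \<longrightarrow> leb U b T m w"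
    using lower leb_refl[OF T] by metis
  have "fixpt U (kind b) T F = (THE v. v \<in> domF U T \<and> F v = v \<and> (\<forall>w\<in>domF U T. F w = w \<longrightarrow> leb U b T v w))"
    by (cases b) (simp_all add: fixpt_def kind_def least_fp_def greatest_fp_def leb_def)
  also have "\<dots> = m"
    using m fix_m least uniq by (intro the_equality) blast+
  finally show "fixpt U (kind b) T F \<in> domF U T" "F (fixpt U (kind b) T F) = fixpt U (kind b) T F"
    "\<And>w. w \<in> domF U T \<Longrightarrow> leb U b T (F w) w \<Longrightarrow> leb U b T (fixpt U (kind b) T F) w"
    using m fix_m lower by simp_all
qed

section \<open>Well-definedness and monotonicity of the semantics\<close>

definition envle :: "'u universe \<Rightarrow> ty list \<Rightarrow> 'u val list \<Rightarrow> 'u val list \<Rightarrow> bool" where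
  "envle U \<Theta> \<eta> \<eta>' \<longleftrightarrow> length \<eta> = length \<Theta> \<and> length \<eta>' = length \<Theta> \<and> (\<forall>i<length \<Theta>.
    \<eta> ! i \<in> dom_ty U (\<Theta> ! i) \<and> \<eta>' ! i \<in> dom_ty U (\<Theta> ! i) \<and> le_ty U (\<Theta> ! i) (\<eta> ! i) (\<eta>' ! i))"

lemma envle_refl: 
  "length \<eta> = length \<Theta> \<Longrightarrow> (\<And>i. i < length \<Theta> \<Longrightarrow> full U (\<Theta> ! i) \<and> \<eta> ! i \<in> dom_ty U (\<Theta> ! i)) \<Longrightarrow> envle U \<Theta> \<eta> \<eta>"
  by (auto simp: envle_def le_ty_refl)

lemma envle_left: "envle U \<Theta> \<eta> \<eta>' \<Longrightarrow> \<forall>A\<in>set \<Theta>. full U A \<Longrightarrow> envle U \<Theta> \<eta> \<eta>"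
  by (rule envle_refl) (auto simp: envle_def)

lemma envle_right: "envle U \<Theta> \<eta> \<eta>' \<Longrightarrow> \<forall>A\<in>set \<Theta>. full U A \<Longrightarrow> envle U \<Theta> \<eta>' \<eta>'"
  by (rule envle_refl) (auto simp: envle_def)

lemma envle_Cons:
  "envle U \<Theta> \<eta> \<eta>' \<Longrightarrow> v \<in> dom_ty U A \<Longrightarrow> w \<in> dom_ty U A \<Longrightarrow> le_ty U A v w \<Longrightarrow>
    envle U (A # \<Theta>) (v # \<eta>) (w # \<eta>')"
  by (auto simp: envle_def nth_Cons split: nat.split)

lemma sem_Fix_fixpt: "sem U \<rho> \<eta> (Fix \<sigma> p T \<phi>) = fixpt U \<sigma> T (\<lambda>v. sem U \<rho> (v # \<eta>) \<phi>)"
  by (simp add: fixpt_def split: fixkind.split)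

lemma kind_surj: obtains b where "\<sigma> = kind b"
  using that[of True] that[of False] by (cases \<sigma>) (auto simp: kind_def)

text \<open>Membership and monotonicity depend on each other: the code of an abstraction lies in its
  domain because the body is monotone in the bound variable, and a fixed point is obtained from a
  monotone body. Hence two environments are compared at once.\<close>

lemma sem_mono:
  assumes "has_type \<Theta> e A" "\<forall>B\<in>types_of \<Theta> e. full U B" "\<forall>x\<in>fvs e. \<rho> x \<in> dom_ty U (snd x)"
    "\<forall>B\<in>set \<Theta>. full U B" "envle U \<Theta> \<eta> \<eta>'"
  shows "sem U \<rho> \<eta> e \<in> dom_ty U A \<and> le_ty U A (sem U \<rho> \<eta> e) (sem U \<rho> \<eta>' e)"
  using assms
proof (induction arbitrary: \<eta> \<eta>' rule: has_type.induct)
  case (1 \<Theta> x)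
  then show ?case by (simp add: le_ty_refl)
next
  case (2 i \<Theta>)
  then show ?case by (simp add: envle_def)
next
  case (3 \<Theta>)
  then show ?case by simp
next
  case (4 \<Theta> t)
  have "sem U \<rho> \<eta> t = sem U \<rho> \<eta>' t"
    using 4(2)[OF _ _ 4(5,6)] 4(3,4) by simp
  then show ?case by simp
next
  case (5 \<Theta> s t)
  have "sem U \<rho> \<eta> s = sem U \<rho> \<eta>' s" "sem U \<rho> \<eta> t = sem U \<rho> \<eta>' t"
    using 5(3)[OF _ _ 5(7,8)] 5(4)[OF _ _ 5(7,8)] 5(5,6) by simp_all
  then show ?case by simp
next
  case (6 \<Theta> s t)
  have "leF U TOmega (sem U \<rho> \<eta> s) (sem U \<rho> \<eta>' s)" "leF U TOmega (sem U \<rho> \<eta> t) (sem U \<rho> \<eta>' t)"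
    using 6(3)[OF _ _ 6(7,8)] 6(4)[OF _ _ 6(7,8)] 6(5,6) by simp_all
  then show ?case by auto
next
  case (7 \<Theta> s t)
  have "leF U TOmega (sem U \<rho> \<eta> s) (sem U \<rho> \<eta>' s)" "leF U TOmega (sem U \<rho> \<eta> t) (sem U \<rho> \<eta>' t)"
    using 7(3)[OF _ _ 7(7,8)] 7(4)[OF _ _ 7(7,8)] 7(5,6) by simp_all
  then show ?case by auto
next
  case (8 A \<Theta> \<phi> T)
  have F: "fullF U (TFun A T)"
    using full_type[OF has_type.intros(8)[OF 8(1)] 8(3)] by simp
  then have A: "\<forall>B\<in>set (A # \<Theta>). full U B" using 8(5) by simp
  have IH: "sem U \<rho> (v # \<eta>1) \<phi> \<in> domF U T \<and> leF U T (sem U \<rho> (v # \<eta>1) \<phi>) (sem U \<rho> (w # \<eta>2) \<phi>)"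
    if "envle U \<Theta> \<eta>1 \<eta>2" "v \<in> dom_ty U A" "w \<in> dom_ty U A" "le_ty U A v w" for v w \<eta>1 \<eta>2
    using 8(2)[OF _ _ A envle_Cons[OF that]] 8(3,4) by simp
  let ?g = "\<lambda>\<eta> v. if v \<in> dom_ty U A then sem U \<rho> (v # \<eta>) \<phi> else Num 0"
  have g: "?g \<eta> \<in> mono_funs (interp U A) (interpF U T)" if "envle U \<Theta> \<eta> \<eta>" for \<eta>
    using IH[OF that] F by (auto simp: mono_funs_def le_ty_refl)
  note g1 = g[OF envle_left[OF 8(6,5)]] and g2 = g[OF envle_right[OF 8(6,5)]]
  have "leF U T (?g \<eta> x) (?g \<eta>' x)" if "x \<in> dom_ty U A" for x
    using IH[OF 8(6) that that] F that by (simp add: le_ty_refl)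
  then have "leF U (TFun A T) (Fn (code U (?g \<eta>))) (Fn (code U (?g \<eta>')))"
    unfolding interpF.simps snd_conv apply_code[OF F g1] apply_code[OF F g2] by blast
  then show ?case using g1 by (simp del: apply_val.simps) blast
next
  case (9 \<Theta> \<phi> A T \<psi>)
  have F: "fullF U (TFun A T)" using full_type[OF 9(1), of U] 9(5) by simp
  have 1: "sem U \<rho> \<eta> \<phi> \<in> domF U (TFun A T)" "leF U (TFun A T) (sem U \<rho> \<eta> \<phi>) (sem U \<rho> \<eta>' \<phi>)"
      "sem U \<rho> \<eta>' \<phi> \<in> domF U (TFun A T)"
    using 9(3)[OF _ _ 9(7,8)] 9(3)[OF _ _ 9(7) envle_right[OF 9(8,7)]] 9(5,6) by auto
  have 2: "sem U \<rho> \<eta> \<psi> \<in> dom_ty U A" "le_ty U A (sem U \<rho> \<eta> \<psi>) (sem U \<rho> \<eta>' \<psi>)"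
      "sem U \<rho> \<eta>' \<psi> \<in> dom_ty U A"
    using 9(4)[OF _ _ 9(7,8)] 9(4)[OF _ _ 9(7) envle_right[OF 9(8,7)]] 9(5,6) by auto
  have "leF U T (apply_val U (sem U \<rho> \<eta> \<phi>) (sem U \<rho> \<eta> \<psi>)) (apply_val U (sem U \<rho> \<eta>' \<phi>) (sem U \<rho> \<eta>' \<psi>))"
    by (rule leF_trans[OF _ apply_in_domF[OF F 1(1) 2(1)] apply_in_domF[OF F 1(1) 2(3)]
      apply_in_domF[OF F 1(3) 2(3)] apply_mono[OF F 1(1) 2(1,3,2)]]) (use F 1 2 in auto)
  then show ?case using apply_in_domF[OF F 1(1) 2(1)] by simp
next
  case (10 T \<Theta> \<phi> \<sigma> p)
  have F: "fullF U T" using 10(3) by simp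
  then have A: "\<forall>B\<in>set (TForm T # \<Theta>). full U B" using 10(5) by simp
  have IH: "sem U \<rho> (v # \<eta>1) \<phi> \<in> domF U T \<and> leF U T (sem U \<rho> (v # \<eta>1) \<phi>) (sem U \<rho> (w # \<eta>2) \<phi>)"
    if "envle U \<Theta> \<eta>1 \<eta>2" "v \<in> domF U T" "w \<in> domF U T" "leF U T v w" for v w \<eta>1 \<eta>2
    using 10(2)[OF _ _ A envle_Cons[OF that(1), of v "TForm T" w]] that 10(3,4) by simp
  obtain b where \<sigma>: "\<sigma> = kind b" by (rule kind_surj)
  define F1 where "F1 = (\<lambda>v. sem U \<rho> (v # \<eta>) \<phi>)"
  define F2 where "F2 = (\<lambda>v. sem U \<rho> (v # \<eta>') \<phi>)"
  note e1 = envle_left[OF 10(6,5)] and e2 = envle_right[OF 10(6,5)]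
  have f1: "\<forall>v\<in>domF U T. F1 v \<in> domF U T"
      "\<forall>v\<in>domF U T. \<forall>w\<in>domF U T. leF U T v w \<longrightarrow> leF U T (F1 v) (F1 w)"
    using IH[OF e1] leF_refl[OF F] unfolding F1_def by blast+
  have f2: "\<forall>v\<in>domF U T. F2 v \<in> domF U T"
      "\<forall>v\<in>domF U T. \<forall>w\<in>domF U T. leF U T v w \<longrightarrow> leF U T (F2 v) (F2 w)"
    using IH[OF e2] leF_refl[OF F] unfolding F2_def by blast+
  have f12: "leF U T (F1 v) (F2 v)" if "v \<in> domF U T" for v
    using IH[OF 10(6) that that leF_refl[OF F that]] unfolding F1_def F2_def by blast
  note fp1 = fixpt_least[where U = U and T = T and F = F1 and b = b, OF F f1] and fp2 = fixpt_least[where U = U and T = T and F = F2 and b = b, OF F f2]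
  have "leF U T (fixpt U \<sigma> T F1) (fixpt U \<sigma> T F2)"
  \<comment> \<open>Least: the fixed point of \<open>F2\<close> is pre-fixed for \<open>F1\<close>.
    Greatest: that of \<open>F1\<close> is post-fixed for \<open>F2\<close>.\<close>
  proof (cases b)
    case True
    then show ?thesis using fp1(3)[OF fp2(1)] f12[OF fp2(1)] fp2(2) by (simp add: leb_def \<sigma>)
  next
    case False
    then show ?thesis using fp2(3)[OF fp1(1)] f12[OF fp1(1)] fp1(2) by (simp add: leb_def \<sigma>)
  qed
  then show ?case using fp1(1) unfolding sem_Fix_fixpt F1_def F2_def \<sigma> by simp
qed

text \<open>Semantic beta reduction. It is not definitional: decoding is known to invert coding only
  on monotone functions, and \<open>sem_mono\<close> supplies monotonicity.\<close>

lemma sem_Lam_apply: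
  assumes "has_type (A # \<Theta>) \<phi> (TForm T)" "\<forall>B\<in>types_of \<Theta> (Lam A \<phi>). full U B"
    "\<forall>x\<in>fvs \<phi>. \<rho> x \<in> dom_ty U (snd x)" "\<forall>B\<in>set \<Theta>. full U B" "envle U \<Theta> \<eta> \<eta>" "v \<in> dom_ty U A"
  shows "apply_val U (sem U \<rho> \<eta> (Lam A \<phi>)) v = sem U \<rho> (v # \<eta>) \<phi>"
proof -
  have F: "fullF U (TFun A T)"
    using full_type[OF has_type.intros(8)[OF assms(1)] assms(2)] by simp
  then have A: "\<forall>B\<in>set (A # \<Theta>). full U B" using assms(4) by simp
  let ?g = "\<lambda>v. if v \<in> dom_ty U A then sem U \<rho> (v # \<eta>) \<phi> else Num 0"
  have IH: "sem U \<rho> (v # \<eta>) \<phi> \<in> domF U T \<and> leF U T (sem U \<rho> (v # \<eta>) \<phi>) (sem U \<rho> (w # \<eta>) \<phi>)"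
    if "v \<in> dom_ty U A" "w \<in> dom_ty U A" "le_ty U A v w" for v w
    using sem_mono[OF assms(1) _ assms(3) A envle_Cons[OF assms(5) that]] assms(2) by simp
  have "?g \<in> mono_funs (interp U A) (interpF U T)"
    using IH F by (auto simp: mono_funs_def le_ty_refl)
  from apply_code[OF F this] assms(6) show ?thesis
    by (simp del: apply_val.simps)
qed


section \<open>Substitution of closed expressions for indices\<close>

primrec num :: "nat \<Rightarrow> 'a exp" where
  "num 0 = Zero"
| "num (Suc n) = Succ (num n)"

lemma has_type_num [simp]: "has_type \<Theta> (num n) TNat"
  by (induction n) (auto intro: has_type.intros)

lemma fvs_num [simp]: "fvs (num n) = {}"
  by (induction n) auto

lemma sem_num [simp]: "sem U \<rho> \<eta> (num n) = Num n"
  by (induction n) auto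

text \<open>Unlike \<open>inst\<close>, it fills all indices from \<open>n\<close> on at once, as an
  environment for an open body requires; indices below \<open>n\<close> belong to binders already
  passed. The inserted expressions are closed, so nothing is shifted.\<close>

primrec psub :: "nat \<Rightarrow> 'a exp list \<Rightarrow> 'a exp \<Rightarrow> 'a exp" where
  "psub n us (FV x) = FV x"
| "psub n us (BV i) = (if i < n then BV i else us ! (i - n))"
| "psub n us Zero = Zero"
| "psub n us (Succ t) = Succ (psub n us t)"
| "psub n us (Eq s t) = Eq (psub n us s) (psub n us t)"
| "psub n us (Or \<phi> \<psi>) = Or (psub n us \<phi>) (psub n us \<psi>)"
| "psub n us (And \<phi> \<psi>) = And (psub n us \<phi>) (psub n us \<psi>)"
| "psub n us (Lam A \<phi>) = Lam A (psub (Suc n) us \<phi>)"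
| "psub n us (App \<phi> \<psi>) = App (psub n us \<phi>) (psub n us \<psi>)"
| "psub n us (Fix \<sigma> p T \<phi>) = Fix \<sigma> p T (psub (Suc n) us \<phi>)"

lemma has_type_weaken: "has_type \<Theta> e A \<Longrightarrow> has_type (\<Theta> @ \<Theta>') e A"
proof (induction rule: has_type.induct)
  case (2 i \<Theta>)
  then show ?case using has_type.intros(2)[of i "\<Theta> @ \<Theta>'"] by (simp add: nth_append)
qed (auto intro: has_type.intros)

lemma psub_closed: "has_type \<Theta> e A \<Longrightarrow> length \<Theta> \<le> n \<Longrightarrow> psub n us e = e"
  by (induction arbitrary: n rule: has_type.induct) auto

lemma inst_closed: "has_type \<Theta> e A \<Longrightarrow> length \<Theta> \<le> n \<Longrightarrow> inst n u e = e"
  by (induction arbitrary: n rule: has_type.induct) auto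

text \<open>Links one reduction step with environments: the expressions in \<open>us\<close> have no
  dangling indices, so filling index \<open>n\<close> afterwards leaves them alone.\<close>

lemma inst_psub:
  "has_type \<Theta> e A \<Longrightarrow> length \<Theta> \<le> Suc n + length us \<Longrightarrow> \<forall>u'\<in>set us. \<exists>B. has_type [] u' B \<Longrightarrow>
    inst n u (psub (Suc n) us e) = psub n (u # us) e"
proof (induction arbitrary: n rule: has_type.induct)
  case (2 i \<Theta>)
  show ?case
  proof (cases "n < i")
    case True
    then obtain j where j: "i = Suc n + j" using less_imp_add_positive[of n i] by (metis add_Suc less_natE)
    then have "us ! j \<in> set us" using 2 by simp
    then obtain B where "has_type [] (us ! j) B" using 2 by blast
    from inst_closed[OF this, of n u] show ?thesis using j by simp
  next
    case False
    then show ?thesis by auto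
  qed
next
  case (8 A \<Theta> \<phi> T)
  then show ?case by simp
next
  case (10 T \<Theta> \<phi> \<sigma> p)
  then show ?case by simp
qed auto

lemma has_type_psub:
  assumes "has_type (\<Theta> @ \<Theta>') e A" "length us = length \<Theta>'" "\<And>i. i < length us \<Longrightarrow> has_type [] (us ! i) (\<Theta>' ! i)"
  shows "has_type \<Theta> (psub (length \<Theta>) us e) A"
proof -
  have "has_type \<Theta>0 e A \<Longrightarrow> \<Theta>0 = \<Theta> @ \<Theta>' \<Longrightarrow> has_type \<Theta> (psub (length \<Theta>) us e) A" for \<Theta>0
  proof (induction arbitrary: \<Theta> rule: has_type.induct)
    case (2 i \<Theta>0)
    show ?case
    proof (cases "i < length \<Theta>")
      case True
      then show ?thesis using 2 has_type.intros(2)[of i \<Theta>] by (simp add: nth_append)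
    next
      case False
      then show ?thesis using 2 assms(2) has_type_weaken[OF assms(3)[of "i - length \<Theta>"], of \<Theta>]
        by (simp add: nth_append)
    qed
  next
    case (8 B \<Theta>0 \<phi> T)
    then show ?case using 8(2)[of "B # \<Theta>"] by (auto intro: has_type.intros)
  next
    case (10 T \<Theta>0 \<phi> \<sigma> p)
    then show ?case using 10(2)[of "TForm T # \<Theta>"] by (auto intro: has_type.intros)
  qed (auto intro: has_type.intros)
  then show ?thesis using assms(1) by blast
qed

lemma inst_eq_psub: "has_type (\<Theta> @ [B]) e A \<Longrightarrow> inst (length \<Theta>) u e = psub (length \<Theta>) [u] e"
  using inst_psub[of "\<Theta> @ [B]" e A "length \<Theta>" "[]" u] psub_closed[of "\<Theta> @ [B]" e A "Suc (length \<Theta>)" "[]"]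
  by simp

lemma has_type_inst:
  "has_type (\<Theta> @ [B]) e A \<Longrightarrow> has_type [] u B \<Longrightarrow> has_type \<Theta> (inst (length \<Theta>) u e) A"
  using has_type_psub[of \<Theta> "[B]" e A "[u]"] inst_eq_psub[of \<Theta> B e A u] by simp

lemma has_type_inst0: "has_type [B] e A \<Longrightarrow> has_type [] u B \<Longrightarrow> has_type [] (inst 0 u e) A"
  using has_type_inst[of "[]" B e A u] by simp

lemma fvs_inst: "fvs (inst n u e) \<subseteq> fvs e \<union> fvs u"
  by (induction e arbitrary: n) auto

lemma fvs_psub: "has_type \<Theta> e A \<Longrightarrow> length \<Theta> \<le> n + length us \<Longrightarrow> fvs (psub n us e) \<subseteq> fvs e \<union> (\<Union>u\<in>set us. fvs u)"
proof (induction arbitrary: n rule: has_type.induct)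
  case (2 i \<Theta>)
  then have "\<not> i < n \<Longrightarrow> us ! (i - n) \<in> set us" by (intro nth_mem) auto
  then show ?case by auto
next
  case (8 A \<Theta> \<phi> T)
  from 8(2)[of "Suc n"] 8(3) show ?case by simp
next
  case (10 T \<Theta> \<phi> \<sigma> p)
  from 10(2)[of "Suc n"] 10(3) show ?case by simp
qed (simp; blast)+

definition first_order :: "var \<Rightarrow> bool" where
  "first_order x \<longleftrightarrow> (\<exists>k. snd x = TForm ((TFun TNat ^^ k) TOmega))"

inductive_cases has_type_FV: "has_type \<Theta> (FV x) A"
inductive_cases has_type_BV: "has_type \<Theta> (BV i) A"
inductive_cases has_type_Zero: "has_type \<Theta> Zero A"
inductive_cases has_type_Succ: "has_type \<Theta> (Succ t) A"
inductive_cases has_type_Eq: "has_type \<Theta> (Eq s t) A"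
inductive_cases has_type_Or: "has_type \<Theta> (Or \<phi> \<psi>) A"
inductive_cases has_type_And: "has_type \<Theta> (And \<phi> \<psi>) A"
inductive_cases has_type_Lam: "has_type \<Theta> (Lam B \<phi>) A"
inductive_cases has_type_App: "has_type \<Theta> (App \<phi> \<psi>) A"
inductive_cases has_type_Fix: "has_type \<Theta> (Fix \<sigma> p T \<phi>) A"

text \<open>Free variables of type N are excluded, so a closed expression of type
  \<open>TNat\<close> is a numeral; predicate variables of first-order type remain.\<close>

definition closed_exp :: "'a exp \<Rightarrow> ty \<Rightarrow> bool" where
  "closed_exp e A \<longleftrightarrow> has_type [] e A \<and> (\<forall>x\<in>fvs e. first_order x)"


section \<open>The truth of the formulas on one side of a branch\<close>

text \<open>A Hintikka set for one side: \<open>X\<close> holds the annotated formulas that occur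
  there, and \<open>b\<close> is true for the left. An unfolding must descend in \<open>W\<close>
  only for operators of \<open>kind b\<close>; the others are not controlled at all.\<close>

locale branch_side =
  fixes U :: "'u universe" and \<rho> :: "var \<Rightarrow> 'u val" and b :: bool and X :: "afm set"
    and W :: "(nat list \<times> nat list) set"
  assumes wf: "wf W"
    and Or: "Or c d \<in> X \<Longrightarrow> if b then c \<in> X \<or> d \<in> X else c \<in> X \<and> d \<in> X"
    and And: "And c d \<in> X \<Longrightarrow> if b then c \<in> X \<and> d \<in> X else c \<in> X \<or> d \<in> X"
    and Lam: "apps (App (Lam A c) d) ds \<in> X \<Longrightarrow> apps (inst 0 d c) ds \<in> X"
    and Fix: "apps (Fix \<sigma> p T c) ds \<in> X \<Longrightarrow>
      \<exists>k. apps (inst 0 (Fix \<sigma> (p @ [k]) T c) c) ds \<in> X \<and> (\<sigma> = kind b \<longrightarrow> (p @ [k], p) \<in> W)"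
    and Eq: "Eq (num n) (num m) \<in> X \<Longrightarrow> (n = m) = b"
    and Atom: "snd x = TForm ((TFun TNat ^^ length ns) TOmega) \<Longrightarrow> apps (FV x) (map num ns) \<in> X \<Longrightarrow>
      foldl (apply_val U) (\<rho> x) (map Num ns) = Truth b"
begin

text \<open>Arguments range over closed expressions and domain values only, the ones for which
  application is meaningful. The clause at \<open>TOmega\<close> is one-directional: it demands
  nothing of formulas outside \<open>X\<close>.\<close>

primrec rel :: "ty \<Rightarrow> afm \<Rightarrow> 'u val \<Rightarrow> bool" and relF :: "fty \<Rightarrow> afm \<Rightarrow> 'u val \<Rightarrow> bool" where
  "rel TNat t v \<longleftrightarrow> (\<exists>n. t = num n \<and> v = Num n)"
| "rel (TForm T) \<phi> v \<longleftrightarrow> relF T \<phi> v"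
| "relF TOmega \<phi> v \<longleftrightarrow> (\<phi> \<in> X \<longrightarrow> v = Truth b)"
| "relF (TFun A T) \<phi> v \<longleftrightarrow> (\<forall>\<psi> w. closed_exp \<psi> A \<longrightarrow> w \<in> dom_ty U A \<longrightarrow> rel A \<psi> w \<longrightarrow>
    relF T (App \<phi> \<psi>) (apply_val U v w))"

text \<open>Closure under reverse reduction in front of any argument list. \<open>Y\<close> is a set
  because the same operator may be unfolded with different fresh numbers, depending on the arguments
  \<open>ds\<close>.\<close>

lemma relF_expand:
  "(\<And>ds. apps \<phi> ds \<in> X \<Longrightarrow> \<exists>\<phi>'\<in>Y. apps \<phi>' ds \<in> X) \<Longrightarrow> (\<And>\<phi>'. \<phi>' \<in> Y \<Longrightarrow> relF T \<phi>' v) \<Longrightarrow> relF T \<phi> v"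
proof (induction T arbitrary: \<phi> Y v rule: fty_induct)
  case 1
  show ?case using 1(1)[of "[]"] 1(2) by auto
next
  case (2 A T)
  have "relF T (App \<phi> \<psi>) (apply_val U v w)"
    if \<psi>: "closed_exp \<psi> A" "w \<in> dom_ty U A" "rel A \<psi> w" for \<psi> w
  proof (rule 2(1)[of _ "(\<lambda>\<phi>'. App \<phi>' \<psi>) ` Y"])
    fix ds assume "apps (App \<phi> \<psi>) ds \<in> X"
    then show "\<exists>\<phi>'\<in>(\<lambda>\<phi>'. App \<phi>' \<psi>) ` Y. apps \<phi>' ds \<in> X"
      using 2(2)[of "\<psi> # ds"] by simp
  next
    fix \<phi>' assume "\<phi>' \<in> (\<lambda>\<phi>'. App \<phi>' \<psi>) ` Y"
    then obtain \<phi>'' where "\<phi>'' \<in> Y" "\<phi>' = App \<phi>'' \<psi>" by blast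
    then show "relF T \<phi>' (apply_val U v w)"
      using 2(3)[of \<phi>''] \<psi> by simp
  qed
  then show ?case by simp
qed

text \<open>Moving towards the truth value wanted on side \<open>b\<close> cannot break the
  relation, since its base clause asks for the top value \<open>Truth b\<close>.\<close>

lemma relF_up:
  "fullF U T \<Longrightarrow> v \<in> domF U T \<Longrightarrow> w \<in> domF U T \<Longrightarrow> relF T \<phi> v \<Longrightarrow> leb U b T v w \<Longrightarrow> relF T \<phi> w"
proof (induction T arbitrary: \<phi> v w rule: fty_induct)
  case 1
  then show ?case by (auto simp: leb_def split: if_splits)
next
  case (2 A T)
  have "relF T (App \<phi> \<psi>) (apply_val U w x)"
    if \<psi>: "closed_exp \<psi> A" "x \<in> dom_ty U A" "rel A \<psi> x" for \<psi> x
  proof (rule 2(1)[OF _ apply_in_domF[OF 2(2,3) \<psi>(2)] apply_in_domF[OF 2(2,4) \<psi>(2)]])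
    show "fullF U T" using 2(2) by simp
    show "relF T (App \<phi> \<psi>) (apply_val U v x)" using 2(5) \<psi> by simp
    show "leb U b T (apply_val U v x) (apply_val U w x)" using 2(6) \<psi>(2) by (simp add: leb_def split: if_splits)
  qed
  then show ?case by simp
qed

text \<open>Holds because \<open>Truth b\<close> is the top at the base and \<open>meet\<close> is
  computed pointwise. An empty \<open>V\<close> gives the top value, which is related to
  everything.\<close>

lemma relF_meet:
  "fullF U T \<Longrightarrow> V \<subseteq> domF U T \<Longrightarrow> (\<And>v. v \<in> V \<Longrightarrow> relF T \<phi> v) \<Longrightarrow> relF T \<phi> (meet U b T V)"
proof (induction T arbitrary: \<phi> V rule: fty_induct)
  case 1
  then show ?case by auto
next
  case (2 A T)
  have "relF T (App \<phi> \<psi>) (apply_val U (meet U b (TFun A T) V) x)"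
    if \<psi>: "closed_exp \<psi> A" "x \<in> dom_ty U A" "rel A \<psi> x" for \<psi> x
  proof -
    have "apply_val U (meet U b (TFun A T) V) x = meet U b T ((\<lambda>v. apply_val U v x) ` V)"
      using meet_is_inf[OF 2(2,3), of b] \<psi>(2) by blast
    moreover have "relF T (App \<phi> \<psi>) (meet U b T ((\<lambda>v. apply_val U v x) ` V))"
    proof (rule 2(1))
      show "fullF U T" using 2(2) by simp
      show "(\<lambda>v. apply_val U v x) ` V \<subseteq> domF U T"
        using apply_in_domF[OF 2(2) subsetD[OF 2(3)] \<psi>(2)] by blast
      fix v assume "v \<in> (\<lambda>v. apply_val U v x) ` V"
      then obtain v' where "v' \<in> V" "v = apply_val U v' x" by blast
      then show "relF T (App \<phi> \<psi>) v" using 2(4)[of v'] \<psi> by simp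
    qed
    ultimately show ?thesis by (simp only:)
  qed
  then show ?case by (simp del: meet.simps)
qed

lemma relF_atom:
  "(\<And>ms. length ms = k \<Longrightarrow> apps \<phi> (map num ms) \<in> X \<Longrightarrow> foldl (apply_val U) v (map Num ms) = Truth b) \<Longrightarrow>
    relF ((TFun TNat ^^ k) TOmega) \<phi> v"
proof (induction k arbitrary: \<phi> v)
  case 0
  from 0[of "[]"] show ?case by simp
next
  case (Suc k)
  have "relF ((TFun TNat ^^ k) TOmega) (App \<phi> (num n)) (apply_val U v (Num n))" for n
  proof (rule Suc.IH)
    fix ms :: "nat list" 
    assume "length ms = k" "apps (App \<phi> (num n)) (map num ms) \<in> X"
    then show "foldl (apply_val U) (apply_val U v (Num n)) (map Num ms) = Truth b"
      using Suc.prems[of "n # ms"] by simp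
  qed
  then show ?case by auto
qed

text \<open>The environment pairs closed expressions with related values. Beta reduction and
  unfolding are reversed by \<open>relF_expand\<close>; the free first-order variables are covered
  by \<open>Atom\<close>.\<close>

lemma fundamental:
  assumes "has_type \<Theta> e A" "\<forall>B\<in>types_of \<Theta> e. full U B" "\<forall>x\<in>fvs e. first_order x \<and> \<rho> x \<in> dom_ty U (snd x)"
    "\<forall>B\<in>set \<Theta>. full U B" "length us = length \<Theta>" "length \<eta> = length \<Theta>"
    "\<forall>i<length \<Theta>. closed_exp (us ! i) (\<Theta> ! i) \<and> \<eta> ! i \<in> dom_ty U (\<Theta> ! i) \<and> rel (\<Theta> ! i) (us ! i) (\<eta> ! i)"
  shows "rel A (psub 0 us e) (sem U \<rho> \<eta> e)"
  using assms
proof (induction arbitrary: us \<eta> rule: has_type.induct)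
  case (1 \<Theta> x)
  then obtain k where k: "snd x = TForm ((TFun TNat ^^ k) TOmega)" by (auto simp: first_order_def)
  have "relF ((TFun TNat ^^ k) TOmega) (FV x) (\<rho> x)"
    by (rule relF_atom) (use Atom[of x] k in blast)
  then show ?case using k by simp
next
  case (2 i \<Theta>)
  then show ?case by simp
next
  case (3 \<Theta>)
  then show ?case by (auto intro: exI[of _ 0])
next
  case (4 \<Theta> t)
  from 4(2)[OF _ _ 4(5-8)] 4(3,4) obtain n where "psub 0 us t = num n" "sem U \<rho> \<eta> t = Num n" by auto
  then show ?case by (auto intro: exI[of _ "Suc n"])
next
  case (5 \<Theta> s t)
  from 5(3)[OF _ _ 5(7-10)] 5(5,6) obtain n where "psub 0 us s = num n" "sem U \<rho> \<eta> s = Num n" by auto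
  moreover from 5(4)[OF _ _ 5(7-10)] 5(5,6) obtain m where "psub 0 us t = num m" "sem U \<rho> \<eta> t = Num m" by auto
  ultimately show ?case using Eq[of n m] by auto
next
  case (6 \<Theta> \<phi> \<psi>)
  have "relF TOmega (psub 0 us \<phi>) (sem U \<rho> \<eta> \<phi>)" "relF TOmega (psub 0 us \<psi>) (sem U \<rho> \<eta> \<psi>)"
    using 6(3)[OF _ _ 6(7-10)] 6(4)[OF _ _ 6(7-10)] 6(5,6) by simp_all
  then show ?case using Or[of "psub 0 us \<phi>" "psub 0 us \<psi>"] by (auto split: if_splits)
next
  case (7 \<Theta> \<phi> \<psi>)
  have "relF TOmega (psub 0 us \<phi>) (sem U \<rho> \<eta> \<phi>)" "relF TOmega (psub 0 us \<psi>) (sem U \<rho> \<eta> \<psi>)"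
    using 7(3)[OF _ _ 7(7-10)] 7(4)[OF _ _ 7(7-10)] 7(5,6) by simp_all
  then show ?case using And[of "psub 0 us \<phi>" "psub 0 us \<psi>"] by (auto split: if_splits)
next
  case (8 A \<Theta> \<phi> T)
  have full: "fullF U (TFun A T)"
    using full_type[OF has_type.intros(8)[OF 8(1)] 8(3)] by simp
  then have A: "\<forall>B\<in>set (A # \<Theta>). full U B" using 8(5) by simp
  have env: "envle U \<Theta> \<eta> \<eta>" using 8(5,7,8) by (intro envle_refl) auto
  have cl: "\<forall>u\<in>set us. \<exists>B. has_type [] u B" using 8(6,8) by (metis closed_exp_def in_set_conv_nth)
  have "relF T (App (psub 0 us (Lam A \<phi>)) \<psi>) (apply_val U (sem U \<rho> \<eta> (Lam A \<phi>)) w)"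
    if \<psi>: "closed_exp \<psi> A" "w \<in> dom_ty U A" "rel A \<psi> w" for \<psi> w
  proof (rule relF_expand[of _ "{psub 0 (\<psi> # us) \<phi>}"])
    fix ds assume "apps (App (psub 0 us (Lam A \<phi>)) \<psi>) ds \<in> X"
    then have "apps (inst 0 \<psi> (psub (Suc 0) us \<phi>)) ds \<in> X" using Lam by simp
    moreover have "inst 0 \<psi> (psub (Suc 0) us \<phi>) = psub 0 (\<psi> # us) \<phi>"
      by (rule inst_psub[OF 8(1)]) (use 8(6) cl in simp_all)
    ultimately show "\<exists>\<phi>'\<in>{psub 0 (\<psi> # us) \<phi>}. apps \<phi>' ds \<in> X" by simp
  next
    fix \<phi>' assume "\<phi>' \<in> {psub 0 (\<psi> # us) \<phi>}"
    moreover have "apply_val U (sem U \<rho> \<eta> (Lam A \<phi>)) w = sem U \<rho> (w # \<eta>) \<phi>"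
      by (rule sem_Lam_apply[OF 8(1,3) _ 8(5) env \<psi>(2)]) (use 8(4) in auto)
    moreover have "rel (TForm T) (psub 0 (\<psi> # us) \<phi>) (sem U \<rho> (w # \<eta>) \<phi>)"
    proof (rule 8(2)[OF _ _ A])
      show "\<forall>i<length (A # \<Theta>). closed_exp ((\<psi> # us) ! i) ((A # \<Theta>) ! i) \<and> (w # \<eta>) ! i \<in> dom_ty U ((A # \<Theta>) ! i) \<and>
          rel ((A # \<Theta>) ! i) ((\<psi> # us) ! i) ((w # \<eta>) ! i)"
        using 8(8) \<psi> by (simp add: All_less_Suc2)
    qed (use 8(3,4,6,7) in simp_all)
    ultimately show "relF T \<phi>' (apply_val U (sem U \<rho> \<eta> (Lam A \<phi>)) w)" by simp
  qed
  then show ?case by (simp del: sem.simps psub.simps)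
next
  case (9 \<Theta> \<phi> A T \<psi>)
  have env: "envle U \<Theta> \<eta> \<eta>" using 9(7,9,10) by (intro envle_refl) auto
  have 1: "rel (TForm (TFun A T)) (psub 0 us \<phi>) (sem U \<rho> \<eta> \<phi>)"
    using 9(3)[OF _ _ 9(7-10)] 9(5,6) by simp
  have 2: "rel A (psub 0 us \<psi>) (sem U \<rho> \<eta> \<psi>)"
    using 9(4)[OF _ _ 9(7-10)] 9(5,6) by simp
  have 3: "sem U \<rho> \<eta> \<psi> \<in> dom_ty U A"
    using sem_mono[OF 9(2) _ _ 9(7) env] 9(5,6) by simp
  have "has_type [] (psub 0 us \<psi>) A"
    using has_type_psub[of "[]" \<Theta> \<psi> A us] 9(2,8,10) by (simp add: closed_exp_def)
  moreover have "\<forall>x\<in>fvs (psub 0 us \<psi>). first_order x"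
  proof
    fix x assume "x \<in> fvs (psub 0 us \<psi>)"
    then have "x \<in> fvs \<psi> \<or> (\<exists>u\<in>set us. x \<in> fvs u)" using fvs_psub[OF 9(2), of 0 us] 9(8) by auto
    then show "first_order x" using 9(6,8,10) by (auto simp: closed_exp_def in_set_conv_nth)
  qed
  ultimately show ?case using 1 2 3 by (simp add: closed_exp_def)
next
  case (10 T \<Theta> \<phi> \<sigma> p)
  have F: "fullF U T" using 10(3) by simp
  then have A: "\<forall>B\<in>set (TForm T # \<Theta>). full U B" using 10(5) by simp
  have env: "envle U \<Theta> \<eta> \<eta>" using 10(5,7,8) by (intro envle_refl) auto
  have cl: "\<forall>u\<in>set us. \<exists>B. has_type [] u B" using 10(6,8) by (metis closed_exp_def in_set_conv_nth)
  define \<phi>' where "\<phi>' = psub (Suc 0) us \<phi>"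
  define G where "G = (\<lambda>v. sem U \<rho> (v # \<eta>) \<phi>)"
  define fp where "fp = fixpt U \<sigma> T G"
  have "sem U \<rho> (v # \<eta>) \<phi> \<in> domF U T \<and> leF U T (sem U \<rho> (v # \<eta>) \<phi>) (sem U \<rho> (w # \<eta>) \<phi>)"
    if "v \<in> domF U T" "w \<in> domF U T" "leF U T v w" for v w
    using sem_mono[OF 10(1) _ _ A envle_Cons[OF env, of v "TForm T" w]] that 10(3,4) by simp
  then have G: "\<forall>v\<in>domF U T. G v \<in> domF U T" "\<forall>v\<in>domF U T. \<forall>w\<in>domF U T. leF U T v w \<longrightarrow> leF U T (G v) (G w)"
    using leF_refl[OF F] unfolding G_def by blast+
  have "has_type [TForm T] \<phi>' (TForm T)"
    using has_type_psub[of "[TForm T]" \<Theta> \<phi> "TForm T" us] 10(1,6,8) by (simp add: closed_exp_def \<phi>'_def)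
  then have ty_fix: "has_type [] (Fix \<sigma> q T \<phi>') (TForm T)" for q by (rule has_type.intros)
  moreover have "\<forall>x\<in>fvs \<phi>'. first_order x"
  proof
    fix x assume "x \<in> fvs \<phi>'"
    then have "x \<in> fvs \<phi> \<or> (\<exists>u\<in>set us. x \<in> fvs u)"
      using fvs_psub[OF 10(1), of "Suc 0" us] 10(6) by (auto simp: \<phi>'_def)
    then show "first_order x" using 10(4,6,8) by (auto simp: closed_exp_def in_set_conv_nth)
  qed
  ultimately have cl_fix: "closed_exp (Fix \<sigma> q T \<phi>') (TForm T)" for q by (simp add: closed_exp_def)
  \<comment> \<open>One unfolding: the hypothesis for the body, with the operator itself and
    \<open>v\<close> as the new pair of the environment.\<close>
  have step: "relF T (inst 0 (Fix \<sigma> q T \<phi>') \<phi>') (G v)" if "v \<in> domF U T" "relF T (Fix \<sigma> q T \<phi>') v" for q v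
  proof -
    have "inst 0 (Fix \<sigma> q T \<phi>') \<phi>' = psub 0 (Fix \<sigma> q T \<phi>' # us) \<phi>"
      unfolding \<phi>'_def by (rule inst_psub[OF 10(1)]) (use 10(6) cl in simp_all)
    moreover have "rel (TForm T) (psub 0 (Fix \<sigma> q T \<phi>' # us) \<phi>) (sem U \<rho> (v # \<eta>) \<phi>)"
    proof (rule 10(2)[OF _ _ A])
      show "\<forall>i<length (TForm T # \<Theta>). closed_exp ((Fix \<sigma> q T \<phi>' # us) ! i) ((TForm T # \<Theta>) ! i) \<and>
          (v # \<eta>) ! i \<in> dom_ty U ((TForm T # \<Theta>) ! i) \<and>
          rel ((TForm T # \<Theta>) ! i) ((Fix \<sigma> q T \<phi>' # us) ! i) ((v # \<eta>) ! i)"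
        using 10(8) that cl_fix by (simp add: All_less_Suc2)
    qed (use 10(3,4,6,7) in simp_all)
    ultimately show ?thesis by (simp add: G_def)
  qed
  obtain b' where \<sigma>: "\<sigma> = kind b'" by (rule kind_surj)
  note fp = fixpt_least[where b = b', OF F G, folded \<sigma>, folded fp_def]
  \<comment> \<open>Stated for every \<open>q\<close>, because unfolding the copy with annotation
    \<open>q\<close> leads to the copy with \<open>q @ [k]\<close>.\<close>
  have "relF T (Fix \<sigma> q T \<phi>') fp" for q
  proof (cases "b' = b")
    case True
    show ?thesis
    \<comment> \<open>For \<open>kind b\<close> each unfolding goes to a smaller annotation, and
      \<open>G fp = fp\<close> turns the relation for the body into the one for the
      operator.\<close>
    proof (induction q rule: wf_induct_rule[OF wf])
      case (1 q)
      show ?case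
      proof (rule relF_expand[of _ "{inst 0 (Fix \<sigma> (q @ [k]) T \<phi>') \<phi>' |k. (q @ [k], q) \<in> W}"])
        fix ds assume "apps (Fix \<sigma> q T \<phi>') ds \<in> X"
        from Fix[OF this] show "\<exists>\<chi>\<in>{inst 0 (Fix \<sigma> (q @ [k]) T \<phi>') \<phi>' |k. (q @ [k], q) \<in> W}. apps \<chi> ds \<in> X"
          using True \<sigma> by blast
      next
        fix \<chi> assume "\<chi> \<in> {inst 0 (Fix \<sigma> (q @ [k]) T \<phi>') \<phi>' |k. (q @ [k], q) \<in> W}"
        then obtain k where k: "\<chi> = inst 0 (Fix \<sigma> (q @ [k]) T \<phi>') \<phi>'" "(q @ [k], q) \<in> W" by blast
        show "relF T \<chi> fp"
          using step[OF fp(1) 1[OF k(2)]] unfolding k(1) fp(2) .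
      qed
    qed
  next
    case False
    define V where "V = {v \<in> domF U T. \<forall>q. relF T (Fix \<sigma> q T \<phi>') v}"
    define u where "u = meet U b T V"
    have V: "V \<subseteq> domF U T" by (auto simp: V_def)
    note inf = meet_is_inf[OF F V, of b, folded u_def]
    have rel_u: "relF T (Fix \<sigma> q T \<phi>') u" for q
      unfolding u_def by (rule relF_meet[OF F V]) (simp add: V_def)
    \<comment> \<open>\<open>u\<close> is related at every annotation, so one unfolding with
      whatever number \<open>k\<close> suffices for \<open>G u\<close>; hence \<open>G u\<close>
      belongs to \<open>V\<close>.\<close>
    have "relF T (Fix \<sigma> q T \<phi>') (G u)" for q
    proof (rule relF_expand[of _ "{inst 0 (Fix \<sigma> (q @ [k]) T \<phi>') \<phi>' |k. True}"])
      fix ds assume "apps (Fix \<sigma> q T \<phi>') ds \<in> X"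
      from Fix[OF this] show "\<exists>\<chi>\<in>{inst 0 (Fix \<sigma> (q @ [k]) T \<phi>') \<phi>' |k. True}. apps \<chi> ds \<in> X"
        by blast
    next
      fix \<chi> assume "\<chi> \<in> {inst 0 (Fix \<sigma> (q @ [k]) T \<phi>') \<phi>' |k. True}"
      then show "relF T \<chi> (G u)" using step rel_u inf by blast
    qed
    then have "G u \<in> V" using G inf by (simp add: V_def)
    then have "leb U b T u (G u)" using inf by blast
    \<comment> \<open>\<open>b\<close> and \<open>b'\<close> give opposite orders: a post-fixed
      point for one is a pre-fixed point for the other, where \<open>fp\<close> is least.\<close>
    then have "leb U b' T (G u) u" using False by (cases b; cases b') (auto simp: leb_def)
    then have "leb U b' T fp u" using fp(3) inf by blast
    then have "leb U b T u fp" using False by (cases b; cases b') (auto simp: leb_def)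
    then show ?thesis using relF_up[OF F _ fp(1) rel_u] inf by blast
  qed
  then show ?case unfolding sem_Fix_fixpt fp_def G_def \<phi>'_def by simp
qed

lemma truth:
  assumes "has_type [] a (TForm TOmega)" "\<forall>B\<in>types_of [] a. full U B"
    "\<forall>x\<in>fvs a. first_order x \<and> \<rho> x \<in> dom_ty U (snd x)" "a \<in> X"
  shows "sem U \<rho> [] a = Truth b"
  using fundamental[OF assms(1-3), of "[]" "[]"] psub_closed[OF assms(1), of 0 "[]"] assms(4) by simp

end


section \<open>Erasure of annotations and substitution for free variables\<close>

lemma has_type_map_exp [simp]: "has_type \<Theta> (map_exp f e) A \<longleftrightarrow> has_type \<Theta> e A"
proof
  show "has_type \<Theta> (map_exp f e) A" if "has_type \<Theta> e A"
    using that by (induction rule: has_type.induct) (auto intro: has_type.intros)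
  show "has_type \<Theta> e A" if "has_type \<Theta> (map_exp f e) A"
    using that
  proof (induction e arbitrary: \<Theta> A)
    case (BV i)
    then show ?case by (auto elim!: has_type_BV intro: has_type.intros)
  next
    case (App e1 e2)
    from App.prems[simplified] obtain B T where "A = TForm T" "has_type \<Theta> (map_exp f e1) (TForm (TFun B T))"
        "has_type \<Theta> (map_exp f e2) B"
      by (rule has_type_App)
    then show ?case using App.IH has_type.intros(9) by blast
  qed (auto elim!: has_type_FV has_type_Zero has_type_Succ has_type_Eq has_type_Or has_type_And
      has_type_Lam has_type_App has_type_Fix intro: has_type.intros)
qed

lemma map_exp_num [simp]: "map_exp f (num n) = num n"
  by (induction n) auto

lemma set_exp_num [simp]: "set_exp (num n) = {}"
  by (induction n) auto

lemma erase_fm [simp]: "erase (e :: fm) = e"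
  by (induction e) auto

lemma typed_seq_iff:
  "typed_seq (\<Gamma>, \<Delta>) \<longleftrightarrow> (\<forall>\<phi>\<in>set \<Gamma>. has_type [] \<phi> (TForm TOmega)) \<and> (\<forall>\<phi>\<in>set \<Delta>. has_type [] \<phi> (TForm TOmega))"
  by (auto simp: typed_seq_def)

lemma subst_cong: "\<forall>x\<in>fvs e. f x = g x \<Longrightarrow> subst f e = subst g e"
  by (induction e) auto

lemma subst_FV: "\<forall>x\<in>fvs e. f x = FV x \<Longrightarrow> subst f e = e"
  by (induction e) auto

lemma finite_fvs: "finite (fvs e)"
  by (induction e) auto

lemma finite_fvs_seq: "finite (fvs_seq S)"
  by (auto simp: fvs_seq_def finite_fvs)


section \<open>Building proofs\<close>

definition good :: "(nat \<Rightarrow> deriv) \<Rightarrow> (nat \<Rightarrow> nat) \<Rightarrow> bool" where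
  "good b j \<longleftrightarrow> (\<exists>m \<tau>.
     fst (\<tau> 0) = Lhs \<and> fix_trace Mu (\<lambda>i. b (m + i)) (\<lambda>i. j (m + i)) \<tau> \<or>
     fst (\<tau> 0) = Rhs \<and> fix_trace Nu (\<lambda>i. b (m + i)) (\<lambda>i. j (m + i)) \<tau>)"

lemma infinitary_proof_iff: "infinitary_proof d \<longleftrightarrow> derivation d \<and> (\<forall>b j. branch d b j \<longrightarrow> good b j)"
  by (simp add: infinitary_proof_def good_def)

text \<open>Acceptance allows a finite prefix to be dropped, so a branch that enters an accepted
  proof is itself accepted.\<close>

lemma good_tail: "good (\<lambda>i. b (n + i)) (\<lambda>i. j (n + i)) \<Longrightarrow> good b j"
  unfolding good_def add.assoc[symmetric] by blast

definition pf :: "sequent \<Rightarrow> deriv" where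
  "pf S = (SOME d. infinitary_proof d \<and> concl (root d) = S)"

lemma pf: "provable S \<Longrightarrow> infinitary_proof (pf S) \<and> concl (root (pf S)) = S"
  unfolding pf_def provable_def by (rule someI_ex)

text \<open>The tree of a proof search with states \<open>'s\<close>; at provable sequents a proof is plugged in, so
  that only branches consisting of unprovable sequents need a trace.\<close>

primcorec grow :: "('s \<Rightarrow> sequent) \<Rightarrow> ('s \<Rightarrow> rule) \<Rightarrow> ('s \<Rightarrow> 's list) \<Rightarrow> 's \<Rightarrow> deriv" where
  "root (grow sq rl nx s) = (if provable (sq s) then root (pf (sq s)) else rl s)"
| "subs (grow sq rl nx s) = (if provable (sq s) then subs (pf (sq s)) else map (grow sq rl nx) (nx s))"

lemma grow_provable: "provable (sq s) \<Longrightarrow> grow sq rl nx s = pf (sq s)"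
  by (rule deriv.expand) simp

lemma derivation_iff: "derivation d \<longleftrightarrow> rule_ok (root d) \<and> typed_seq (concl (root d)) \<and>
    map (\<lambda>d. concl (root d)) (subs d) = prems (root d) \<and> (\<forall>d'\<in>set (subs d). derivation d')"
  by (cases d) (auto elim: derivation.cases intro: derivation.intros)

lemma derivation_coinduct:
  assumes "P d" and "\<And>d. P d \<Longrightarrow> rule_ok (root d) \<and> typed_seq (concl (root d)) \<and>
    map (\<lambda>d. concl (root d)) (subs d) = prems (root d) \<and> (\<forall>d'\<in>set (subs d). P d' \<or> derivation d')"
  shows "derivation d"
  using assms(1)
proof (coinduction arbitrary: d)
  case derivation
  then show ?case using assms(2)[of d] by (cases d) auto
qed

text \<open>A branch either enters a plugged-in proof and is accepted there, or follows states with
  unprovable sequents forever. This is why \<open>step\<close> and \<open>good\<close> may assume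
  unprovability.\<close>

lemma provable_search:
  assumes I: "I start"
    and step: "\<And>s. I s \<Longrightarrow> \<not> provable (sq s) \<Longrightarrow> rule_ok (rl s) \<and> typed_seq (sq s) \<and> concl (rl s) = sq s \<and>
      map sq (nx s) = prems (rl s) \<and> (\<forall>s'\<in>set (nx s). I s')"
    and good: "\<And>b st j. st 0 = start \<Longrightarrow> (\<And>i. I (st i) \<and> \<not> provable (sq (st i)) \<and> root (b i) = rl (st i) \<and>
      j i < length (nx (st i)) \<and> st (Suc i) = nx (st i) ! j i) \<Longrightarrow> good b j"
  shows "provable (sq start)"
proof -
  let ?t = "grow sq rl nx"
  have concl: "concl (root (?t s)) = sq s" if "I s" for s
    using that step pf by auto
  have "derivation (?t s)" if "I s" for s
  proof (rule derivation_coinduct[of "\<lambda>d. \<exists>s. I s \<and> d = ?t s"])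
    show "\<exists>s'. I s' \<and> ?t s = ?t s'" using that by blast
    fix d assume "\<exists>s. I s \<and> d = ?t s"
    then obtain s where s: "I s" "d = ?t s" by blast
    show "rule_ok (root d) \<and> typed_seq (concl (root d)) \<and>
      map (\<lambda>d. concl (root d)) (subs d) = prems (root d) \<and>
      (\<forall>d'\<in>set (subs d). (\<exists>s. I s \<and> d' = ?t s) \<or> derivation d')"
    proof (cases "provable (sq s)")
      case True
      then have "derivation d"
        using s(2) pf[OF True] grow_provable[of sq s rl nx] by (simp add: infinitary_proof_iff)
      then show ?thesis using derivation_iff[of d] by blast
    next
      case False
      note st = step[OF s(1) False]
      have "map (\<lambda>d. concl (root d)) (subs d) = map (\<lambda>s. concl (root (?t s))) (nx s)"
        by (simp add: s(2) False comp_def del: grow.sel(1))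
      also have "\<dots> = map sq (nx s)" using st concl by (intro map_cong) blast+
      finally have "map (\<lambda>d. concl (root d)) (subs d) = map sq (nx s)" .
      then show ?thesis using st False by (auto simp: s(2))
    qed
  qed
  moreover have "good b j" if "branch (?t start) b j" for b j
  proof (cases "\<exists>n s. provable (sq s) \<and> b n = ?t s")
    case True
    then obtain n s where n: "provable (sq s)" "b n = ?t s" by blast
    then have "branch (pf (sq s)) (\<lambda>i. b (n + i)) (\<lambda>i. j (n + i))"
      using that grow_provable[of sq s rl nx] n(1) by (simp add: branch_def)
    then have "good (\<lambda>i. b (n + i)) (\<lambda>i. j (n + i))" using pf[OF n(1)] by (auto simp: infinitary_proof_iff)
    then show ?thesis by (rule good_tail)
  next
    case False
    \<comment> \<open>The states are rebuilt from the premise numbers, since a tree does not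
      determine the state it was grown from.\<close>
    define st where "st = rec_nat start (\<lambda>i s. nx s ! j i)"
    have st: "st 0 = start" "\<And>i. st (Suc i) = nx (st i) ! j i" by (simp_all add: st_def)
    have inv: "I (st i) \<and> b i = ?t (st i)" for i
    proof (induction i)
      case 0
      then show ?case using I that st by (simp add: branch_def)
    next
      case (Suc i)
      then have np: "\<not> provable (sq (st i))" using False by blast
      then have "j i < length (nx (st i))" "b (Suc i) = ?t (nx (st i) ! j i)"
        using that Suc unfolding branch_def by (metis grow.sel(2) length_map, metis grow.sel(2) length_map nth_map)
      then show ?case using st(2) step[of "st i"] Suc np by simp
    qed
    show ?thesis
    proof (rule good[of st, OF st(1)])
      fix i
      have np: "\<not> provable (sq (st i))" using False inv by blast
      moreover have "j i < length (nx (st i))"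
        using that inv[of i] np unfolding branch_def by (metis grow.sel(2) length_map)
      ultimately show "I (st i) \<and> \<not> provable (sq (st i)) \<and> root (b i) = rl (st i) \<and>
          j i < length (nx (st i)) \<and> st (Suc i) = nx (st i) ! j i"
        using inv[of i] st(2) by simp
    qed
  qed
  ultimately show ?thesis using I concl unfolding provable_def infinitary_proof_iff by blast
qed

text \<open>A search with sequents as states that ends after one step: every premise is provable, so
  no infinite branch of unprovable sequents is left.\<close>

lemma provable_rule:
  assumes "rule_ok r" "typed_seq (concl r)" "\<And>S. S \<in> set (prems r) \<Longrightarrow> provable S"
  shows "provable (concl r)"
proof -
  have "provable (id (concl r))"
  proof (rule provable_search[where sq = id and start = "concl r" and I = "\<lambda>s. s = concl r \<or> provable s" and rl = "\<lambda>_. r" and nx = "\<lambda>_. prems r"])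
    fix b and st :: "nat \<Rightarrow> sequent" and j
    assume "st 0 = concl r" and "\<And>i. (st i = concl r \<or> provable (st i)) \<and> \<not> provable (id (st i)) \<and> root (b i) = r \<and>
      j i < length (prems r) \<and> st (Suc i) = prems r ! j i"
    from this(2)[of 0] this(2)[of "Suc 0"] assms(3)[of "st (Suc 0)"] nth_mem[of "j 0" "prems r"]
    show "good b j" by auto
  qed (use assms in auto)
  then show ?thesis by simp
qed

section \<open>Structural rules and sequents that close a branch\<close>

lemma weakL: "provable (\<Gamma>, \<Delta>) \<Longrightarrow> typed_seq (\<Gamma> @ [\<phi>], \<Delta>) \<Longrightarrow> provable (\<Gamma> @ [\<phi>], \<Delta>)"
  using provable_rule[of "WeakL \<Gamma> \<phi> \<Delta>"] by (simp add: rule_ok_def)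

lemma weakR: "provable (\<Gamma>, \<Delta>) \<Longrightarrow> typed_seq (\<Gamma>, \<phi> # \<Delta>) \<Longrightarrow> provable (\<Gamma>, \<phi> # \<Delta>)"
  using provable_rule[of "WeakR \<Gamma> \<phi> \<Delta>"] by (simp add: rule_ok_def)

lemma weakL_append: "provable (\<Gamma>, \<Delta>) \<Longrightarrow> typed_seq (\<Gamma> @ \<Gamma>', \<Delta>) \<Longrightarrow> provable (\<Gamma> @ \<Gamma>', \<Delta>)"
proof (induction \<Gamma>' rule: rev_induct)
  case (snoc \<phi> \<Gamma>')
  then show ?case using weakL[of "\<Gamma> @ \<Gamma>'" \<Delta> \<phi>] by (simp add: typed_seq_iff)
qed simp

lemma weakR_append: "provable (\<Gamma>, \<Delta>) \<Longrightarrow> typed_seq (\<Gamma>, \<Delta>' @ \<Delta>) \<Longrightarrow> provable (\<Gamma>, \<Delta>' @ \<Delta>)"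
  by (induction \<Delta>') (auto intro: weakR simp: typed_seq_iff)

lemma exchL_append:
  "provable (\<Gamma> @ \<phi> # \<Gamma>', \<Delta>) \<Longrightarrow> typed_seq (\<Gamma> @ \<phi> # \<Gamma>', \<Delta>) \<Longrightarrow> provable (\<Gamma> @ \<Gamma>' @ [\<phi>], \<Delta>)"
proof (induction \<Gamma>' arbitrary: \<Gamma>)
  case (Cons \<psi> \<Gamma>')
  have "provable (\<Gamma> @ \<psi> # \<phi> # \<Gamma>', \<Delta>)"
    using provable_rule[of "ExchL \<Gamma> \<psi> \<phi> \<Gamma>' \<Delta>"] Cons.prems by (simp add: rule_ok_def typed_seq_iff)
  then show ?case using Cons.IH[of "\<Gamma> @ [\<psi>]"] Cons.prems by (simp add: typed_seq_iff)
qed simp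

lemma exchR_append:
  "provable (\<Gamma>, \<Delta> @ \<phi> # \<Delta>') \<Longrightarrow> typed_seq (\<Gamma>, \<Delta> @ \<phi> # \<Delta>') \<Longrightarrow> provable (\<Gamma>, \<phi> # \<Delta> @ \<Delta>')"
proof (induction \<Delta> arbitrary: \<Delta>' rule: rev_induct)
  case (snoc \<psi> \<Delta>)
  have "provable (\<Gamma>, \<Delta> @ \<phi> # \<psi> # \<Delta>')"
    using provable_rule[of "ExchR \<Gamma> \<Delta> \<phi> \<psi> \<Delta>'"] snoc.prems by (simp add: rule_ok_def typed_seq_iff)
  then show ?case using snoc.IH[of "\<psi> # \<Delta>'"] snoc.prems by (simp add: typed_seq_iff)
qed simp

lemma weaken_singleL:
  assumes "provable ([\<phi>], \<Delta>)" "\<phi> \<in> set \<Gamma>" "typed_seq (\<Gamma>, \<Delta>)"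
  shows "provable (\<Gamma>, \<Delta>)"
proof -
  obtain \<Gamma>1 \<Gamma>2 where \<Gamma>: "\<Gamma> = \<Gamma>1 @ \<phi> # \<Gamma>2" using assms(2) by (meson split_list)
  have "provable ([\<phi>] @ \<Gamma>1, \<Delta>)" by (rule weakL_append[OF assms(1)]) (use assms(3) \<Gamma> in \<open>simp add: typed_seq_iff\<close>)
  then have "provable (\<Gamma>1 @ [\<phi>], \<Delta>)" using exchL_append[of "[]" \<phi> \<Gamma>1 \<Delta>] assms(3) \<Gamma> by (simp add: typed_seq_iff)
  then show ?thesis using weakL_append[of "\<Gamma>1 @ [\<phi>]" \<Delta> \<Gamma>2] assms(3) \<Gamma> by simp
qed

lemma weaken_singleR:
  assumes "provable (\<Gamma>, [\<phi>])" "\<phi> \<in> set \<Delta>" "typed_seq (\<Gamma>, \<Delta>)"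
  shows "provable (\<Gamma>, \<Delta>)"
proof -
  obtain \<Delta>1 \<Delta>2 where \<Delta>: "\<Delta> = \<Delta>1 @ \<phi> # \<Delta>2" using assms(2) by (meson split_list)
  have "provable (\<Gamma>, \<Delta>2 @ [\<phi>])" by (rule weakR_append[OF assms(1)]) (use assms(3) \<Delta> in \<open>simp add: typed_seq_iff\<close>)
  then have "provable (\<Gamma>, \<phi> # \<Delta>2)" using exchR_append[of \<Gamma> \<Delta>2 \<phi> "[]"] assms(3) \<Delta> by (simp add: typed_seq_iff)
  then show ?thesis using weakR_append[of \<Gamma> "\<phi> # \<Delta>2" \<Delta>1] assms(3) \<Delta> by simp
qed

lemma provable_axiom:
  assumes "\<phi> \<in> set \<Gamma>" "\<phi> \<in> set \<Delta>" "typed_seq (\<Gamma>, \<Delta>)"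
  shows "provable (\<Gamma>, \<Delta>)"
proof (rule weaken_singleR[OF weaken_singleL[OF _ assms(1)] assms(2,3)])
  show "provable ([\<phi>], [\<phi>])"
    using provable_rule[of "Axiom \<phi>"] assms by (simp add: rule_ok_def typed_seq_iff)
  show "typed_seq (\<Gamma>, [\<phi>])" using assms by (simp add: typed_seq_iff)
qed

lemma provable_eqR:
  assumes "Eq t t \<in> set \<Delta>" "typed_seq (\<Gamma>, \<Delta>)"
  shows "provable (\<Gamma>, \<Delta>)"
proof (rule weaken_singleR[OF _ assms])
  show "provable (\<Gamma>, [Eq t t])"
    using provable_rule[of "EqR \<Gamma> t []"] assms by (simp add: rule_ok_def typed_seq_iff)
qed

lemma has_type_EqI: "has_type \<Theta> s TNat \<Longrightarrow> has_type \<Theta> t TNat \<Longrightarrow> has_type \<Theta> (Eq s t) (TForm TOmega)"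
  by (rule has_type.intros)

text \<open>(P1) and (P2) refute \<open>S s = Z\<close> and strip successors. The mirror image
  \<open>Z = S s\<close> needs symmetry of equality, obtained from (=L) and joined by a cut.\<close>

lemma provable_num_neq: "n \<noteq> m \<Longrightarrow> provable ([Eq (num n) (num m)], [])"
proof (induction n arbitrary: m)
  case 0
  then obtain m' where m: "m = Suc m'" by (cases m) auto
  let ?s = "num m :: fm"
  define x y :: var where "x = (0, TNat)" and "y = (1, TNat)"
  have xy: "x \<noteq> y" by (simp add: x_def y_def)
  have t1: "has_type [] (Eq Zero ?s) (TForm TOmega)" and t2: "has_type [] (Eq ?s Zero) (TForm TOmega)"
    by (intro has_type_EqI has_type_num has_type.intros(3))+
  have "provable ([], [Eq Zero Zero])"
    by (rule provable_eqR[of Zero]) (auto simp: typed_seq_iff intro: has_type.intros)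
  \<comment> \<open>Putting \<open>Zero\<close> for \<open>y\<close> in \<open>y = Z\<close> gives
    the reflexive premise, putting the numeral gives the reversed equation; \<open>x\<close> is a
    dummy.\<close>
  then have "provable ([Eq Zero ?s], [Eq ?s Zero])"
    using provable_rule[of "EqL [] [Eq (FV y) Zero] x y Zero ?s"] xy t1 t2
    by (simp add: rule_ok_def typed_seq_iff x_def y_def)
  moreover have "provable ([Eq ?s Zero], [])"
    using provable_rule[of "P1 (num m')"] m t2 by (simp add: rule_ok_def typed_seq_iff)
  then have "provable ([Eq Zero ?s, Eq ?s Zero], [])"
    by (rule weaken_singleL) (use t1 t2 in \<open>auto simp: typed_seq_iff\<close>)
  ultimately have "provable ([Eq Zero ?s], [])"
    using provable_rule[of "Cut [Eq Zero ?s] (Eq ?s Zero) []"] t1 by (auto simp: rule_ok_def typed_seq_iff)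
  then show ?case by simp
next
  case (Suc n)
  have ty_eq: "has_type [] (Eq (num n) (num m)) (TForm TOmega)" for n m by (intro has_type_EqI has_type_num)
  show ?case
  proof (cases m)
    case 0
    then show ?thesis
      using provable_rule[of "P1 (num n)"] ty_eq[of "Suc n" 0] by (simp add: rule_ok_def typed_seq_iff)
  next
    case (Suc m')
    then show ?thesis
      using provable_rule[of "P2 [] (num n) (num m') []"] ty_eq[of "Suc n" "Suc m'"] Suc.IH[of m'] Suc.prems
      by (simp add: rule_ok_def typed_seq_iff)
  qed
qed

lemma provable_eqL:
  "Eq (num n) (num m) \<in> set \<Gamma> \<Longrightarrow> n \<noteq> m \<Longrightarrow> typed_seq (\<Gamma>, \<Delta>) \<Longrightarrow> provable (\<Gamma>, \<Delta>)"
proof (rule weaken_singleL)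
  assume "Eq (num n) (num m) \<in> set \<Gamma>" "n \<noteq> m" "typed_seq (\<Gamma>, \<Delta>)"
  then show "provable ([Eq (num n) (num m)], \<Delta>)"
    using weakR_append[OF provable_num_neq, of n m \<Delta>] by (simp add: typed_seq_iff)
qed


section \<open>The omega rule\<close>

text \<open>(=L) with a dummy \<open>y\<close> outside the sequent: \<open>v := v, y := n\<close>
  leaves the context of the conclusion unchanged, while the exchanged substitution
  \<open>v := n, y := v\<close> instantiates \<open>v\<close> in the premise.\<close>

lemma provable_eq_var:
  fixes v :: var
  assumes v: "snd v = TNat" and typed: "typed_seq (\<Gamma>, \<Delta>)"
    and prem: "provable (map (subst1 v (num n)) \<Gamma>, map (subst1 v (num n)) \<Delta>)"
  shows "provable (\<Gamma> @ [Eq (FV v) (num n)], \<Delta>)"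
proof -
  have "finite (insert (fst v) (fst ` fvs_seq (\<Gamma>, \<Delta>)))" using finite_fvs_seq by blast
  then obtain i where i: "i \<notin> insert (fst v) (fst ` fvs_seq (\<Gamma>, \<Delta>))" using ex_new_if_finite infinite_UNIV_nat by blast
  define y :: var where "y = (i, TNat)"
  have y: "y \<noteq> v" "y \<notin> fvs_seq (\<Gamma>, \<Delta>)" using i by (force simp: y_def)+
  have y': "y \<notin> fvs \<phi>" if "\<phi> \<in> set \<Gamma> \<union> set \<Delta>" for \<phi> using y(2) that by (auto simp: fvs_seq_def)
  have 1: "subst2 v (FV v) y (num n) \<phi> = \<phi>" if "\<phi> \<in> set \<Gamma> \<union> set \<Delta>" for \<phi>
    by (rule subst_FV) (use y'[OF that] in auto)
  have 2: "subst2 v (num n) y (FV v) \<phi> = subst1 v (num n) \<phi>" if "\<phi> \<in> set \<Gamma> \<union> set \<Delta>" for \<phi>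
    by (rule subst_cong) (use y'[OF that] in auto)
  have e1: "map (subst2 v (FV v) y (num n)) \<Gamma> = \<Gamma>" "map (subst2 v (FV v) y (num n)) \<Delta> = \<Delta>"
    using 1 by (auto intro!: map_idI)
  have e2: "map (subst2 v (num n) y (FV v)) \<Gamma> = map (subst1 v (num n)) \<Gamma>"
      "map (subst2 v (num n) y (FV v)) \<Delta> = map (subst1 v (num n)) \<Delta>"
    using 2 by auto
  have "has_type [] (Eq (FV v) (num n)) (TForm TOmega)"
    using has_type_EqI[OF _ has_type_num, of "[]" "FV v"] has_type.intros(1)[of "[]" v] v by simp
  moreover have "rule_ok (EqL \<Gamma> \<Delta> v y (FV v) (num n))" using y(1) v by (simp add: rule_ok_def y_def)
  ultimately show ?thesis
    using provable_rule[of "EqL \<Gamma> \<Delta> v y (FV v) (num n)"] typed prem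
    unfolding concl.simps prems.simps e1 e2 by (simp add: typed_seq_iff)
qed

text \<open>On the left, \<open>N v\<close> unfolds to \<open>v = Z\<close> or a fixed point that runs through the candidates \<open>n\<close> for the
  predecessor of \<open>v\<close>. At \<open>n\<close> it passes through the formulas \<open>spine v N p n i\<close> with \<open>i = 0, 1, 2\<close>; then one
  premise, \<open>i = 3\<close>, determines \<open>v\<close>, and the other continues with \<open>n + 1\<close>. Here \<open>N\<close> stands for \<open>nat_pred\<close> or
  an annotated copy of it.\<close>

definition spine_or :: "var \<Rightarrow> 'a exp \<Rightarrow> 'a exp \<Rightarrow> 'a exp \<Rightarrow> 'a exp" where
  "spine_or v N e t = Or (And (Eq (FV v) (Succ t)) (App N t)) (App e (Succ t))"

definition spine_fix :: "var \<Rightarrow> 'a exp \<Rightarrow> 'a \<Rightarrow> 'a exp" where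
  "spine_fix v N p = Fix Mu p (TFun TNat TOmega) (Lam TNat (spine_or v N (BV 1) (BV 0)))"

definition spine :: "var \<Rightarrow> 'a exp \<Rightarrow> 'a \<Rightarrow> nat \<Rightarrow> nat \<Rightarrow> 'a exp" where
  "spine v N p n i =
    (if i = 0 then App (spine_fix v N p) (num n)
     else if i = 1 then App (Lam TNat (spine_or v N (spine_fix v N p) (BV 0))) (num n)
     else if i = 2 then spine_or v N (spine_fix v N p) (num n)
     else And (Eq (FV v) (num (Suc n))) (App N (num n)))"

lemma inst_num [simp]: "inst i u (num n) = num n"
  using inst_closed[OF has_type_num[of "[]"]] by simp

lemma annot_principal:
  "principal (OrL \<Gamma> \<phi> \<psi> \<Delta>) q \<Longrightarrow> annot (OrL \<Gamma> \<phi> \<psi> \<Delta>) j k q q' (Or c d) (if j = 0 then c else d)"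
  "principal (OrR \<Gamma> \<phi> \<psi> \<Delta>) q \<Longrightarrow> annot (OrR \<Gamma> \<phi> \<psi> \<Delta>) j k q q' (Or c d) (if snd q' = 0 then c else d)"
  "principal (AndL \<Gamma> \<phi> \<psi> \<Delta>) q \<Longrightarrow> annot (AndL \<Gamma> \<phi> \<psi> \<Delta>) j k q q' (And c d) (if snd q' = length \<Gamma> then c else d)"
  "principal (AndR \<Gamma> \<phi> \<psi> \<Delta>) q \<Longrightarrow> annot (AndR \<Gamma> \<phi> \<psi> \<Delta>) j k q q' (And c d) (if j = 0 then c else d)"
  unfolding annot_def rule.case by (simp_all only: simp_thms if_False) blast+

lemma annot_lam:
  "principal (LamL \<Gamma> A \<phi> \<psi> \<psi>s \<Delta>) q \<Longrightarrow>
    annot (LamL \<Gamma> A \<phi> \<psi> \<psi>s \<Delta>) j k q q' (apps (App (Lam A c) d) ds) (apps (inst 0 d c) ds)"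
  "principal (LamR \<Gamma> A \<phi> \<psi> \<psi>s \<Delta>) q \<Longrightarrow>
    annot (LamR \<Gamma> A \<phi> \<psi> \<psi>s \<Delta>) j k q q' (apps (App (Lam A c) d) ds) (apps (inst 0 d c) ds)"
  unfolding annot_def rule.case by (simp_all only: simp_thms if_False) blast+

lemma annot_fix:
  "principal (FixL \<Gamma> \<sigma> T \<phi> \<psi>s \<Delta>) q \<Longrightarrow> annot (FixL \<Gamma> \<sigma> T \<phi> \<psi>s \<Delta>) j k q q'
    (apps (Fix \<sigma> p T c) ds) (apps (inst 0 (Fix \<sigma> (p @ [k]) T c) c) ds)"
  "principal (FixR \<Gamma> \<sigma> T \<phi> \<psi>s \<Delta>) q \<Longrightarrow> annot (FixR \<Gamma> \<sigma> T \<phi> \<psi>s \<Delta>) j k q q'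
    (apps (Fix \<sigma> p T c) ds) (apps (inst 0 (Fix \<sigma> (p @ [k]) T c) c) ds)"
  unfolding annot_def rule.case by (simp_all only: simp_thms if_False) blast+

lemma spine_typed:
  assumes "snd v = TNat" "has_type [] N (TForm (TFun TNat TOmega))"
  shows "has_type [] (spine v N p n i) (TForm TOmega)"
proof -
  note App = has_type.intros(9)
  have N: "has_type \<Theta> N (TForm (TFun TNat TOmega))" for \<Theta> using has_type_weaken[OF assms(2), of \<Theta>] by simp
  have v: "has_type \<Theta> (FV v) TNat" for \<Theta> using has_type.intros(1)[of \<Theta> v] assms(1) by simp
  have bv: "i < length \<Theta> \<Longrightarrow> \<Theta> ! i = A \<Longrightarrow> has_type \<Theta> (BV i) A" for i \<Theta> A using has_type.intros(2) by blast
  have or: "has_type \<Theta> (spine_or v N e t) (TForm TOmega)"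
    if "has_type \<Theta> e (TForm (TFun TNat TOmega))" "has_type \<Theta> t TNat" for \<Theta> e t
    unfolding spine_or_def by (intro has_type.intros N v that App[OF N] App[OF that(1)])
  have fx: "has_type \<Theta> (spine_fix v N p) (TForm (TFun TNat TOmega))" for \<Theta>
    unfolding spine_fix_def by (intro has_type.intros(8,10) or bv) simp_all
  have lam: "has_type [] (Lam TNat (spine_or v N (spine_fix v N p) (BV 0))) (TForm (TFun TNat TOmega))"
    by (intro has_type.intros(8) or fx bv) simp_all
  show ?thesis
    unfolding spine_def
    using App[OF fx has_type_num] App[OF lam has_type_num] or[OF fx has_type_num]
      has_type.intros(7)[OF has_type_EqI[OF v has_type_num] App[OF N has_type_num]]
    by (auto simp del: num.simps)
qed

lemma spine_fix_unfold:
  assumes "has_type [] N B"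
  shows "inst 0 (spine_fix v N q) (Lam TNat (spine_or v N (BV 1) (BV 0))) = Lam TNat (spine_or v N (spine_fix v N q) (BV 0))"
    and "inst 0 t (spine_or v N (spine_fix v N q) (BV 0)) = spine_or v N (spine_fix v N q) t"
  using inst_closed[OF assms] by (simp_all add: spine_or_def spine_fix_def)

lemma map_exp_spine: "map_exp f (spine v N p n i) = spine v (map_exp f N) (f p) n i"
  by (simp add: spine_def spine_or_def spine_fix_def)

text \<open>Each candidate \<open>n\<close> costs three rules: unfold, reduce, split the
  disjunction. The left premise of the split fixes \<open>v\<close> and is provable by hypothesis,
  so the remaining branch keeps incrementing \<open>n\<close> and unfolds the same \<mu>-operator
  forever.\<close>

lemma provable_spine:
  fixes v :: var
  assumes v: "snd v = TNat" and typed: "typed_seq (\<Gamma>, \<Delta>)"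
    and prem: "\<And>n. provable (map (subst1 v (num n)) \<Gamma>, map (subst1 v (num n)) \<Delta>)"
  shows "provable (\<Gamma> @ [spine v nat_pred () 0 0], \<Delta>)"
proof -
  note N = nat_pred_type
  \<comment> \<open>The copies of \<open>nat_pred\<close> inside the spine are not unfolded along
    this trace and keep the empty annotation.\<close>
  define N' where "N' = eps nat_pred"
  have N': "has_type [] N' (TForm (TFun TNat TOmega))" using N by (simp add: N'_def)
  note ty = spine_typed[OF v N]
  have end_p: "provable (\<Gamma> @ [spine v nat_pred () n 3], \<Delta>)" for n
  proof -
    let ?e = "Eq (FV v) (num (Suc n)) :: fm" and ?a = "App nat_pred (num n)"
    have "has_type [] (And ?e ?a) (TForm TOmega)" using ty[of "()" n 3] by (simp add: spine_def)
    then have ty': "has_type [] ?e (TForm TOmega)" "has_type [] ?a (TForm TOmega)" by (auto elim!: has_type_And simp del: num.simps)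
    have "provable ((\<Gamma> @ [?e]) @ [?a], \<Delta>)"
      by (rule weakL[OF provable_eq_var[OF v typed prem]]) (use typed ty' in \<open>auto simp: typed_seq_iff simp del: num.simps\<close>)
    then show ?thesis
      using provable_rule[of "AndL \<Gamma> ?e ?a \<Delta>"] typed ty[of "()" n 3]
      by (simp add: rule_ok_def typed_seq_iff spine_def del: num.simps)
  qed
  define sq where "sq = (\<lambda>(n, i). (\<Gamma> @ [spine v nat_pred () n i], \<Delta>))"
  define rl where "rl = (\<lambda>(n, i). if i = 0 then FixL \<Gamma> Mu (TFun TNat TOmega) (Lam TNat (spine_or v nat_pred (BV 1) (BV 0))) [num n] \<Delta>
    else if i = Suc 0 then LamL \<Gamma> TNat (spine_or v nat_pred (spine_fix v nat_pred ()) (BV 0)) (num n) [] \<Delta>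
    else OrL \<Gamma> (And (Eq (FV v) (num (Suc n))) (App nat_pred (num n))) (App (spine_fix v nat_pred ()) (num (Suc n))) \<Delta>)"
  define nx :: "nat \<times> nat \<Rightarrow> (nat \<times> nat) list" where
    "nx = (\<lambda>(n, i). if i < 2 then [(n, Suc i)] else [(n, 3), (Suc n, 0)])"
  have "provable (sq (0, 0))"
  proof (rule provable_search[where I = "\<lambda>(n, i). i \<le> 3" and rl = rl and nx = nx])
    fix s :: "nat \<times> nat" assume "case s of (n, i) \<Rightarrow> i \<le> 3" "\<not> provable (sq s)"
    then obtain n i where s: "s = (n, i)" "i = 0 \<or> i = 1 \<or> i = 2"
      using end_p by (cases s) (auto simp: sq_def numeral_3_eq_3 le_Suc_eq)
    have "typed_seq (sq s)" using typed ty by (auto simp: typed_seq_iff sq_def s)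
    moreover have "concl (rl s) = sq s" "map sq (nx s) = prems (rl s)"
      using s(2) spine_fix_unfold[where v = v and q = "()", OF N, unfolded spine_fix_def]
      by (auto simp: s(1) rl_def sq_def nx_def spine_def spine_fix_def spine_or_def)
    ultimately show "rule_ok (rl s) \<and> typed_seq (sq s) \<and> concl (rl s) = sq s \<and> map sq (nx s) = prems (rl s) \<and>
        (\<forall>s'\<in>set (nx s). case s' of (n, i) \<Rightarrow> i \<le> 3)"
      using s(2) by (auto simp: s(1) rl_def rule_ok_def nx_def)
  next
    fix b :: "nat \<Rightarrow> deriv" and st :: "nat \<Rightarrow> nat \<times> nat" and j
    assume st0: "st 0 = (0, 0)"
      and st: "\<And>i. (case st i of (n, i) \<Rightarrow> i \<le> 3) \<and> \<not> provable (sq (st i)) \<and> root (b i) = rl (st i) \<and>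
        j i < length (nx (st i)) \<and> st (Suc i) = nx (st i) ! j i"
    \<comment> \<open>Position 3 is provable by \<open>end_p\<close>, so the branch passes through
      0, 1, 2 for each candidate, and the time \<open>i\<close> determines the state.\<close>
    have st_div: "st i = (i div 3, i mod 3)" for i
    proof (induction i)
      case (Suc i)
      show ?case
      proof (cases "i mod 3 = 2")
        case True
        have "st (Suc i) \<noteq> (i div 3, 3)" using st[of "Suc i"] end_p by (auto simp: sq_def)
        then have "st (Suc i) = (Suc (i div 3), 0)" using st[of i] Suc True by (auto simp: nx_def less_Suc_eq)
        then show ?thesis using True by (simp add: div_Suc mod_Suc)
      next
        case False
        then have "i mod 3 < 2" by (metis One_nat_def Suc_1 less_2_cases_iff less_Suc_eq mod_less_divisor numeral_3_eq_3 zero_less_Suc)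
        then show ?thesis using st[of i] Suc by (simp add: nx_def div_Suc mod_Suc)
      qed
    qed (simp add: st0)
    have rt: "root (b i) = rl (i div 3, i mod 3)" for i using st st_div by metis
    have ji: "i mod 3 = 2 \<Longrightarrow> j i = 1" and ji': "i mod 3 \<noteq> 2 \<Longrightarrow> j i = 0" for i
      using st[of i] st[of "Suc i"] unfolding st_div by (auto simp: nx_def less_Suc_eq mod_Suc split: if_splits)
    have m3: "i mod 3 = 0 \<or> i mod 3 = 1 \<or> i mod 3 = 2" for i :: nat by presburger
    \<comment> \<open>Unfoldings take place at times 0, 3, 6 and so on; \<open>k i\<close> counts
      those before time \<open>i\<close> and also serves as the next fresh number.\<close>
    define k :: "nat \<Rightarrow> nat" where "k = (\<lambda>i. (i + 2) div 3)"
    define a where "a = (\<lambda>i. spine v N' [0..<k i] (i div 3) (i mod 3))"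
    define \<tau> :: "nat \<Rightarrow> occ" where "\<tau> = (\<lambda>i. (Lhs, length \<Gamma>))"
    have con: "concl (root (b i)) = (\<Gamma> @ [spine v nat_pred () (i div 3) (i mod 3)], \<Delta>)" for i
      using m3[of i] by (auto simp: rt rl_def spine_def spine_fix_def spine_or_def)
    have pr: "principal (root (b i)) (\<tau> i)" "logical (root (b i))" for i
    proof -
      have "ctx_len (root (b i)) Lhs = length \<Gamma>" by (simp add: rt rl_def)
      then show "principal (root (b i)) (\<tau> i)" by (simp add: principal_def ctx_occ_def con \<tau>_def)
      show "logical (root (b i))" by (simp add: rt rl_def)
    qed
    have rel: "relevant (root (b i)) (j i) (\<tau> i) (\<tau> (Suc i))" for i
      using m3[of i] ji[of i] ji'[of i]
      by (auto simp: rt rl_def \<tau>_def intro: relevant.intros)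
    have "trace b j \<tau>"
      unfolding trace_def using pr rel by (auto simp: con \<tau>_def)
    moreover have "annotation b j \<tau> a"
      unfolding annotation_def
    proof (intro conjI allI exI[of _ k])
      show "a 0 = eps (fm_at (concl (root (b 0))) (\<tau> 0))"
        by (simp add: con \<tau>_def a_def k_def map_exp_spine N'_def)
      show "erase (a i) = fm_at (concl (root (b i))) (\<tau> i)" for i
        by (simp add: con \<tau>_def a_def map_exp_spine N'_def exp.map_comp comp_def)
      show "m \<le> i \<longrightarrow> (\<forall>p\<in>set_exp (a m). k i \<notin> set p)" for i m
      proof (intro impI ballI)
        fix p assume m: "m \<le> i" "p \<in> set_exp (a m)"
        have "p = [] \<or> p = [0..<k m]"
          using m(2) by (auto simp: a_def spine_def spine_fix_def spine_or_def N'_def exp.set_map split: if_splits)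
        moreover have "k m \<le> k i" using m(1) by (simp add: k_def div_le_mono)
        ultimately show "k i \<notin> set p" by auto
      qed
      show "annot (root (b i)) (j i) (k i) (\<tau> i) (\<tau> (Suc i)) (a i) (a (Suc i))" for i
      proof -
        have "i mod 3 = 0 \<Longrightarrow> Suc i div 3 = i div 3 \<and> Suc i mod 3 = 1 \<and> k (Suc i) = Suc (k i)"
            "i mod 3 = 1 \<Longrightarrow> Suc i div 3 = i div 3 \<and> Suc i mod 3 = 2 \<and> k (Suc i) = k i"
            "i mod 3 = 2 \<Longrightarrow> Suc i div 3 = Suc (i div 3) \<and> Suc i mod 3 = 0 \<and> k (Suc i) = k i"
          by (simp_all add: k_def div_Suc mod_Suc)
        then consider "i mod 3 = 0" "Suc i div 3 = i div 3" "Suc i mod 3 = 1" "k (Suc i) = Suc (k i)"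
          | "i mod 3 = 1" "Suc i div 3 = i div 3" "Suc i mod 3 = 2" "k (Suc i) = k i"
          | "i mod 3 = 2" "Suc i div 3 = Suc (i div 3)" "Suc i mod 3 = 0" "k (Suc i) = k i"
          using m3[of i] by metis
        then show ?thesis
        proof cases
          case 1
          have "a i = apps (Fix Mu [0..<k i] (TFun TNat TOmega) (Lam TNat (spine_or v N' (BV 1) (BV 0)))) [num (i div 3)]"
            using 1 by (simp add: a_def spine_def spine_fix_def)
          moreover have "a (Suc i) = apps (inst 0 (Fix Mu ([0..<k i] @ [k i]) (TFun TNat TOmega)
              (Lam TNat (spine_or v N' (BV 1) (BV 0)))) (Lam TNat (spine_or v N' (BV 1) (BV 0)))) [num (i div 3)]"
            using 1 spine_fix_unfold(1)[where v = v and q = "[0..<Suc (k i)]", OF N'] unfolding spine_fix_def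
            by (simp add: a_def spine_def spine_fix_def)
          moreover have "root (b i) = FixL \<Gamma> Mu (TFun TNat TOmega) (Lam TNat (spine_or v nat_pred (BV 1) (BV 0))) [num (i div 3)] \<Delta>"
            using 1 by (simp add: rt rl_def)
          ultimately show ?thesis using pr(1)[of i] by (simp only: annot_fix)
        next
          case 2
          have "a i = apps (App (Lam TNat (spine_or v N' (spine_fix v N' [0..<k i]) (BV 0))) (num (i div 3))) []"
            using 2 by (simp add: a_def spine_def)
          moreover have "a (Suc i) = apps (inst 0 (num (i div 3)) (spine_or v N' (spine_fix v N' [0..<k i]) (BV 0))) []"
            using 2 spine_fix_unfold(2)[OF N'] by (simp add: a_def spine_def)
          moreover have "root (b i) = LamL \<Gamma> TNat (spine_or v nat_pred (spine_fix v nat_pred ()) (BV 0)) (num (i div 3)) [] \<Delta>"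
            using 2 by (simp add: rt rl_def)
          ultimately show ?thesis using pr(1)[of i] by (simp only: annot_lam)
        next
          case 3
          let ?c = "And (Eq (FV v) (Succ (num (i div 3)))) (App N' (num (i div 3)))"
          have "a i = Or ?c (a (Suc i))"
            using 3 by (simp add: a_def spine_def spine_or_def)
          moreover have "root (b i) = OrL \<Gamma> (And (Eq (FV v) (num (Suc (i div 3)))) (App nat_pred (num (i div 3))))
              (App (spine_fix v nat_pred ()) (num (Suc (i div 3)))) \<Delta>"
            using 3 by (simp add: rt rl_def)
          ultimately show ?thesis
            using annot_principal(1)[of \<Gamma> _ _ \<Delta> "\<tau> i" "j i" "k i" "\<tau> (Suc i)" ?c "a (Suc i)"] pr(1)[of i] ji[OF 3(1)]
            by (simp only: one_neq_zero if_False)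
        qed
      qed
    qed
    \<comment> \<open>The witness is the identity: after \<open>n\<close> rounds of three steps the
      annotation is \<open>[0..<n]\<close>.\<close>
    moreover have "\<forall>n. \<exists>i. map (\<lambda>i. i) [0..<n] \<in> anns Mu (a i)"
    proof
      fix n
      have "map (\<lambda>i. i) [0..<n] \<in> anns Mu (a (3 * n))"
        using div_mult_self2[of 3 2 n] by (simp add: a_def k_def spine_def spine_fix_def div_Suc mod_Suc)
      then show "\<exists>i. map (\<lambda>i. i) [0..<n] \<in> anns Mu (a i)" by (rule exI)
    qed
    ultimately have "fix_trace Mu (\<lambda>i. b (0 + i)) (\<lambda>i. j (0 + i)) \<tau>"
      unfolding fix_trace_def add_0 by (intro conjI exI[of _ a] exI[of _ "\<lambda>i. i"])
    moreover have "fst (\<tau> 0) = Lhs" by (simp add: \<tau>_def)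
    ultimately show "good b j" unfolding good_def by blast
  qed simp
  then show ?thesis by (simp add: sq_def)
qed

text \<open>(Nat) is applied to \<open>v\<close> itself. One unfolding of \<open>N v\<close> leaves
  \<open>v = Z\<close>, settled by the instance for 0, or the first formula of the spine.\<close>

lemma omega_rule:
  fixes v :: var
  assumes v: "snd v = TNat" and typed: "typed_seq (\<Gamma>, \<Delta>)"
    and prem: "\<And>n. provable (map (subst1 v (num n)) \<Gamma>, map (subst1 v (num n)) \<Delta>)"
  shows "provable (\<Gamma>, \<Delta>)"
proof -
  obtain i where i: "v = (i, TNat)" using v by (cases v) auto
  \<comment> \<open>\<open>c\<close> is the body of \<open>nat_pred\<close>, with index 3 for the
    recursive variable; \<open>d\<close> is the same body after unfolding.\<close>
  define c where "c = Or (Eq (BV 0) Zero) (ex_nat (And (Eq (BV 2) (Succ (BV 0))) (App (BV 3) (BV 0))))"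
  have N: "nat_pred = Fix Mu () (TFun TNat TOmega) (Lam TNat c)" by (simp add: nat_pred_def c_def)
  define d where "d = Or (Eq (BV 0) Zero) (ex_nat (And (Eq (BV 2) (Succ (BV 0))) (App nat_pred (BV 0))))"
  have cd: "inst 0 nat_pred (Lam TNat c) = Lam TNat d"
    by (simp add: c_def d_def ex_nat_def numeral_2_eq_2 numeral_3_eq_3)
  have d: "inst 0 (FV v) d = Or (Eq (FV v) Zero) (spine v nat_pred () 0 0)"
    using inst_closed[OF nat_pred_type]
    by (simp add: d_def ex_nat_def spine_def spine_fix_def spine_or_def numeral_2_eq_2)
  have t: "has_type [] (FV v) TNat" using has_type.intros(1)[of "[]" v] v by simp
  have t1: "has_type [] (App nat_pred (FV v)) (TForm TOmega)" by (rule has_type.intros(9)[OF nat_pred_type t])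
  have "has_type [TForm (TFun TNat TOmega)] (Lam TNat c) (TForm (TFun TNat TOmega))"
    using nat_pred_type unfolding N by (rule has_type_Fix) simp
  then have "has_type [] (Lam TNat d) (TForm (TFun TNat TOmega))"
    using has_type_inst0[OF _ nat_pred_type] cd by metis
  then have t2: "has_type [] (App (Lam TNat d) (FV v)) (TForm TOmega)" using t by (rule has_type.intros(9))
  have t3: "has_type [] (Or (Eq (FV v) Zero) (spine v nat_pred () 0 0)) (TForm TOmega)"
    by (intro has_type.intros t has_type_EqI spine_typed v nat_pred_type)
  have "provable (\<Gamma> @ [Eq (FV v) Zero], \<Delta>)" using provable_eq_var[OF v typed prem, of 0] by simp
  then have "provable (\<Gamma> @ [inst 0 (FV v) d], \<Delta>)"
    using provable_rule[of "OrL \<Gamma> (Eq (FV v) Zero) (spine v nat_pred () 0 0) \<Delta>"] provable_spine[OF assms] typed t3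
    by (auto simp: d rule_ok_def typed_seq_iff)
  then have "provable (\<Gamma> @ [App (Lam TNat d) (FV v)], \<Delta>)"
    using provable_rule[of "LamL \<Gamma> TNat d (FV v) [] \<Delta>"] typed t2 by (auto simp: rule_ok_def typed_seq_iff)
  then have "provable (\<Gamma> @ [App nat_pred (FV v)], \<Delta>)"
    using provable_rule[of "FixL \<Gamma> Mu (TFun TNat TOmega) (Lam TNat c) [FV v] \<Delta>"] typed t1 cd
    by (auto simp: rule_ok_def typed_seq_iff N)
  then show ?thesis
    using provable_rule[of "NatIntro \<Gamma> i \<Delta>"] typed by (auto simp: rule_ok_def i)
qed


section \<open>One step of the search\<close>

lemma fvs_apps [simp]: "fvs (apps h ds) = fvs h \<union> (\<Union>d\<in>set ds. fvs d)"
  by (induction ds arbitrary: h) auto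

lemma set_exp_apps [simp]: "set_exp (apps h ds) = set_exp h \<union> (\<Union>d\<in>set ds. set_exp d)"
  by (induction ds arbitrary: h) auto

lemma anns_apps [simp]: "anns \<sigma> (apps h ds) = anns \<sigma> h \<union> (\<Union>d\<in>set ds. anns \<sigma> d)"
  by (induction ds arbitrary: h) auto

lemma map_exp_apps [simp]: "map_exp f (apps h ds) = apps (map_exp f h) (map (map_exp f) ds)"
  by (induction ds arbitrary: h) auto

lemma map_exp_inst: "map_exp f (inst n u e) = inst n (map_exp f u) (map_exp f e)"
  by (induction e arbitrary: n) auto

lemma set_exp_inst: "set_exp (inst n u e) \<subseteq> set_exp e \<union> set_exp u"
  by (induction e arbitrary: n) auto

lemma anns_inst: "anns \<sigma> (inst n u e) \<subseteq> anns \<sigma> e \<union> anns \<sigma> u"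
  by (induction e arbitrary: n) auto

lemma anns_subset: "anns \<sigma> e \<subseteq> set_exp e"
  by (induction e) auto

lemma has_type_apps:
  "has_type \<Theta> (apps h ds) A \<Longrightarrow> \<exists>B. has_type \<Theta> h B \<and> (\<forall>h'. has_type \<Theta> h' B \<longrightarrow> has_type \<Theta> (apps h' ds) A)"
proof (induction ds arbitrary: h)
  case (Cons d ds)
  then obtain B where B: "has_type \<Theta> (App h d) B" "\<forall>h'. has_type \<Theta> h' B \<longrightarrow> has_type \<Theta> (apps h' ds) A"
    by fastforce
  from B(1) obtain C T where "B = TForm T" "has_type \<Theta> h (TForm (TFun C T))" "has_type \<Theta> d C"
    by (rule has_type_App)
  then show ?case using B(2) has_type.intros(9) by fastforce
qed auto

fun strip :: "'a exp \<Rightarrow> 'a exp \<times> 'a exp list" where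
  "strip (App f x) = (fst (strip f), snd (strip f) @ [x])"
| "strip e = (e, [])"

lemma apps_strip: "apps (fst (strip a)) (snd (strip a)) = a"
  by (induction a rule: strip.induct) auto

lemma strip_apps [simp]: "strip (apps h ds) = (fst (strip h), snd (strip h) @ ds)"
  by (induction ds arbitrary: h) auto

text \<open>\<open>expand s k a\<close> lists, for each premise of the rule that decomposes \<open>a\<close> on side \<open>s\<close>, the formulas
  replacing \<open>a\<close>. The formula lists of the left side are kept in reverse order, so that on both sides
  the head is the principal position.\<close>

definition expand :: "side \<Rightarrow> nat \<Rightarrow> afm \<Rightarrow> afm list list" where
  "expand s k a = (case strip a of
     (Or c d, ds) \<Rightarrow> if s = Lhs then [[c], [d]] else [[c, d]]
   | (And c d, ds) \<Rightarrow> if s = Lhs then [[d, c]] else [[c], [d]]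
   | (Lam A c, d # ds) \<Rightarrow> [[apps (inst 0 d c) ds]]
   | (Fix \<sigma> p T c, ds) \<Rightarrow> [[apps (inst 0 (Fix \<sigma> (p @ [k]) T c) c) ds]]
   | _ \<Rightarrow> [])"

text \<open>\<open>Axiom Zero\<close> is a default value for formulas that are not active.\<close>

definition rule_for :: "side \<Rightarrow> fm list \<Rightarrow> fm list \<Rightarrow> afm \<Rightarrow> rule" where
  "rule_for s \<Gamma> \<Delta> a = (case strip a of
     (Or c d, ds) \<Rightarrow> (if s = Lhs then OrL else OrR) \<Gamma> (erase c) (erase d) \<Delta>
   | (And c d, ds) \<Rightarrow> (if s = Lhs then AndL else AndR) \<Gamma> (erase c) (erase d) \<Delta>
   | (Lam A c, d # ds) \<Rightarrow> (if s = Lhs then LamL else LamR) \<Gamma> A (erase c) (erase d) (map erase ds) \<Delta>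
   | (Fix \<sigma> p T c, ds) \<Rightarrow> (if s = Lhs then FixL else FixR) \<Gamma> \<sigma> T (erase c) (map erase ds) \<Delta>
   | _ \<Rightarrow> Axiom Zero)"

text \<open>Side and number are immaterial here, as they never decide whether \<open>expand\<close>
  is empty. The inactive ones among the well-typed formulas are the equations and the atoms.\<close>

definition active :: "afm \<Rightarrow> bool" where
  "active a \<longleftrightarrow> expand Lhs 0 a \<noteq> []"

lemma expand_simps [simp]:
  "expand s k (Or c d) = (if s = Lhs then [[c], [d]] else [[c, d]])"
  "expand s k (And c d) = (if s = Lhs then [[d, c]] else [[c], [d]])"
  "expand s k (apps (App (Lam A c) d) ds) = [[apps (inst 0 d c) ds]]"
  "expand s k (apps (Fix \<sigma> p T c) ds) = [[apps (inst 0 (Fix \<sigma> (p @ [k]) T c) c) ds]]"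
  "expand s k (Eq t u) = []"
  "expand s k (apps (FV x) ds) = []"
  by (simp_all add: expand_def)

lemma rule_for_simps [simp]:
  "rule_for s \<Gamma> \<Delta> (Or c d) = (if s = Lhs then OrL else OrR) \<Gamma> (erase c) (erase d) \<Delta>"
  "rule_for s \<Gamma> \<Delta> (And c d) = (if s = Lhs then AndL else AndR) \<Gamma> (erase c) (erase d) \<Delta>"
  "rule_for s \<Gamma> \<Delta> (apps (App (Lam A c) d) ds) =
    (if s = Lhs then LamL else LamR) \<Gamma> A (erase c) (erase d) (map erase ds) \<Delta>"
  "rule_for s \<Gamma> \<Delta> (apps (Fix \<sigma> p T c) ds) = (if s = Lhs then FixL else FixR) \<Gamma> \<sigma> T (erase c) (map erase ds) \<Delta>"
  by (simp_all add: rule_for_def)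

lemma active_simps [simp]:
  "active (Or c d)" "active (And c d)" "active (apps (App (Lam A c) d) ds)" "active (apps (Fix \<sigma> p T c) ds)"
  "\<not> active (Eq t u)" "\<not> active (apps (FV x) ds)"
  by (simp_all only: active_def expand_simps) simp_all

text \<open>Typing forces a disjunction or conjunction at the head to stand without arguments;
  activity forces an abstraction to have one.\<close>

lemma active_cases:
  assumes "active a" "has_type [] a (TForm TOmega)"
  obtains c d where "a = Or c d" | c d where "a = And c d"
  | A c d ds where "a = apps (App (Lam A c) d) ds" | \<sigma> p T c ds where "a = apps (Fix \<sigma> p T c) ds"
proof -
  define h ds where "h = fst (strip a)" and "ds = snd (strip a)"
  have a: "a = apps h ds" using apps_strip[of a] by (simp add: h_def ds_def)
  have hd: "strip a = (h, ds)" by (simp add: h_def ds_def)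
  obtain B where B: "has_type [] h B" using has_type_apps assms(2) a by metis
  have no_args: "ds = []" if h: "h = Or c d \<or> h = And c d" for c d
  proof (cases ds)
    case (Cons e es)
    then have "has_type [] (apps (App h e) es) (TForm TOmega)" using assms(2) a by simp
    then obtain C where "has_type [] (App h e) C" using has_type_apps by blast
    then show ?thesis using h by (auto elim!: has_type_App elim: has_type_Or has_type_And)
  qed
  show thesis
  proof (cases h)
    case (Lam A c)
    then obtain d es where "ds = d # es" using assms(1) hd by (cases ds) (auto simp: active_def expand_def)
    then show thesis using that(3) a Lam by simp
  qed (use assms(1) hd a no_args that in \<open>auto simp: active_def expand_def\<close>)
qed

lemma expand_typed:
  assumes "has_type [] a (TForm TOmega)" "active a" "new \<in> set (expand s k a)" "c \<in> set new"
  shows "has_type [] c (TForm TOmega) \<and> fvs c \<subseteq> fvs a"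
  using assms(2,1)
proof (cases rule: active_cases)
  case (1 c1 d1)
  then show ?thesis using assms by (auto elim!: has_type_Or split: if_splits)
next
  case (2 c1 d1)
  then show ?thesis using assms by (auto elim!: has_type_And split: if_splits)
next
  case (3 A e d ds)
  then have c: "c = apps (inst 0 d e) ds" using assms(3,4) by auto
  obtain B where B: "has_type [] (App (Lam A e) d) B" "\<forall>h'. has_type [] h' B \<longrightarrow> has_type [] (apps h' ds) (TForm TOmega)"
    using has_type_apps assms(1) 3 by metis
  have "has_type [] (inst 0 d e) B"
    using B(1) by (auto elim!: has_type_App has_type_Lam intro: has_type_inst0)
  then show ?thesis using B(2) fvs_inst[of 0 d e] unfolding c 3 by auto
next
  case (4 \<sigma> p T e ds)
  then have c: "c = apps (inst 0 (Fix \<sigma> (p @ [k]) T e) e) ds" using assms(3,4) by auto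
  obtain B where B: "has_type [] (Fix \<sigma> p T e) B" "\<forall>h'. has_type [] h' B \<longrightarrow> has_type [] (apps h' ds) (TForm TOmega)"
    using has_type_apps assms(1) 4 by metis
  have "has_type [] (inst 0 (Fix \<sigma> (p @ [k]) T e) e) B"
    using B(1) by (auto elim!: has_type_Fix intro: has_type_inst0 has_type.intros(10))
  then show ?thesis using B(2) fvs_inst[of 0 "Fix \<sigma> (p @ [k]) T e" e] unfolding c 4 by auto
qed

lemma expand_set_exp:
  assumes "has_type [] a (TForm TOmega)" "active a" "new \<in> set (expand s k a)" "c \<in> set new" "q \<in> set_exp c"
  shows "q \<in> set_exp a \<or> (\<exists>p\<in>set_exp a. q = p @ [k])"
  using assms(2,1)
proof (cases rule: active_cases)
  case (1 c1 d1)
  then show ?thesis using assms by (auto split: if_splits)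
next
  case (2 c1 d1)
  then show ?thesis using assms by (auto split: if_splits)
next
  case (3 A e d ds)
  then show ?thesis using assms(3-5) set_exp_inst[of 0 d e] by auto
next
  case (4 \<sigma> p T e ds)
  then show ?thesis using assms(3-5) set_exp_inst[of 0 "Fix \<sigma> (p @ [k]) T e" e] by auto
qed

text \<open>Sharper than \<open>expand_set_exp\<close>: a new annotation can only come from the
  operator at the head, which lets a number be traced back to the unfolding that produced
  it.\<close>

lemma expand_anns:
  assumes "has_type [] a (TForm TOmega)" "active a" "new \<in> set (expand s k a)" "c \<in> set new" "q \<in> anns \<sigma> c"
  shows "q \<in> anns \<sigma> a \<or> (\<exists>p T e ds. a = apps (Fix \<sigma> p T e) ds \<and> q = p @ [k])"
  using assms(2,1)
proof (cases rule: active_cases)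
  case (1 c1 d1)
  then show ?thesis using assms by (auto split: if_splits)
next
  case (2 c1 d1)
  then show ?thesis using assms by (auto split: if_splits)
next
  case (3 A e d ds)
  then show ?thesis using assms(3-5) anns_inst[of \<sigma> 0 d e] by auto
next
  case (4 \<sigma>' p T e ds)
  then have "q \<in> anns \<sigma> (inst 0 (Fix \<sigma>' (p @ [k]) T e) e) \<or> (\<exists>d\<in>set ds. q \<in> anns \<sigma> d)"
    using assms(3-5) by auto
  then consider "q \<in> anns \<sigma> a" | "\<sigma>' = \<sigma>" "q = p @ [k]"
    using anns_inst[of \<sigma> 0 "Fix \<sigma>' (p @ [k]) T e" e] 4 by (auto split: if_splits)
  then show ?thesis using 4 by cases auto
qed

definition plug :: "side \<Rightarrow> fm list \<Rightarrow> fm list \<Rightarrow> afm list \<Rightarrow> sequent" where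
  "plug s \<Gamma> \<Delta> new = (if s = Lhs then (\<Gamma> @ rev (map erase new), \<Delta>) else (\<Gamma>, map erase new @ \<Delta>))"

lemma rule_for_basic:
  assumes "active a" "has_type [] a (TForm TOmega)"
  shows "rule_ok (rule_for s \<Gamma> \<Delta> a)" "logical (rule_for s \<Gamma> \<Delta> a)"
    "concl (rule_for s \<Gamma> \<Delta> a) = plug s \<Gamma> \<Delta> [a]"
    "prems (rule_for s \<Gamma> \<Delta> a) = map (plug s \<Gamma> \<Delta>) (expand s k a)"
    "ctx_len (rule_for s \<Gamma> \<Delta> a) = case_side (length \<Gamma>) (length \<Delta>)"
  using assms
  by (cases rule: active_cases; cases s; simp add: rule_ok_def plug_def map_exp_inst)+

definition head_pos :: "side \<Rightarrow> nat \<Rightarrow> nat" where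
  "head_pos s n = (if s = Lhs then n else 0)"

lemma rule_for_principal:
  assumes "active a" "has_type [] a (TForm TOmega)"
  shows "principal (rule_for s \<Gamma> \<Delta> a) (s, head_pos s (length \<Gamma>))"
  using rule_for_basic[OF assms, of s \<Gamma> \<Delta>]
  by (cases s) (auto simp: principal_def ctx_occ_def head_pos_def plug_def)

text \<open>The left lists are stored reversed, so the \<open>i\<close>-th new formula is counted
  from the end of the left side; on the right it sits at place \<open>i\<close>.\<close>

lemma rule_for_relevant:
  assumes "active a" "has_type [] a (TForm TOmega)" "j < length (expand s k a)" "i < length (expand s k a ! j)"
  shows "relevant (rule_for s \<Gamma> \<Delta> a) j (s, head_pos s (length \<Gamma>))
      (s, if s = Lhs then length \<Gamma> + (length (expand s k a ! j) - Suc i) else i)" (is ?R)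
    "annot (rule_for s \<Gamma> \<Delta> a) j k (s, head_pos s (length \<Gamma>))
      (s, if s = Lhs then length \<Gamma> + (length (expand s k a ! j) - Suc i) else i) a (expand s k a ! j ! i)" (is ?N)
proof -
  note pr = rule_for_principal[OF assms(1,2), of s \<Gamma> \<Delta>]
  have "?R \<and> ?N"
    using assms(1,2)
  proof (cases rule: active_cases)
    case (1 c d)
    show ?thesis
    proof (cases s)
      case Lhs
      then have "j < 2" "i = 0" using assms(3,4) 1 by (auto simp: less_Suc_eq)
      then show ?thesis using 1 Lhs pr annot_principal(1)[of \<Gamma> "erase c" "erase d" \<Delta> _ j k _ c d]
          relevant.orL[of j \<Gamma> "erase c" "erase d" \<Delta>]
        by (auto simp: head_pos_def less_2_cases_iff)
    next
      case Rhs
      then have "j = 0" "i < 2" using assms(3,4) 1 by auto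
      then show ?thesis using 1 Rhs pr annot_principal(2)[of \<Gamma> "erase c" "erase d" \<Delta> _ j k "(Rhs, i)" c d]
          relevant.orR[of i \<Gamma> "erase c" "erase d" \<Delta>]
        by (auto simp: head_pos_def less_2_cases_iff)
    qed
  next
    case (2 c d)
    show ?thesis
    proof (cases s)
      case Lhs
      then have "j = 0" "i < 2" using assms(3,4) 2 by auto
      then show ?thesis using 2 Lhs pr relevant.andL[of 0 \<Gamma> "erase c" "erase d" \<Delta>]
          relevant.andL[of 1 \<Gamma> "erase c" "erase d" \<Delta>]
          annot_principal(3)[of \<Gamma> "erase c" "erase d" \<Delta> _ j k "(Lhs, length \<Gamma>)" c d]
          annot_principal(3)[of \<Gamma> "erase c" "erase d" \<Delta> _ j k "(Lhs, Suc (length \<Gamma>))" c d]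
        by (auto simp: head_pos_def less_2_cases_iff)
    next
      case Rhs
      then have "j < 2" "i = 0" using assms(3,4) 2 by (auto simp: less_Suc_eq)
      then show ?thesis using 2 Rhs pr annot_principal(4)[of \<Gamma> "erase c" "erase d" \<Delta> _ j k _ c d]
          relevant.andR[of j \<Gamma> "erase c" "erase d" \<Delta>]
        by (auto simp: head_pos_def less_2_cases_iff)
    qed
  next
    case (3 A c d ds)
    then have "j = 0" "i = 0" using assms(3,4) by auto
    then show ?thesis using 3 pr annot_lam[of \<Gamma> A "erase c" "erase d" "map erase ds" \<Delta>]
      by (cases s) (auto simp: head_pos_def intro: relevant.intros)
  next
    case (4 \<sigma> p T c ds)
    then have "j = 0" "i = 0" using assms(3,4) by auto
    then show ?thesis using 4 pr annot_fix[of \<Gamma> \<sigma> T "erase c" "map erase ds" \<Delta>]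
      by (cases s) (auto simp: head_pos_def intro: relevant.intros)
  qed
  then show ?R ?N by blast+
qed

lemma annot_side:
  "\<not> principal r q \<Longrightarrow> (\<forall>\<Gamma> \<Delta> x \<phi>. r \<noteq> Subst \<Gamma> \<Delta> x \<phi>) \<Longrightarrow> (\<forall>\<Gamma> \<Delta> x y s t. r \<noteq> EqL \<Gamma> \<Delta> x y s t) \<Longrightarrow>
    annot r j k q q' a a"
  by (cases r) (simp_all add: annot_def)

text \<open>When the rule acts on the right, the context there moves: one place precedes it in the
  conclusion, and as many as there are new formulas in the premise. Left positions never
  move.\<close>

lemma rule_for_side:
  assumes "active a" "has_type [] a (TForm TOmega)" "j < length (expand s k a)"
  shows "i < length \<Gamma> \<Longrightarrow> relevant (rule_for s \<Gamma> \<Delta> a) j (Lhs, i) (Lhs, i)"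
    "i < length \<Gamma> \<Longrightarrow> annot (rule_for s \<Gamma> \<Delta> a) j k (Lhs, i) q' c c"
    "i < length \<Delta> \<Longrightarrow> relevant (rule_for s \<Gamma> \<Delta> a) j
      (Rhs, (if s = Lhs then 0 else 1) + i) (Rhs, (if s = Lhs then 0 else length (expand s k a ! j)) + i)"
    "i < length \<Delta> \<Longrightarrow> annot (rule_for s \<Gamma> \<Delta> a) j k (Rhs, (if s = Lhs then 0 else 1) + i) q' c c"
proof -
  note basic = rule_for_basic[OF assms(1,2), of s \<Gamma> \<Delta>]
  note pr = basic(4)[of k]
  have j: "j < length (prems (rule_for s \<Gamma> \<Delta> a))" using assms(3) pr by simp
  have cc: "ctx_occ (rule_for s \<Gamma> \<Delta> a) (plug s \<Gamma> \<Delta> new) q i =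
      (q, if q = Lhs then i else (if s = Lhs then 0 else length new) + i)" for new q i
    by (cases q) (auto simp: ctx_occ_def basic plug_def)
  have rel: "i < ctx_len (rule_for s \<Gamma> \<Delta> a) q \<Longrightarrow> relevant (rule_for s \<Gamma> \<Delta> a) j
      (q, if q = Lhs then i else (if s = Lhs then 0 else 1) + i)
      (q, if q = Lhs then i else (if s = Lhs then 0 else length (expand s k a ! j)) + i)" for q i
    using relevant.side[OF j, of i q] assms(3) unfolding pr basic(3) nth_map[OF assms(3)] cc by (cases q; cases s) simp_all
  have np: "i < ctx_len (rule_for s \<Gamma> \<Delta> a) q \<Longrightarrow> \<not> principal (rule_for s \<Gamma> \<Delta> a)
      (q, if q = Lhs then i else (if s = Lhs then 0 else 1) + i)" for q i
    unfolding principal_def basic(3) using cc[of "[a]" q i] by auto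
  have no: "rule_for s \<Gamma> \<Delta> a \<noteq> Subst \<Gamma>' \<Delta>' x \<phi>" "rule_for s \<Gamma> \<Delta> a \<noteq> EqL \<Gamma>' \<Delta>' x y t u" for \<Gamma>' \<Delta>' x y \<phi> t u
    using assms(1,2) by (cases rule: active_cases; auto)+
  show "i < length \<Gamma> \<Longrightarrow> relevant (rule_for s \<Gamma> \<Delta> a) j (Lhs, i) (Lhs, i)"
    using rel[of i Lhs] basic(5) by simp
  show "i < length \<Gamma> \<Longrightarrow> annot (rule_for s \<Gamma> \<Delta> a) j k (Lhs, i) q' c c"
    using np[of i Lhs] basic(5) no by (intro annot_side) auto
  show "i < length \<Delta> \<Longrightarrow> relevant (rule_for s \<Gamma> \<Delta> a) j
      (Rhs, (if s = Lhs then 0 else 1) + i) (Rhs, (if s = Lhs then 0 else length (expand s k a ! j)) + i)"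
    using rel[of i Rhs] basic(5) by simp
  show "i < length \<Delta> \<Longrightarrow> annot (rule_for s \<Gamma> \<Delta> a) j k (Rhs, (if s = Lhs then 0 else 1) + i) q' c c"
    using np[of i Rhs] basic(5) no by (intro annot_side) auto
qed


section \<open>States of the search\<close>

text \<open>An item consists of an annotated formula, the time at which the formula was created, and its
  index in the previous state. A state consists of the time, the target (the item that is being
  moved to the principal position, if any), and the items on each side. Among the active items
  one of the oldest is chosen as target, which makes the search fair.\<close>

type_synonym item = "afm \<times> nat \<times> nat"
type_synonym state = "nat \<times> (side \<times> nat) option \<times> (side \<Rightarrow> item list)"

abbreviation birth :: "item \<Rightarrow> nat" where "birth x \<equiv> fst (snd x)"
abbreviation org :: "item \<Rightarrow> nat" where "org x \<equiv> snd (snd x)"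
abbreviation tgt :: "state \<Rightarrow> (side \<times> nat) option" where "tgt st \<equiv> fst (snd st)"
abbreviation its :: "state \<Rightarrow> side \<Rightarrow> item list" where "its st \<equiv> snd (snd st)"

definition fms :: "item list \<Rightarrow> fm list" where
  "fms xs = map (\<lambda>x. erase (fst x)) xs"

definition sq :: "state \<Rightarrow> sequent" where
  "sq st = (rev (fms (its st Lhs)), fms (its st Rhs))"

definition occ_of :: "(side \<Rightarrow> item list) \<Rightarrow> side \<Rightarrow> nat \<Rightarrow> occ" where
  "occ_of X s i = (s, if s = Lhs then length (X s) - Suc i else i)"

text \<open>The origin becomes the item's own position; a later permutation moves it along, so it
  still names the position in the previous state.\<close>

definition keep :: "item list \<Rightarrow> item list" where
  "keep xs = map (\<lambda>i. (fst (xs ! i), birth (xs ! i), i)) [0..<length xs]"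

definition swap :: "nat \<Rightarrow> 'b list \<Rightarrow> 'b list" where
  "swap i xs = take i xs @ xs ! Suc i # xs ! i # drop (Suc (Suc i)) xs"

definition put :: "(side \<Rightarrow> item list) \<Rightarrow> side \<Rightarrow> item list \<Rightarrow> side \<Rightarrow> item list" where
  "put X s xs s' = (if s' = s then xs else keep (X s'))"

definition oldest :: "(side \<Rightarrow> item list) \<Rightarrow> side \<times> nat \<Rightarrow> bool" where
  "oldest X q \<longleftrightarrow> snd q < length (X (fst q)) \<and> active (fst (X (fst q) ! snd q)) \<and>
    (\<forall>s. \<forall>x\<in>set (X s). active (fst x) \<longrightarrow> birth (X (fst q) ! snd q) \<le> birth x)"

definition pick :: "(side \<Rightarrow> item list) \<Rightarrow> (side \<times> nat) option" where
  "pick X = (if \<exists>s. \<exists>x\<in>set (X s). active (fst x) then Some (SOME q. oldest X q) else None)"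

text \<open>New items are born at \<open>Suc n\<close>, later than all present ones, and descend
  from the expanded item, which sits at position 0.\<close>

definition new_items :: "nat \<Rightarrow> afm list \<Rightarrow> item list \<Rightarrow> item list" where
  "new_items n new xs = map (\<lambda>a. (a, Suc n, 0)) new @ tl (keep xs)"

text \<open>The choice of a target is a step of its own and repeats forever once nothing is active,
  so the search never stops by itself.\<close>

definition succs :: "state \<Rightarrow> state list" where
  "succs = (\<lambda>(n, t, X). case t of
     None \<Rightarrow> [(Suc n, pick X, \<lambda>s. keep (X s))]
   | Some (s, 0) \<Rightarrow> map (\<lambda>new. (Suc n, None, put X s (new_items n new (X s)))) (expand s n (fst (X s ! 0)))
   | Some (s, Suc i) \<Rightarrow> [(Suc n, Some (s, i), put X s (swap i (keep (X s))))])"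

text \<open>Choosing a target must not change the sequent, so it is realised by the substitution of
  a variable for itself.\<close>

definition rule_at :: "state \<Rightarrow> rule" where
  "rule_at = (\<lambda>(n, t, X). let \<Gamma> = rev (fms (X Lhs)); \<Delta> = fms (X Rhs) in case t of
     None \<Rightarrow> Subst \<Gamma> \<Delta> (0, TNat) (FV (0, TNat))
   | Some (s, 0) \<Rightarrow> (if s = Lhs then rule_for s (rev (fms (tl (X Lhs)))) \<Delta> (fst (X s ! 0))
       else rule_for s \<Gamma> (fms (tl (X Rhs))) (fst (X s ! 0)))
   | Some (s, Suc i) \<Rightarrow>
       (if s = Lhs then ExchL (rev (fms (drop (Suc (Suc i)) (X s)))) (erase (fst (X s ! Suc i)))
          (erase (fst (X s ! i))) (rev (fms (take i (X s)))) \<Delta>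
        else ExchR \<Gamma> (fms (take i (X s))) (erase (fst (X s ! i))) (erase (fst (X s ! Suc i)))
          (fms (drop (Suc (Suc i)) (X s)))))"

text \<open>All numbers in annotations are below the clock \<open>n\<close>, so \<open>n\<close> is
  fresh for an unfolding at this time. A target stays oldest until it is expanded.\<close>

definition state_inv :: "var set \<Rightarrow> state \<Rightarrow> bool" where
  "state_inv V = (\<lambda>(n, t, X). (\<forall>s. \<forall>x\<in>set (X s). has_type [] (fst x) (TForm TOmega) \<and> fvs (fst x) \<subseteq> V \<and>
      birth x \<le> n \<and> (\<forall>p\<in>set_exp (fst x). \<forall>k\<in>set p. k < n)) \<and> (\<forall>q. t = Some q \<longrightarrow> oldest X q))"

lemma length_keep [simp]: "length (keep xs) = length xs"
  by (simp add: keep_def)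

lemma nth_keep [simp]: "i < length xs \<Longrightarrow> keep xs ! i = (fst (xs ! i), birth (xs ! i), i)"
  by (simp add: keep_def)

lemma fms_keep [simp]: "fms (keep xs) = fms xs"
  by (rule nth_equalityI) (auto simp: fms_def)

lemma fms_simps [simp]: "length (fms xs) = length xs" "fms (xs @ ys) = fms xs @ fms ys"
    "fms (x # xs) = erase (fst x) # fms xs" "fms [] = []"
  by (simp_all add: fms_def)

lemma fms_tl: "fms (tl xs) = tl (fms xs)" and fms_take: "fms (take i xs) = take i (fms xs)"
    and fms_drop: "fms (drop i xs) = drop i (fms xs)"
  by (simp_all add: fms_def map_tl take_map drop_map)

lemma fms_nth: "i < length xs \<Longrightarrow> fms xs ! i = erase (fst (xs ! i))"
  by (simp add: fms_def)

lemma swap_self: "Suc i < length xs \<Longrightarrow> take i xs @ xs ! i # xs ! Suc i # drop (Suc (Suc i)) xs = xs"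
  by (simp add: Cons_nth_drop_Suc)

lemma length_swap [simp]: "Suc i < length xs \<Longrightarrow> length (swap i xs) = length xs"
  by (simp add: swap_def)

lemma nth_swap: "Suc i < length xs \<Longrightarrow> l < length xs \<Longrightarrow> swap i xs ! l = xs ! swap_at i l"
proof -
  assume a: "Suc i < length xs" "l < length xs"
  consider "l < i" | "l = i" | "l = Suc i" | m where "l = Suc (Suc i) + m"
    by (metis le_add_diff_inverse nat_less_le not_less not_less_eq)
  then show ?thesis
    using a by cases (simp_all add: swap_def swap_at_def nth_append)
qed

lemma swap_at_less: "Suc i < n \<Longrightarrow> l < n \<Longrightarrow> swap_at i l < n"
  by (auto simp: swap_at_def)

lemma swap_at_invol [simp]: "swap_at i (swap_at i l) = l"
  by (auto simp: swap_at_def)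

lemma pick_oldest: "pick X = Some q \<Longrightarrow> oldest X q"
proof -
  assume c: "pick X = Some q"
  let ?A = "\<lambda>q. snd q < length (X (fst q)) \<and> active (fst (X (fst q) ! snd q))"
  from c obtain s x where "x \<in> set (X s)" "active (fst x)" by (auto simp: pick_def split: if_splits)
  then obtain i where "?A (s, i)" by (auto simp: in_set_conv_nth)
  then obtain q0 where q0: "?A q0" "\<And>q. ?A q \<Longrightarrow> birth (X (fst q0) ! snd q0) \<le> birth (X (fst q) ! snd q)"
    using ex_has_least_nat[of ?A "(s, i)" "\<lambda>q. birth (X (fst q) ! snd q)"] by blast
  have "oldest X q0"
    unfolding oldest_def using q0(1)
  proof (intro conjI allI ballI impI)
    fix s x assume "x \<in> set (X s)" "active (fst x)"
    then obtain i where "i < length (X s)" "x = X s ! i" by (auto simp: in_set_conv_nth)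
    then show "birth (X (fst q0) ! snd q0) \<le> birth x" using q0(2)[of "(s, i)"] \<open>active (fst x)\<close> by simp
  qed blast+
  then have "oldest X (SOME q. oldest X q)" by (rule someI)
  then show ?thesis using c by (simp add: pick_def split: if_splits)
qed

lemma step_cases:
  assumes "st' \<in> set (succs (n, t, X))"
  obtains (Pick) "t = None" "st' = (Suc n, pick X, \<lambda>s. keep (X s))"
  | (Move) s i where "t = Some (s, Suc i)" "st' = (Suc n, Some (s, i), put X s (swap i (keep (X s))))"
  | (Expand) s new where "t = Some (s, 0)" "new \<in> set (expand s n (fst (X s ! 0)))"
      "st' = (Suc n, None, put X s (new_items n new (X s)))"
proof (cases t)
  case None
  then show thesis using assms that(1) by (simp add: succs_def)
next
  case (Some q)
  then obtain s i where "t = Some (s, i)" by (cases q) auto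
  then show thesis using assms that(2,3) by (cases i) (auto simp: succs_def)
qed

lemma inv_oldest: "state_inv V (n, Some q, X) \<Longrightarrow> oldest X q"
  by (cases q) (simp add: state_inv_def)

lemma inv_item: "state_inv V (n, t, X) \<Longrightarrow> x \<in> set (X s) \<Longrightarrow> has_type [] (fst x) (TForm TOmega) \<and> fvs (fst x) \<subseteq> V \<and>
      birth x \<le> n \<and> (\<forall>p\<in>set_exp (fst x). \<forall>k\<in>set p. k < n)"
  by (simp add: state_inv_def)

lemma nth_new_items:
  "l < length (new_items n new xs) \<Longrightarrow> new_items n new xs ! l =
    (if l < length new then (new ! l, Suc n, 0)
     else (fst (xs ! (Suc l - length new)), birth (xs ! (Suc l - length new)), Suc l - length new))"
  by (auto simp: new_items_def nth_append nth_tl Suc_diff_le)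

lemma length_new_items [simp]: "length (new_items n new xs) = length new + (length xs - 1)"
  by (simp add: new_items_def)

text \<open>The basic fact about ancestry, on which the invariant and the provenance of annotations
  rest: an item that does not copy its origin is a product of the expanded head.\<close>

lemma step_origin:
  assumes inv: "state_inv V (n, t, X)" and j: "j < length (succs (n, t, X))" and st': "succs (n, t, X) ! j = (n', t', X')"
    and l: "l < length (X' s)"
  defines "x \<equiv> X' s ! l"
  shows "n' = Suc n" "org x < length (X s)"
    "fst x = fst (X s ! org x) \<and> birth x = birth (X s ! org x) \<or>
      t = Some (s, 0) \<and> org x = 0 \<and> j < length (expand s n (fst (X s ! 0))) \<and>
      fst x \<in> set (expand s n (fst (X s ! 0)) ! j) \<and> birth x = Suc n"
proof -
  have "(n', t', X') \<in> set (succs (n, t, X))" using j st' nth_mem by metis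
  then have "n' = Suc n \<and> org x < length (X s) \<and> (fst x = fst (X s ! org x) \<and> birth x = birth (X s ! org x) \<or>
      t = Some (s, 0) \<and> org x = 0 \<and> j < length (expand s n (fst (X s ! 0))) \<and>
      fst x \<in> set (expand s n (fst (X s ! 0)) ! j) \<and> birth x = Suc n)"
  proof (cases rule: step_cases)
    case Pick
    then show ?thesis using l by (simp add: x_def)
  next
    case (Move s' i)
    have len: "Suc i < length (X s')" using inv_oldest[of V n "(s', Suc i)" X] inv Move(1) by (simp add: oldest_def)
    show ?thesis
    proof (cases "s = s'")
      case True
      then have "l < length (X s')" using l Move len by (simp add: put_def)
      then show ?thesis using True Move len swap_at_less[OF len, of l]
        by (simp add: x_def put_def nth_swap)
    next
      case False
      then show ?thesis using l Move by (simp add: x_def put_def)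
    qed
  next
    case (Expand s' new)
    have len: "0 < length (X s')" using inv_oldest[of V n "(s', 0)" X] inv Expand(1) by (simp add: oldest_def)
    have j': "j < length (expand s' n (fst (X s' ! 0)))" using j Expand(1) by (simp add: succs_def)
    then have X': "X' = put X s' (new_items n (expand s' n (fst (X s' ! 0)) ! j) (X s'))"
      using st' Expand(1) by (simp add: succs_def)
    show ?thesis
    proof (cases "s = s'")
      case True
      then show ?thesis using Expand len l j' unfolding x_def X' put_def
        by (auto simp: nth_new_items)
    next
      case False
      then show ?thesis using l Expand unfolding x_def X' by (simp add: put_def)
    qed
  qed
  then show "n' = Suc n" "org x < length (X s)"
    "fst x = fst (X s ! org x) \<and> birth x = birth (X s ! org x) \<or>
      t = Some (s, 0) \<and> org x = 0 \<and> j < length (expand s n (fst (X s ! 0))) \<and>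
      fst x \<in> set (expand s n (fst (X s ! 0)) ! j) \<and> birth x = Suc n"
    by blast+
qed

text \<open>Choosing and moving create no items, so minimality of the birth time is
  inherited.\<close>

lemma oldest_transfer:
  assumes "oldest X q" "snd q' < length (X' (fst q'))"
    and "fst (X' (fst q') ! snd q') = fst (X (fst q) ! snd q)" "birth (X' (fst q') ! snd q') = birth (X (fst q) ! snd q)"
    and "\<And>s l. l < length (X' s) \<Longrightarrow> \<exists>x\<in>set (X s). fst (X' s ! l) = fst x \<and> birth (X' s ! l) = birth x"
  shows "oldest X' q'"
  unfolding oldest_def
proof (intro conjI allI ballI impI)
  show "active (fst (X' (fst q') ! snd q'))" using assms(1,3) by (simp add: oldest_def)
  fix s x assume "x \<in> set (X' s)" "active (fst x)"
  then show "birth (X' (fst q') ! snd q') \<le> birth x"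
    using assms(1,4) assms(5)[of _ s] unfolding oldest_def by (metis in_set_conv_nth)
qed (rule assms(2))

lemma inv_step:
  assumes inv: "state_inv V (n, t, X)" and st': "st' \<in> set (succs (n, t, X))"
  shows "state_inv V st'"
proof -
  obtain n' t' X' where e: "st' = (n', t', X')" by (cases st') auto
  from st' obtain j where j: "j < length (succs (n, t, X))" "succs (n, t, X) ! j = (n', t', X')"
    by (auto simp: in_set_conv_nth e)
  note origin = step_origin[OF inv j]
  have n': "n' = Suc n" using st' e by (cases rule: step_cases) auto
  have items: "has_type [] (fst x) (TForm TOmega) \<and> fvs (fst x) \<subseteq> V \<and>
      birth x \<le> n' \<and> (\<forall>p\<in>set_exp (fst x). \<forall>k\<in>set p. k < n')" if "x \<in> set (X' s)" for s x
  proof -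
    from that obtain l where l: "l < length (X' s)" "x = X' s ! l" by (auto simp: in_set_conv_nth)
    note o = origin(2,3)[OF l(1), folded l(2)]
    note old = inv_item[OF inv nth_mem[OF o(1)]]
    from o(2) show ?thesis
    proof
      assume "fst x = fst (X s ! org x) \<and> birth x = birth (X s ! org x)"
      then show ?thesis using old n' by (metis le_SucI less_SucI)
    next
      assume new: "t = Some (s, 0) \<and> org x = 0 \<and> j < length (expand s n (fst (X s ! 0))) \<and>
        fst x \<in> set (expand s n (fst (X s ! 0)) ! j) \<and> birth x = Suc n"
      then have act: "active (fst (X s ! 0))" using inv_oldest[of V n "(s, 0)" X] inv by (simp add: oldest_def)
      have ty: "has_type [] (fst (X s ! 0)) (TForm TOmega)" using old new by simp
      have mem: "expand s n (fst (X s ! 0)) ! j \<in> set (expand s n (fst (X s ! 0)))" using new by simp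
      have "has_type [] (fst x) (TForm TOmega) \<and> fvs (fst x) \<subseteq> V"
        using expand_typed[OF ty act mem] new old by (metis subset_trans)
      moreover have "k < n'" if p: "p \<in> set_exp (fst x)" "k \<in> set p" for p k
        using expand_set_exp[OF ty act mem _ p(1)] new old p(2) n' by (auto simp: less_Suc_eq)
      ultimately show ?thesis using new n' by simp
    qed
  qed
  have "oldest X' q'" if q': "t' = Some q'" for q'
    using st' unfolding e
  proof (cases rule: step_cases)
    case Pick
    then have "oldest X q'" using pick_oldest q' by simp
    then show ?thesis
      by (rule oldest_transfer) (use Pick \<open>oldest X q'\<close> in \<open>auto simp: oldest_def\<close>)
  next
    case (Move s i)
    then have old: "oldest X (s, Suc i)" using inv_oldest inv by simp
    then have len: "Suc i < length (X s)" by (simp add: oldest_def)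
    have eq: "q' = (s, i)" "X' = put X s (swap i (keep (X s)))" using Move q' by auto
    show ?thesis
    proof (rule oldest_transfer[OF old])
      fix s' l assume l: "l < length (X' s')"
      show "\<exists>x\<in>set (X s'). fst (X' s' ! l) = fst x \<and> birth (X' s' ! l) = birth x"
        using origin(2,3)[OF l] Move(1) nth_mem by auto
    qed (use len in \<open>simp_all add: eq put_def nth_swap swap_at_def\<close>)
  next
    case Expand
    then show ?thesis using q' by simp
  qed
  then show ?thesis using items by (simp add: e state_inv_def)
qed

lemma subst_FV_id [simp]: "subst FV e = e"
  by (rule subst_FV) simp

lemma step_rule:
  assumes inv: "state_inv V (n, t, X)"
  shows "rule_ok (rule_at (n, t, X))" "concl (rule_at (n, t, X)) = sq (n, t, X)"
    "map sq (succs (n, t, X)) = prems (rule_at (n, t, X))"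
    "t = Some (s, 0) \<Longrightarrow> logical (rule_at (n, t, X)) \<and> principal (rule_at (n, t, X)) (occ_of X s 0)"
proof -
  have "rule_ok (rule_at (n, t, X)) \<and> concl (rule_at (n, t, X)) = sq (n, t, X) \<and>
    map sq (succs (n, t, X)) = prems (rule_at (n, t, X)) \<and>
    (t = Some (s, 0) \<longrightarrow> logical (rule_at (n, t, X)) \<and> principal (rule_at (n, t, X)) (occ_of X s 0))"
  proof (cases t)
    case None
    then show ?thesis
      using has_type.intros(1)[where ?'a = unit, of "[]" "(0, TNat)"]
      by (simp add: rule_at_def rule_ok_def sq_def succs_def map_idI)
  next
    case (Some q)
    then obtain s' i where t: "t = Some (s', i)" by (cases q) auto
    then have old: "oldest X (s', i)" using inv_oldest inv by simp
    then have len: "i < length (X s')" and act: "active (fst (X s' ! i))" by (simp_all add: oldest_def)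
    have ty: "has_type [] (fst (X s' ! i)) (TForm TOmega)" using inv_item[OF inv nth_mem[OF len]] by simp
    show ?thesis
    proof (cases i)
      case (Suc i')
      then have len': "Suc i' < length (X s')" using len by simp
      have k1: "fms (swap i' (keep (X s'))) = fms (take i' (X s')) @ erase (fst (X s' ! Suc i')) #
          erase (fst (X s' ! i')) # fms (drop (Suc (Suc i')) (X s'))"
        using len' by (simp add: swap_def fms_take fms_drop)
      have k2: "fms (X s') = fms (take i' (X s')) @ erase (fst (X s' ! i')) #
          erase (fst (X s' ! Suc i')) # fms (drop (Suc (Suc i')) (X s'))"
        by (subst swap_self[OF len', symmetric]) (simp del: fms_keep)
      show ?thesis
        by (cases s') (use k1 k2 in \<open>simp_all add: t Suc rule_at_def rule_ok_def sq_def succs_def put_def\<close>)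
    next
      case 0
      have hd: "X s' = X s' ! 0 # tl (X s')" using len by (cases "X s'") auto
      have fm_hd: "fms (X s') = erase (fst (X s' ! 0)) # fms (tl (X s'))" by (subst hd) simp
      have nw: "fms (new_items n new (X s')) = map erase new @ fms (tl (X s'))" for new
        by (simp add: new_items_def fms_tl) (simp add: fms_def comp_def)
      note basic = rule_for_basic[OF act[unfolded 0] ty[unfolded 0]]
      note pr = rule_for_principal[OF act[unfolded 0] ty[unfolded 0]]
      show ?thesis
      proof (cases s')
        case Lhs
        let ?r = "rule_for Lhs (rev (fms (tl (X Lhs)))) (fms (X Rhs)) (fst (X Lhs ! 0))"
        have r: "rule_at (n, t, X) = ?r" using t 0 Lhs by (simp add: rule_at_def)
        have "map sq (succs (n, t, X)) = prems ?r"
          unfolding basic(4)[unfolded Lhs, of _ _ _ n, unfolded Lhs]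
          using t 0 Lhs basic(4)[of Lhs _ _ n] nw by (simp add: succs_def sq_def put_def plug_def)
        then show ?thesis
          using basic[of Lhs] pr[of Lhs "rev (fms (tl (X Lhs)))" "fms (X Rhs)"] Lhs fm_hd t len
          unfolding r by (auto simp: sq_def plug_def occ_of_def head_pos_def)
      next
        case Rhs
        let ?r = "rule_for Rhs (rev (fms (X Lhs))) (fms (tl (X Rhs))) (fst (X Rhs ! 0))"
        have r: "rule_at (n, t, X) = ?r" using t 0 Rhs by (simp add: rule_at_def)
        have "map sq (succs (n, t, X)) = prems ?r"
          using t 0 Rhs basic(4)[of Rhs _ _ n] nw by (simp add: succs_def sq_def put_def plug_def)
        then show ?thesis
          using basic[of Rhs] pr[of Rhs "rev (fms (X Lhs))" "fms (tl (X Rhs))"] Rhs fm_hd t len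
          unfolding r by (auto simp: sq_def plug_def occ_of_def head_pos_def)
      qed
    qed
  qed
  then show "rule_ok (rule_at (n, t, X))" "concl (rule_at (n, t, X)) = sq (n, t, X)"
    "map sq (succs (n, t, X)) = prems (rule_at (n, t, X))"
    "t = Some (s, 0) \<Longrightarrow> logical (rule_at (n, t, X)) \<and> principal (rule_at (n, t, X)) (occ_of X s 0)"
    by blast+
qed


text \<open>The left list is stored reversed, so exchanging \<open>i\<close> and
  \<open>i + 1\<close> there becomes exchanging \<open>n - i - 2\<close> and
  \<open>n - i - 1\<close> in the sequent.\<close>

lemma swap_at_rev:
  "Suc i < n \<Longrightarrow> l < n \<Longrightarrow> swap_at (n - Suc (Suc i)) (n - Suc (swap_at i l)) = n - Suc l"
  by (auto simp: swap_at_def)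

lemma annot_exch: "annot (ExchL \<Gamma> \<phi> \<psi> \<Gamma>' \<Delta>) j k q q' a a" "annot (ExchR \<Gamma> \<Delta> \<phi> \<psi> \<Delta>') j k q q' a a"
  by (simp_all add: annot_def)

text \<open>Following origins is following a trace: each step uses a relevant occurrence and a
  permitted change of annotation, with the clock \<open>n\<close> as the fresh number.\<close>

lemma step_linked:
  assumes inv: "state_inv V (n, t, X)" and j: "j < length (succs (n, t, X))" and st': "succs (n, t, X) ! j = (n', t', X')"
    and l: "l < length (X' s)"
  shows "relevant (rule_at (n, t, X)) j (occ_of X s (org (X' s ! l))) (occ_of X' s l)" (is ?R)
    and "annot (rule_at (n, t, X)) j n (occ_of X s (org (X' s ! l))) (occ_of X' s l)
      (fst (X s ! org (X' s ! l))) (fst (X' s ! l))" (is ?N)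
proof -
  have "?R \<and> ?N"
  proof (cases t)
    case None
    let ?x = "(0, TNat) :: var"
    let ?r = "Subst (rev (fms (X Lhs))) (fms (X Rhs)) ?x (FV ?x)"
    have r: "rule_at (n, t, X) = ?r" by (simp add: None rule_at_def)
    have j0: "j = 0" and X': "X' = (\<lambda>s. keep (X s))" using j st' by (auto simp: None succs_def)
    have l': "l < length (X s)" using l X' by simp
    let ?i = "if s = Lhs then length (X s) - Suc l else l"
    have c: "ctx_occ ?r (concl ?r) s ?i = occ_of X s l" "ctx_occ ?r (prems ?r ! 0) s ?i = occ_of X' s l" "?i < ctx_len ?r s"
      using l' by (cases s; simp add: ctx_occ_def occ_of_def X')+
    have "relevant ?r 0 (occ_of X s l) (occ_of X' s l)"
      using relevant.side[of 0 ?r ?i s] c by simp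
    moreover have "\<not> principal ?r (occ_of X s l)"
      unfolding principal_def using c(1,3) by (auto simp: occ_of_def)
    \<comment> \<open>The substitution is the identity, so each occurrence of the variable is
      replaced by the variable itself.\<close>
    then have "annot ?r 0 n (occ_of X s l) (occ_of X' s l) (fst (X s ! l)) (fst (X s ! l))"
      by (simp add: annot_def) (rule exI[of _ "\<lambda>_. FV ?x"], simp add: subst_occ_const)
    ultimately show ?thesis using l' by (simp add: r j0 X')
  next
    case (Some q)
    then obtain s' i where t: "t = Some (s', i)" by (cases q) auto
    then have old: "oldest X (s', i)" using inv_oldest inv by simp
    then have len: "i < length (X s')" and act: "active (fst (X s' ! i))" by (simp_all add: oldest_def)
    have ty: "has_type [] (fst (X s' ! i)) (TForm TOmega)" using inv_item[OF inv nth_mem[OF len]] by simp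
    show ?thesis
    proof (cases i)
      case (Suc i')
      then have len': "Suc i' < length (X s')" using len by simp
      have j0: "j = 0" and X': "X' = put X s' (swap i' (keep (X s')))" using j st' by (auto simp: t Suc succs_def)
      show ?thesis
      proof (cases "s = s'")
        case True
        then have l': "l < length (X s')" using l len' by (simp add: X' put_def)
        have x: "X' s ! l = (fst (X s ! swap_at i' l), birth (X s ! swap_at i' l), swap_at i' l)"
          using True l' len' swap_at_less[OF len' l'] by (simp add: X' put_def nth_swap)
        show ?thesis
        proof (cases s')
          case Lhs
          have "relevant (rule_at (n, t, X)) 0 (Lhs, length (X Lhs) - Suc (swap_at i' l))
              (Lhs, swap_at (length (X Lhs) - Suc (Suc i')) (length (X Lhs) - Suc (swap_at i' l)))"
            using relevant.exchL[of "length (X Lhs) - Suc (swap_at i' l)" "rev (fms (drop (Suc (Suc i')) (X Lhs)))"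
                "erase (fst (X Lhs ! Suc i'))" "erase (fst (X Lhs ! i'))" "rev (fms (take i' (X Lhs)))" "fms (X Rhs)"]
              len' l' Lhs by (simp add: t Suc rule_at_def)
          then show ?thesis
            using x True Lhs len' l' swap_at_rev[OF len' l'] annot_exch
            by (simp add: occ_of_def X' put_def j0) (simp add: t Suc rule_at_def annot_exch)
        next
          case Rhs
          have "relevant (rule_at (n, t, X)) 0 (Rhs, swap_at i' l) (Rhs, swap_at i' (swap_at i' l))"
            using relevant.exchR[of "swap_at i' l" "fms (take i' (X Rhs))" "erase (fst (X Rhs ! i'))"
                "erase (fst (X Rhs ! Suc i'))" "fms (drop (Suc (Suc i')) (X Rhs))" "rev (fms (X Lhs))"]
              len' swap_at_less[OF len' l'] Rhs by (simp add: t Suc rule_at_def)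
          then show ?thesis
            using x True Rhs by (simp add: occ_of_def j0) (simp add: t Suc rule_at_def annot_exch)
        qed
      next
        case False
        then have l': "l < length (X s)" and x: "X' s ! l = (fst (X s ! l), birth (X s ! l), l)"
          using l by (simp_all add: X' put_def)
        let ?r = "rule_at (n, t, X)"
        let ?i = "if s = Lhs then length (X s) - Suc l else l"
        have len_pr: "0 < length (prems ?r)" using False by (cases s'; simp add: t Suc rule_at_def)
        have c: "ctx_occ ?r (concl ?r) s ?i = occ_of X s l" "ctx_occ ?r (prems ?r ! 0) s ?i = occ_of X' s l"
            "?i < ctx_len ?r s"
          using l' False by (cases s; cases s'; simp add: ctx_occ_def occ_of_def X' put_def t Suc rule_at_def)+
        have "relevant ?r 0 (occ_of X s l) (occ_of X' s l)"
          using relevant.side[OF len_pr c(3)] c by simp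
        moreover have "annot ?r 0 n (occ_of X s l) (occ_of X' s l) (fst (X s ! l)) (fst (X s ! l))"
          by (simp add: t Suc rule_at_def annot_exch)
        ultimately show ?thesis using l' x by (simp add: j0)
      qed
    next
      case 0
      note act = act[unfolded 0] and ty = ty[unfolded 0]
      define a where "a = fst (X s' ! 0)"
      define new where "new = expand s' n a ! j"
      have j': "j < length (expand s' n a)" and X': "X' = put X s' (new_items n new (X s'))"
        using j st' by (auto simp: t 0 succs_def a_def new_def)
      define \<Gamma> where "\<Gamma> = rev (fms (if s' = Lhs then tl (X Lhs) else X Lhs))"
      define \<Delta> where "\<Delta> = fms (if s' = Lhs then X Rhs else tl (X Rhs))"
      have r: "rule_at (n, t, X) = rule_for s' \<Gamma> \<Delta> a"
        by (simp add: t 0 rule_at_def \<Gamma>_def \<Delta>_def a_def)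
      note princ = rule_for_relevant[OF act ty, folded a_def, of j s' n, folded new_def, OF j']
      note side = rule_for_side[OF act ty, folded a_def, of j s' n, folded new_def, OF j']
      show ?thesis
      proof (cases "s = s'")
        case False
        then have l': "l < length (X s)" and x: "X' s ! l = (fst (X s ! l), birth (X s ! l), l)"
          using l by (simp_all add: X' put_def)
        show ?thesis
        proof (cases s)
          case Lhs
          then have "s' = Rhs" using False by (cases s') auto
          then have "length \<Gamma> = length (X Lhs)" by (simp add: \<Gamma>_def)
          then show ?thesis using side(1,2)[of "length (X Lhs) - Suc l"] x l' Lhs False
            by (simp add: r occ_of_def X' put_def)
        next
          case Rhs
          then have "s' = Lhs" using False by (cases s') auto
          moreover have "length \<Delta> = length (X Rhs)" using calculation by (simp add: \<Delta>_def)
          ultimately show ?thesis using side(3,4)[of l] x l' Rhs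
            by (simp add: r occ_of_def X' put_def)
        qed
      next
        case True
        then have l1: "l < length (new_items n new (X s'))" using l by (simp add: X' put_def)
        then have x: "X' s ! l = (if l < length new then (new ! l, Suc n, 0)
            else (fst (X s ! (Suc l - length new)), birth (X s ! (Suc l - length new)), Suc l - length new))"
          using nth_new_items[OF l1] True by (simp add: X' put_def)
        show ?thesis
        proof (cases "l < length new")
          case l_new: True
          have "occ_of X s 0 = (s', head_pos s' (length \<Gamma>))"
              "occ_of X' s l = (s', if s' = Lhs then length \<Gamma> + (length new - Suc l) else l)"
            using True len l_new by (cases s'; simp add: occ_of_def head_pos_def \<Gamma>_def X' put_def)+
          then show ?thesis using princ[OF l_new, of \<Gamma> \<Delta>] x l_new True by (simp add: r a_def)
        next
          case l_old: False
          show ?thesis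
          proof (cases s')
            case Lhs
            have "occ_of X s (Suc l - length new) = (Lhs, length (X Lhs) - Suc (Suc l - length new))"
                "occ_of X' s l = (Lhs, length (X Lhs) - Suc (Suc l - length new))"
                "length (X Lhs) - Suc (Suc l - length new) < length \<Gamma>"
              using True Lhs len l_old l1 by (auto simp: occ_of_def \<Gamma>_def X' put_def)
            then show ?thesis using side(1,2)[of "length (X Lhs) - Suc (Suc l - length new)"] x l_old by (simp add: r)
          next
            case Rhs
            have "occ_of X s (Suc l - length new) = (Rhs, 1 + (l - length new))"
                "occ_of X' s l = (Rhs, length new + (l - length new))" "l - length new < length \<Delta>"
              using True Rhs len l_old l1 by (auto simp: occ_of_def \<Delta>_def)
            then show ?thesis using side(3,4)[of "l - length new"] x l_old Rhs by (simp add: r)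
          qed
        qed
      qed
    qed
  qed
  then show ?R ?N by blast+
qed

text \<open>The forward counterpart of \<open>step_origin\<close>: no item is lost except the
  expanded head, and that one leaves all formulas of the chosen premise.\<close>

lemma step_forward:
  assumes inv: "state_inv V (n, t, X)" and j: "j < length (succs (n, t, X))" and st': "succs (n, t, X) ! j = (n', t', X')"
  shows "i < length (X s) \<Longrightarrow> t \<noteq> Some (s, 0) \<or> i \<noteq> 0 \<Longrightarrow>
      \<exists>x\<in>set (X' s). fst x = fst (X s ! i) \<and> birth x = birth (X s ! i)"
    and "t = Some (s, 0) \<Longrightarrow> j < length (expand s n (fst (X s ! 0))) \<and>
      set (expand s n (fst (X s ! 0)) ! j) \<subseteq> fst ` set (X' s)"
proof -
  have mem: "(n', t', X') \<in> set (succs (n, t, X))" using j st' nth_mem by metis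
  show "\<exists>x\<in>set (X' s). fst x = fst (X s ! i) \<and> birth x = birth (X s ! i)"
    if i: "i < length (X s)" "t \<noteq> Some (s, 0) \<or> i \<noteq> 0"
  proof -
    have kp: "keep (X s) ! i \<in> set (keep (X s))" using i by (intro nth_mem) simp
    have "\<exists>x\<in>set (X' s). x = keep (X s) ! i"
      using mem
    proof (cases rule: step_cases)
      case Pick
      then show ?thesis using kp by simp
    next
      case (Move s' i')
      have len: "Suc i' < length (X s')" using inv_oldest[of V n "(s', Suc i')" X] inv Move(1) by (simp add: oldest_def)
      show ?thesis
      proof (cases "s = s'")
        case True
        have "swap i' (keep (X s)) ! swap_at i' i = keep (X s) ! i"
          using nth_swap[of i' "keep (X s)" "swap_at i' i"] len i(1) True swap_at_less[of i' _ i] by simp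
        moreover have "swap_at i' i < length (swap i' (keep (X s)))" using len i(1) True swap_at_less[of i' _ i] by simp
        ultimately have "keep (X s) ! i \<in> set (swap i' (keep (X s)))" using nth_mem by metis
        then show ?thesis using Move True by (simp add: put_def)
      next
        case False
        then show ?thesis using Move kp by (simp add: put_def)
      qed
    next
      case (Expand s' new)
      show ?thesis
      proof (cases "s = s'")
        case True
        then obtain i' where "i = Suc i'" using i(2) Expand(1) by (cases i) auto
        then have "keep (X s) ! i = tl (keep (X s)) ! i'" "i' < length (tl (keep (X s)))"
          using i(1) by (simp_all add: nth_tl)
        then have "keep (X s) ! i \<in> set (tl (keep (X s)))" using nth_mem by metis
        then show ?thesis using Expand True by (simp add: put_def new_items_def)
      next
        case False
        then show ?thesis using Expand kp by (simp add: put_def)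
      qed
    qed
    then have "keep (X s) ! i \<in> set (X' s)" by blast
    then show ?thesis using i(1) by (intro bexI[of _ "keep (X s) ! i"]) simp_all
  qed
  show "j < length (expand s n (fst (X s ! 0))) \<and> set (expand s n (fst (X s ! 0)) ! j) \<subseteq> fst ` set (X' s)"
    if "t = Some (s, 0)"
    using j st' that by (auto simp: succs_def put_def new_items_def image_image image_Un)
qed


section \<open>A measure for fairness\<close>

definition cnt :: "nat \<Rightarrow> item list \<Rightarrow> nat" where
  "cnt t xs = length (filter (\<lambda>(a, m). active a \<and> m \<le> t) (map (\<lambda>x. (fst x, birth x)) xs))"

lemma cnt_keep [simp]: "cnt t (keep xs) = cnt t xs"
proof -
  have "map (\<lambda>x. (fst x, birth x)) (keep xs) = map (\<lambda>x. (fst x, birth x)) xs"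
    by (rule nth_equalityI) simp_all
  then show ?thesis by (simp only: cnt_def)
qed

lemma cnt_append: "cnt t (xs @ ys) = cnt t xs + cnt t ys"
  by (simp add: cnt_def)

lemma cnt_Cons: "cnt t (x # xs) = (if active (fst x) \<and> birth x \<le> t then 1 else 0) + cnt t xs"
  by (simp add: cnt_def)

lemma cnt_swap: "Suc i < length xs \<Longrightarrow> cnt t (swap i xs) = cnt t xs"
  by (subst (2) swap_self[of i xs, symmetric]) (simp_all add: swap_def cnt_append cnt_Cons)

lemma cnt_new_items:
  assumes "t \<le> n" "xs \<noteq> []"
  shows "cnt t (new_items n new xs) + (if active (fst (xs ! 0)) \<and> birth (xs ! 0) \<le> t then 1 else 0) = cnt t xs"
proof -
  have "keep xs \<noteq> []" using assms(2) by (metis length_0_conv length_keep)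
  then have "keep xs = keep xs ! 0 # tl (keep xs)" by (cases "keep xs") auto
  then have "cnt t xs = cnt t [keep xs ! 0] + cnt t (tl (keep xs))"
    by (metis cnt_keep cnt_append append_Cons append_Nil)
  moreover have "cnt t (map (\<lambda>a. (a, Suc n, 0)) new) = 0"
    using assms(1) by (auto simp: cnt_def filter_empty_conv)
  ultimately show ?thesis using assms(2) by (simp add: new_items_def cnt_append cnt_Cons) (simp add: cnt_def)
qed

definition total :: "nat \<Rightarrow> (side \<Rightarrow> item list) \<Rightarrow> nat" where
  "total t X = cnt t (X Lhs) + cnt t (X Rhs)"

text \<open>Items created later than \<open>m\<close> are not counted, so the number of old active
  items never grows, and expanding one of them lowers it. A constant supply of new items does no
  harm.\<close>

lemma step_total:
  assumes inv: "state_inv V (n, t, X)" and st': "(n', t', X') \<in> set (succs (n, t, X))" and m: "m \<le> n"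
  shows "total m X' \<le> total m X" "t = Some (s, 0) \<Longrightarrow> birth (X s ! 0) \<le> m \<Longrightarrow> total m X' < total m X"
proof -
  have "total m X' \<le> total m X \<and> (t = Some (s, 0) \<longrightarrow> birth (X s ! 0) \<le> m \<longrightarrow> total m X' < total m X)"
    using st'
  proof (cases rule: step_cases)
    case Pick
    then show ?thesis by (simp add: total_def)
  next
    case (Move s' i)
    then have "oldest X (s', Suc i)" using inv_oldest inv by simp
    then have "Suc i < length (keep (X s'))" by (simp add: oldest_def)
    from cnt_swap[OF this, of m] show ?thesis using Move by (cases s') (simp_all add: total_def put_def)
  next
    case (Expand s' new)
    then have old: "oldest X (s', 0)" using inv_oldest inv by simp
    then have "X s' \<noteq> []" "active (fst (X s' ! 0))" by (auto simp: oldest_def)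
    then have "cnt m (new_items n new (X s')) + (if birth (X s' ! 0) \<le> m then 1 else 0) = cnt m (X s')"
      using cnt_new_items[OF m, of "X s'" new] by simp
    then show ?thesis using Expand by (cases s') (auto simp: total_def put_def split: if_splits)
  qed
  then show "total m X' \<le> total m X" "t = Some (s, 0) \<Longrightarrow> birth (X s ! 0) \<le> m \<Longrightarrow> total m X' < total m X"
    by blast+
qed


section \<open>Infinite branches of the search\<close>

locale search =
  fixes V :: "var set" and st :: "nat \<Rightarrow> state" and j :: "nat \<Rightarrow> nat" and b :: "nat \<Rightarrow> deriv"
  assumes inv_st: "state_inv V (st i)"
    and unprovable: "\<not> provable (sq (st i))"
    and root: "root (b i) = rule_at (st i)"
    and j_less: "j i < length (succs (st i))"
    and st_Suc: "st (Suc i) = succs (st i) ! j i"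
    and time0: "fst (st 0) = 0"
    and init: "x \<in> set (its (st 0) s) \<Longrightarrow> fst x = eps (erase (fst x))"
begin

abbreviation X :: "nat \<Rightarrow> side \<Rightarrow> item list" where "X i \<equiv> its (st i)"
abbreviation T :: "nat \<Rightarrow> (side \<times> nat) option" where "T i \<equiv> tgt (st i)"

lemma st_mem: "st (Suc i) \<in> set (succs (st i))"
  using j_less st_Suc by simp

lemma time: "fst (st i) = i"
proof (induction i)
  case (Suc i)
  have "st (Suc i) \<in> set (succs (i, T i, X i))" using st_mem[of i] Suc by (metis prod.collapse)
  then show ?case by (cases rule: step_cases) auto
qed (rule time0)

lemma st_eq: "st i = (i, T i, X i)"
  by (metis prod.collapse time)

lemma inv': "state_inv V (i, T i, X i)"
  using inv_st[of i] st_eq by metis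

lemma j_less': "j i < length (succs (i, T i, X i))"
  using j_less[of i] st_eq by metis

lemma st_Suc': "succs (i, T i, X i) ! j i = (Suc i, T (Suc i), X (Suc i))"
  using st_Suc[of i] st_eq by metis

lemmas item = inv_item[OF inv']
lemmas origin = step_origin[OF inv' j_less' st_Suc']
lemmas linked = step_linked[OF inv' j_less' st_Suc']
lemmas forward = step_forward[OF inv' j_less' st_Suc']

lemma oldest_T: "T i = Some q \<Longrightarrow> oldest (X i) q"
  using inv'[of i] by (auto intro: inv_oldest)

lemma persist:
  assumes "x \<in> set (X m s)" "\<And>m'. m \<le> m' \<Longrightarrow> T m' = Some (s, 0) \<Longrightarrow> fst (X m' s ! 0) \<noteq> fst x" "m \<le> m'"
  shows "\<exists>y\<in>set (X m' s). fst y = fst x \<and> birth y = birth x"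
  using assms(3)
proof (induction m' rule: dec_induct)
  case base
  then show ?case using assms(1) by blast
next
  case (step m')
  then obtain i where i: "i < length (X m' s)" "fst (X m' s ! i) = fst x" "birth (X m' s ! i) = birth x"
    by (metis in_set_conv_nth)
  have "T m' \<noteq> Some (s, 0) \<or> i \<noteq> 0" using assms(2)[of m'] step(1) i(2) by (cases "i = 0") auto
  from forward(1)[OF i(1) this] show ?case using i by simp
qed

lemma target_moves:
  "T m = Some (s, i) \<Longrightarrow> T (m + i) = Some (s, 0) \<and> birth (X (m + i) s ! 0) = birth (X m s ! i)"
proof (induction i arbitrary: m)
  case (Suc i)
  have "st (Suc m) \<in> set (succs (m, T m, X m))" using st_mem[of m] st_eq by metis
  then have "T (Suc m) = Some (s, i) \<and> X (Suc m) = put (X m) s (swap i (keep (X m s)))"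
    using Suc.prems by (cases rule: step_cases) auto
  moreover have "Suc i < length (X m s)" using oldest_T[OF Suc.prems] by (simp add: oldest_def)
  ultimately have "T (Suc m) = Some (s, i)" "birth (X (Suc m) s ! i) = birth (X m s ! Suc i)"
    by (simp_all add: put_def nth_swap swap_at_def)
  then show ?case using Suc.IH[of "Suc m"] by simp
qed simp

text \<open>A missing target is chosen at the next step, since an active item is present. Being
  oldest, it is born no later than \<open>x\<close>, and it reaches the head after as many steps as
  its index.\<close>

lemma target_exists:
  assumes "x \<in> set (X m s)" "active (fst x)"
    and np: "\<And>m'. m \<le> m' \<Longrightarrow> T m' = Some (s, 0) \<Longrightarrow> fst (X m' s ! 0) \<noteq> fst x"
  obtains s' m' where "m \<le> m'" "T m' = Some (s', 0)" "birth (X m' s' ! 0) \<le> birth x"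
proof -
  have "\<exists>m1\<ge>m. T m1 \<noteq> None"
  proof (cases "T m")
    case None
    have "st (Suc m) \<in> set (succs (m, T m, X m))" using st_mem[of m] st_eq by metis
    then have "T (Suc m) = pick (X m)" using None by (cases rule: step_cases) auto
    then have "T (Suc m) \<noteq> None" using assms by (auto simp: pick_def)
    then show ?thesis using le_SucI by blast
  next
    case (Some q)
    then show ?thesis by auto
  qed
  then obtain m1 s' i where m1: "m \<le> m1" "T m1 = Some (s', i)" by auto
  obtain y where y: "y \<in> set (X m1 s)" "fst y = fst x" "birth y = birth x"
    using persist[OF assms(1) np m1(1)] by blast
  have "\<forall>s. \<forall>z\<in>set (X m1 s). active (fst z) \<longrightarrow> birth (X m1 s' ! i) \<le> birth z"
    using oldest_T[OF m1(2)] unfolding oldest_def by simp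
  then have "birth (X m1 s' ! i) \<le> birth y" using y(1,2) assms(2) by metis
  then show thesis using target_moves[OF m1(2)] m1(1) y(3) that[of "m1 + i" s'] by simp
qed

text \<open>Fairness, by induction on the number of active items at least as old as
  \<open>x\<close>. While the formula of \<open>x\<close> waits, some such item reaches the head and
  is expanded, which lowers this number.\<close>

lemma processed:
  "x \<in> set (X m s) \<Longrightarrow> active (fst x) \<Longrightarrow> \<exists>m'\<ge>m. T m' = Some (s, 0) \<and> fst (X m' s ! 0) = fst x"
proof (induction "total (birth x) (X m)" arbitrary: m x rule: less_induct)
  case less
  show ?case
  proof (rule ccontr)
    assume neg: "\<not> ?case"
    then have np: "\<And>m'. m \<le> m' \<Longrightarrow> T m' = Some (s, 0) \<Longrightarrow> fst (X m' s ! 0) \<noteq> fst x" by blast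
    obtain m' s' where m': "m \<le> m'" "T m' = Some (s', 0)" "birth (X m' s' ! 0) \<le> birth x"
      by (rule target_exists[OF less.prems np])
    have bm: "birth x \<le> m" using item[OF less.prems(1)] by simp
    have mem: "(Suc i, T (Suc i), X (Suc i)) \<in> set (succs (i, T i, X i))" for i
      using st_mem[of i] st_eq by metis
    have "total (birth x) (X m') \<le> total (birth x) (X m)"
      using m'(1)
    proof (induction m' rule: dec_induct)
      case (step m')
      have "birth x \<le> m'" using bm step(1) by linarith
      from step_total(1)[OF inv' mem this] step(3) show ?case by linarith
    qed simp
    moreover have "total (birth x) (X (Suc m')) < total (birth x) (X m')"
      by (rule step_total(2)[OF inv' mem _ m'(2,3)]) (use bm m'(1) in linarith)
    ultimately have lt: "total (birth x) (X (Suc m')) < total (birth x) (X m)" by linarith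
    have "m \<le> Suc m'" using m'(1) by simp
    from persist[OF less.prems(1) np this] obtain y where
      y: "y \<in> set (X (Suc m') s)" "fst y = fst x" "birth y = birth x" by blast
    have "total (birth y) (X (Suc m')) < total (birth x) (X m)" using lt by (simp only: y(3))
    moreover have "active (fst y)" using less.prems(2) by (simp only: y(2))
    ultimately obtain m'' where m'': "Suc m' \<le> m''" "T m'' = Some (s, 0)" "fst (X m'' s ! 0) = fst y"
      using less.hyps[OF _ y(1)] by blast
    have "m \<le> m''" using m'(1) m''(1) by linarith
    from np[OF this m''(2)] show False using m''(3) y(2) by simp
  qed
qed

section \<open>Formulas and unfoldings of the branch\<close>

definition F :: "side \<Rightarrow> afm set" where
  "F s = {fst x |m x. x \<in> set (X m s)}"

text \<open>Pairs are recorded only for unfoldings that happen on side \<open>s\<close>. As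
  \<open>k\<close> is the time of the unfolding, it determines the operator and thereby
  \<open>p\<close>.\<close>

definition W :: "side \<Rightarrow> fixkind \<Rightarrow> (nat list \<times> nat list) set" where
  "W s \<sigma> = {(p @ [k], p) |k p. T k = Some (s, 0) \<and> (\<exists>T' c ds. fst (X k s ! 0) = apps (Fix \<sigma> p T' c) ds)}"

lemma F_expand:
  assumes "a \<in> F s" "active a"
  shows "\<exists>m. T m = Some (s, 0) \<and> fst (X m s ! 0) = a \<and> j m < length (expand s m a) \<and> set (expand s m a ! j m) \<subseteq> F s"
proof -
  obtain m x where "x \<in> set (X m s)" "fst x = a" using assms(1) by (auto simp: F_def)
  then obtain m where m: "T m = Some (s, 0)" "fst (X m s ! 0) = a" using processed assms(2) by blast
  have "fst ` set (X (Suc m) s) \<subseteq> F s" unfolding F_def by blast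
  then show ?thesis using forward(2)[OF m(1)] m by (intro exI[of _ m]) auto
qed

text \<open>Inactive formulas are never expanded and stay for good, so finitely many of them can be
  found in one common sequent.\<close>

lemma F_inactive:
  assumes "a \<in> F s" "\<not> active a"
  obtains M where "\<And>m. M \<le> m \<Longrightarrow> erase a \<in> set (occs (sq (st m)) s)"
proof -
  obtain M x where x: "x \<in> set (X M s)" "fst x = a" using assms(1) by (auto simp: F_def)
  have "erase a \<in> set (occs (sq (st m)) s)" if "M \<le> m" for m
  proof -
    have "\<exists>y\<in>set (X m s). fst y = fst x \<and> birth y = birth x"
    proof (rule persist[OF x(1) _ that])
      fix m' assume "T m' = Some (s, 0)"
      from oldest_T[OF this] show "fst (X m' s ! 0) \<noteq> fst x" using x(2) assms(2) by (auto simp: oldest_def)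
    qed
    then obtain y where "y \<in> set (X m s)" "erase a = erase (fst y)" using x(2) by metis
    then have "erase a \<in> (\<lambda>x. erase (fst x)) ` set (X m s)" by (rule rev_image_eqI)
    then show ?thesis by (cases s) (simp_all add: sq_def fms_def)
  qed
  then show thesis by (rule that)
qed

lemma typed_sq: "typed_seq (sq (st i))"
  using item[of _ i] by (auto simp: typed_seq_iff sq_def fms_def)


subsection \<open>Traces\<close>

text \<open>\<open>anc s m i k\<close> is the index at time \<open>k \<le> m\<close> of the ancestor of the item with index \<open>i\<close> at time \<open>m\<close>.\<close>

primrec anc :: "side \<Rightarrow> nat \<Rightarrow> nat \<Rightarrow> nat \<Rightarrow> nat" where
  "anc s 0 i k = i"
| "anc s (Suc m) i k = (if Suc m \<le> k then i else anc s m (org (X (Suc m) s ! i)) k)"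

lemma anc_self [simp]: "m \<le> k \<Longrightarrow> anc s m i k = i"
  by (cases m) auto

lemma anc_less: "i < length (X m s) \<Longrightarrow> k \<le> m \<Longrightarrow> anc s m i k < length (X k s)"
proof (induction m arbitrary: i)
  case (Suc m)
  show ?case
  proof (cases "Suc m \<le> k")
    case False
    then show ?thesis using Suc.IH[OF origin(2)[OF Suc.prems(1)]] by simp
  qed (use Suc.prems in \<open>auto simp: le_antisym\<close>)
qed simp

lemma anc_comp: "l \<le> k \<Longrightarrow> k \<le> m \<Longrightarrow> anc s k (anc s m i k) l = anc s m i l"
proof (induction m arbitrary: i)
  case (Suc m)
  then show ?case by (cases "k = Suc m") auto
qed simp

lemma anc_step: "k < m \<Longrightarrow> org (X (Suc k) s ! anc s m i (Suc k)) = anc s m i k"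
  using anc_comp[of k "Suc k" m s i] by simp

text \<open>By induction back along the ancestors: a number \<open>k\<close> enters an annotation
  only through the unfolding at time \<open>k\<close>, so the ancestor at that time is the unfolded
  item at the head, with annotation \<open>p\<close>.\<close>

lemma provenance:
  assumes "i < length (X m s)" "p @ [k] \<in> anns \<sigma> (fst (X m s ! i))"
  shows "k < m \<and> anc s m i k = 0 \<and> T k = Some (s, 0) \<and> (\<exists>T' c ds. fst (X k s ! 0) = apps (Fix \<sigma> p T' c) ds)"
  using assms
proof (induction m arbitrary: i)
  case 0
  obtain e where e: "fst (X 0 s ! i) = eps e" using init[OF nth_mem[OF 0(1)]] by blast
  have "set_exp (eps e) \<subseteq> {[]}" by (auto simp: exp.set_map)
  then have "p @ [k] = []" using 0(2) anns_subset[of \<sigma> "eps e"] unfolding e by blast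
  then show ?case by simp
next
  case (Suc m)
  define x where "x = X (Suc m) s ! i"
  note o = origin(2,3)[OF Suc.prems(1), folded x_def]
  have anc: "k \<le> m \<Longrightarrow> anc s (Suc m) i k = anc s m (org x) k" by (simp add: x_def)
  have IH: ?case if "p @ [k] \<in> anns \<sigma> (fst (X m s ! org x))"
    using Suc.IH[OF o(1) that] anc by (metis less_SucI less_imp_le)
  from o(2) show ?case
  proof
    assume "fst x = fst (X m s ! org x) \<and> birth x = birth (X m s ! org x)"
    then have "p @ [k] \<in> anns \<sigma> (fst (X m s ! org x))" using Suc.prems(2) unfolding x_def by metis
    then show ?thesis by (rule IH)
  next
    assume new: "T m = Some (s, 0) \<and> org x = 0 \<and> j m < length (expand s m (fst (X m s ! 0))) \<and>
      fst x \<in> set (expand s m (fst (X m s ! 0)) ! j m) \<and> birth x = Suc m"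
    then have act: "active (fst (X m s ! 0))" using oldest_T[of m] by (auto simp: oldest_def)
    have ty: "has_type [] (fst (X m s ! 0)) (TForm TOmega)" using item[OF nth_mem[OF o(1)]] new by simp
    have "expand s m (fst (X m s ! 0)) ! j m \<in> set (expand s m (fst (X m s ! 0)))" using new by simp
    from expand_anns[OF ty act this, of "fst x" "p @ [k]" \<sigma>] new Suc.prems(2)[folded x_def]
    consider "p @ [k] \<in> anns \<sigma> (fst (X m s ! 0))"
      | q T' e ds where "fst (X m s ! 0) = apps (Fix \<sigma> q T' e) ds" "p @ [k] = q @ [m]"
      by blast
    then show ?thesis
    proof cases
      case 1
      have "org x = 0" using new by blast
      then show ?thesis using IH 1 by (simp only:)
    next
      case 2
      then have "k = m" by simp
      moreover have "p = q" using 2(2) by simp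
      moreover have "anc s (Suc m) i m = 0" using new anc[unfolded \<open>k = m\<close>] by simp
      ultimately show ?thesis using new 2(1) by blast
    qed
  qed
qed

text \<open>A descending chain may start at a nonempty annotation. Its proper prefixes must be
  assigned as well, and they are found at earlier unfoldings on the same line of ancestors.\<close>

lemma prefix_assigned:
  "i < length (X m s) \<Longrightarrow> p @ q \<in> anns \<sigma> (fst (X m s ! i)) \<Longrightarrow> \<exists>k\<le>m. p \<in> anns \<sigma> (fst (X k s ! anc s m i k))"
proof (induction q arbitrary: m i rule: rev_induct)
  case Nil
  then show ?case by auto
next
  case (snoc k q)
  have "(p @ q) @ [k] \<in> anns \<sigma> (fst (X m s ! i))" using snoc.prems(2) by simp
  from provenance[OF snoc.prems(1) this] obtain T' c ds where
    k: "k < m" "anc s m i k = 0" and fix_k: "T k = Some (s, 0)" "fst (X k s ! 0) = apps (Fix \<sigma> (p @ q) T' c) ds"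
    by blast
  have "0 < length (X k s)" using oldest_T[OF fix_k(1)] by (simp add: oldest_def)
  from snoc.IH[OF this, of] fix_k(2) obtain k' where
    k': "k' \<le> k" "p \<in> anns \<sigma> (fst (X k' s ! anc s k 0 k'))" by auto
  then show ?case using anc_comp[of k' k m s i] k by (intro exI[of _ k']) simp
qed

lemma fm_at_occ:
  "i < length (X m s) \<Longrightarrow> snd (occ_of (X m) s i) < length (occs (sq (st m)) s) \<and>
    occs (sq (st m)) s ! snd (occ_of (X m) s i) = erase (fst (X m s ! i))"
  by (cases s) (auto simp: occ_of_def sq_def rev_nth fms_nth)

text \<open>A descending chain in \<open>W\<close> lists unfoldings. By \<open>provenance\<close>
  each is an ancestor of the next, so the times increase and the lines of ancestors agree; together
  they form one infinite trace.\<close>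

lemma trace_of_chain:
  assumes "\<not> wf (W s \<sigma>)"
  shows "\<exists>\<tau>. fst (\<tau> 0) = s \<and> fix_trace \<sigma> b j \<tau>"
proof -
  obtain f where f: "\<And>r. (f (Suc r), f r) \<in> W s \<sigma>" using assms by (auto simp: wf_iff_no_infinite_down_chain)
  have "\<exists>k. f (Suc r) = f r @ [k] \<and> T k = Some (s, 0) \<and> (\<exists>T' c ds. fst (X k s ! 0) = apps (Fix \<sigma> (f r) T' c) ds)" for r
    using f[of r] by (auto simp: W_def)
  then obtain ks where ks: "\<And>r. f (Suc r) = f r @ [ks r]" "\<And>r. T (ks r) = Some (s, 0)"
      "\<And>r. \<exists>T' c ds. fst (X (ks r) s ! 0) = apps (Fix \<sigma> (f r) T' c) ds"
    by metis
  have pos: "0 < length (X (ks r) s)" for r using oldest_T[OF ks(2)] by (simp add: oldest_def)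
  have f_ann: "f r \<in> anns \<sigma> (fst (X (ks r) s ! 0))" for r using ks(3)[of r] by auto
  have prov: "ks r < ks (Suc r) \<and> anc s (ks (Suc r)) 0 (ks r) = 0" for r
    using provenance[OF pos[of "Suc r"], of "f r" "ks r" \<sigma>] f_ann[of "Suc r"] ks(1)[of r] by simp
  then have mono: "strict_mono ks" by (simp add: strict_mono_Suc_iff)
  have ge: "r \<le> ks r" for r using strict_mono_imp_increasing[OF mono] .
  have consistent: "anc s (ks r') 0 l = anc s (ks r) 0 l" if "r \<le> r'" "l \<le> ks r" for r r' l
    using that(1)
  proof (induction r' rule: dec_induct)
    case (step r')
    have "l \<le> ks r'" using that(2) step(1) mono by (meson le_trans strict_mono_less_eq)
    then have "anc s (ks (Suc r')) 0 l = anc s (ks r') 0 l"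
      using anc_comp[of l "ks r'" "ks (Suc r')" s 0] prov[of r'] by simp
    then show ?case using step(3) by simp
  qed simp
  \<comment> \<open>Any \<open>ks r\<close> with \<open>l \<le> ks r\<close> yields the same
    ancestor at time \<open>l\<close>; taking \<open>r = l\<close> is legitimate since
    \<open>l \<le> ks l\<close>.\<close>
  define idx where "idx = (\<lambda>l. anc s (ks l) 0 l)"
  have idx_less: "idx l < length (X l s)" for l unfolding idx_def by (rule anc_less[OF pos ge])
  have idx_step: "org (X (Suc l) s ! idx (Suc l)) = idx l" for l
    using anc_step[of l "ks (Suc l)" s 0] ge[of "Suc l"] consistent[of l "Suc l" l] ge[of l] by (simp add: idx_def)
  have idx_anc: "anc s (ks r) 0 l = idx l" if "l \<le> ks r" for r l
    using consistent[of r l l] consistent[of l r l] that ge[of l] by (cases "r \<le> l") (simp_all add: idx_def)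
  have idx_ks: "idx (ks r) = 0" for r using idx_anc[of "ks r" r] by simp
  define \<tau> where "\<tau> = (\<lambda>l. occ_of (X l) s (idx l))"
  define a where "a = (\<lambda>l. fst (X l s ! idx l))"
  have fst_\<tau>: "fst (\<tau> l) = s" for l by (simp add: \<tau>_def occ_of_def)
  have concl_b: "concl (root (b l)) = sq (st l)" for l
    using step_rule(2)[OF inv'[of l]] root[of l] st_eq[of l] by simp
  have rule_b: "root (b l) = rule_at (l, T l, X l)" for l using root[of l] st_eq[of l] by simp
  have len: "snd (\<tau> l) < length (occs (concl (root (b l))) (fst (\<tau> l)))"
    and fm: "erase (a l) = fm_at (concl (root (b l))) (\<tau> l)" for l
    using fm_at_occ[OF idx_less[of l]] unfolding concl_b fst_\<tau> unfolding \<tau>_def a_def by simp_all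
  have rel: "relevant (root (b l)) (j l) (\<tau> l) (\<tau> (Suc l))"
    and ann: "annot (root (b l)) (j l) l (\<tau> l) (\<tau> (Suc l)) (a l) (a (Suc l))" for l
    using linked[OF idx_less[of "Suc l"]] unfolding idx_step rule_b \<tau>_def a_def by blast+
  have princ: "logical (root (b (ks r))) \<and> principal (root (b (ks r))) (\<tau> (ks r))" for r
    using step_rule(4)[OF inv' ks(2)[of r]] by (simp add: rule_b \<tau>_def idx_ks)
  have "trace b j \<tau>"
    unfolding trace_def using len rel princ ge by blast
  moreover have "annotation b j \<tau> a"
    unfolding annotation_def
  proof (intro conjI exI[of _ "\<lambda>i. i"])
    show "a 0 = eps (fm_at (concl (root (b 0))) (\<tau> 0))"
      using init[OF nth_mem[OF idx_less[of 0]]] unfolding fm[symmetric] by (simp add: a_def)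
    have "k < m" if "p \<in> set_exp (a m)" "k \<in> set p" for m p k
      using item[OF nth_mem[OF idx_less[of m]]] that by (auto simp: a_def)
    then show "\<forall>i. (\<forall>m\<le>i. \<forall>p\<in>set_exp (a m). i \<notin> set p) \<and>
        annot (root (b i)) (j i) i (\<tau> i) (\<tau> (Suc i)) (a i) (a (Suc i))"
      using ann by (meson leD)
  qed (use fm in blast)
  moreover
  \<comment> \<open>The infinite annotation sequence: first the annotation at which the chain
    starts, then the times of its unfoldings.\<close>
  define q where "q = (\<lambda>n. if n < length (f 0) then f 0 ! n else ks (n - length (f 0)))"
  have q: "map q [0..<length (f 0) + r] = f r" for r
  proof (induction r)
    case 0
    show ?case by (rule nth_equalityI) (simp_all add: q_def)
  next
    case (Suc r)
    then show ?case by (simp add: ks(1) q_def)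
  qed
  have "\<exists>i. map q [0..<n] \<in> anns \<sigma> (a i)" for n
  proof (cases "n < length (f 0)")
    case True
    have "map q [0..<n] = take n (f 0)" using True by (intro nth_equalityI) (simp_all add: q_def)
    then have "map q [0..<n] @ drop n (f 0) \<in> anns \<sigma> (fst (X (ks 0) s ! 0))" using f_ann[of 0] by simp
    from prefix_assigned[OF pos this] obtain k where
      "k \<le> ks 0" "map q [0..<n] \<in> anns \<sigma> (fst (X k s ! anc s (ks 0) 0 k))" by blast
    then show ?thesis using idx_anc[of k 0] by (auto simp: a_def)
  next
    case False
    then obtain r where "n = length (f 0) + r" using le_Suc_ex not_less by blast
    then show ?thesis using q[of r] f_ann[of r] by (intro exI[of _ "ks r"]) (simp add: a_def idx_ks)
  qed
  ultimately have "fix_trace \<sigma> b j \<tau>" unfolding fix_trace_def by blast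
  then show ?thesis using fst_\<tau> by blast
qed

lemma wf_W:
  assumes "\<not> good b j"
  shows "wf (W s (kind (s = Lhs)))"
proof (rule ccontr)
  assume "\<not> wf (W s (kind (s = Lhs)))"
  from trace_of_chain[OF this] obtain \<tau> where \<tau>: "fst (\<tau> 0) = s" "fix_trace (kind (s = Lhs)) b j \<tau>" by blast
  have "good b j"
    unfolding good_def by (rule exI[of _ 0], rule exI[of _ \<tau>]) (use \<tau> in \<open>cases s; simp add: kind_def\<close>)
  then show False using assms by simp
qed

end


section \<open>The valuation read off a branch\<close>

text \<open>Turns a predicate on number lists into a coded curried function. All functions from
  numbers are monotone, so any predicate is admissible.\<close>

fun encode :: "'u universe \<Rightarrow> fty \<Rightarrow> (nat list \<Rightarrow> bool) \<Rightarrow> 'u val" where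
  "encode U TOmega P = Truth (P [])"
| "encode U (TFun A T) P =
    Fn (code U (\<lambda>v. if v \<in> range Num then encode U T (\<lambda>ns. P (num_of v # ns)) else Num 0))"

lemma encode_first_order:
  "fullF U ((TFun TNat ^^ k) TOmega) \<Longrightarrow> encode U ((TFun TNat ^^ k) TOmega) P \<in> domF U ((TFun TNat ^^ k) TOmega) \<and>
    (\<forall>ns. length ns = k \<longrightarrow> foldl (apply_val U) (encode U ((TFun TNat ^^ k) TOmega) P) (map Num ns) = Truth (P ns))"
proof (induction k arbitrary: P)
  case 0
  then show ?case by auto
next
  case (Suc k)
  let ?T = "(TFun TNat ^^ k) TOmega"
  let ?g = "\<lambda>P v. if v \<in> range Num then encode U ?T (\<lambda>ns. P (num_of v # ns)) else Num 0"
  have full: "fullF U (TFun TNat ?T)" using Suc.prems by simp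
  then have T: "fullF U ?T" by simp
  note IH = Suc.IH[OF T]
  have g: "?g P \<in> mono_funs (interp U TNat) (interpF U ?T)"
    using IH leF_refl[OF T] by (auto simp: mono_funs_def)
  then have "encode U (TFun TNat ?T) P \<in> domF U (TFun TNat ?T)" by auto
  moreover have "foldl (apply_val U) (encode U (TFun TNat ?T) P) (map Num ns) = Truth (P ns)"
    if len: "length ns = Suc k" for ns
  proof -
    obtain n ms where ns: "ns = n # ms" "length ms = k" using len by (auto simp: length_Suc_conv)
    have "apply_val U (encode U (TFun TNat ?T) P) (Num n) = encode U ?T (\<lambda>ns. P (n # ns))"
      unfolding encode.simps apply_code[OF full g] by simp
    then show ?thesis using IH ns by simp
  qed
  ultimately show ?case by simp
qed

lemma types_of_fvs: "x \<in> fvs e \<Longrightarrow> snd x \<in> types_of \<Theta> e"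
  by (induction e arbitrary: \<Theta>) auto

lemma sem_map_exp [simp]: "sem U \<rho> \<eta> (map_exp f e) = sem U \<rho> \<eta> e"
  by (induction e arbitrary: \<eta>) (auto cong: if_cong split: fixkind.split)

lemma types_of_map_exp [simp]: "types_of \<Theta> (map_exp f e) = types_of \<Theta> e"
proof (induction e arbitrary: \<Theta>)
  case (Lam A e)
  have "has_type \<Theta> (Lam A (map_exp f e)) B \<longleftrightarrow> has_type \<Theta> (Lam A e) B" for B
    using has_type_map_exp[of \<Theta> f "Lam A e" B] by simp
  then show ?case using Lam by simp
qed auto

lemma fvs_map_exp [simp]: "fvs (map_exp f e) = fvs e"
  by (induction e) auto

context search
begin

text \<open>No accepted trace means that annotation extension is well-founded for \<mu> on the left
  and for \<nu> on the right, so the truth lemma applies to both sides under the same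
  valuation.\<close>

lemma countermodel:
  fixes U :: "'u universe"
  assumes not_good: "\<not> good b j"
    and V: "\<And>x. x \<in> V \<Longrightarrow> first_order x \<and> full U (snd x)"
    and full: "\<And>s x B. x \<in> set (X 0 s) \<Longrightarrow> B \<in> types_of [] (fst x) \<Longrightarrow> full U B"
  shows "\<exists>\<rho>. (\<forall>x\<in>V. \<rho> x \<in> dom_ty U (snd x)) \<and>
    (\<forall>s. \<forall>x\<in>set (X 0 s). sem U \<rho> [] (fst x) = Truth (s = Lhs))"
proof -
  \<comment> \<open>\<open>Num 0\<close> is a default: no variable in \<open>V\<close> has type N.
    Atoms applied to numerals contain no operators, so they carry no annotations.\<close>
  define \<rho> where "\<rho> = (\<lambda>x. case snd x of TNat \<Rightarrow> Num 0
    | TForm T' \<Rightarrow> encode U T' (\<lambda>ns. apps (FV x) (map num ns) \<in> F Lhs))"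
  have F_item: "a \<in> F s \<Longrightarrow> has_type [] a (TForm TOmega) \<and> fvs a \<subseteq> V" for a s
    unfolding F_def using item by blast
  have dom: "\<rho> x \<in> dom_ty U (snd x)" if "x \<in> V" for x
    using V[OF that] encode_first_order[of U] by (auto simp: first_order_def \<rho>_def)
  have atom: "foldl (apply_val U) (\<rho> x) (map Num ns) = Truth (apps (FV x) (map num ns) \<in> F Lhs)"
    if "x \<in> V" "snd x = TForm ((TFun TNat ^^ length ns) TOmega)" for x ns
    using V[OF that(1)] encode_first_order[of U "length ns"] that(2) by (simp add: \<rho>_def)
  \<comment> \<open>An inactive formula found on both sides would eventually stand on both sides of
    one sequent, which is then provable by an axiom.\<close>
  have conflict: "a \<notin> F Rhs" if a: "a \<in> F Lhs" "\<not> active a" for a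
  proof
    assume "a \<in> F Rhs"
    obtain M where M: "\<And>m. M \<le> m \<Longrightarrow> erase a \<in> set (occs (sq (st m)) Lhs)" using F_inactive[OF a] by blast
    obtain M' where M': "\<And>m. M' \<le> m \<Longrightarrow> erase a \<in> set (occs (sq (st m)) Rhs)"
      using F_inactive[OF \<open>a \<in> F Rhs\<close> a(2)] by blast
    let ?m = "max M M'"
    have "provable (fst (sq (st ?m)), snd (sq (st ?m)))"
      by (rule provable_axiom[of "erase a"]) (use M[of ?m] M'[of ?m] typed_sq[of ?m] in auto)
    then show False using unprovable[of ?m] by simp
  qed
  have side: "branch_side U \<rho> (s = Lhs) (F s) (W s (kind (s = Lhs)))" for s
  proof
    show "wf (W s (kind (s = Lhs)))" by (rule wf_W[OF not_good])
  next
    fix c d assume "Or c d \<in> F s"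
    from F_expand[OF this] obtain m where
      "j m < length (expand s m (Or c d))" "set (expand s m (Or c d) ! j m) \<subseteq> F s" by auto
    then show "if s = Lhs then c \<in> F s \<or> d \<in> F s else c \<in> F s \<and> d \<in> F s"
      by (auto simp: less_Suc_eq split: if_splits)
  next
    fix c d assume "And c d \<in> F s"
    from F_expand[OF this] obtain m where
      "j m < length (expand s m (And c d))" "set (expand s m (And c d) ! j m) \<subseteq> F s" by auto
    then show "if s = Lhs then c \<in> F s \<and> d \<in> F s else c \<in> F s \<or> d \<in> F s"
      by (auto simp: less_Suc_eq split: if_splits)
  next
    fix A c d ds assume "apps (App (Lam A c) d) ds \<in> F s"
    from F_expand[OF this] show "apps (inst 0 d c) ds \<in> F s" by (auto simp del: foldl_Cons)
  next
    fix \<sigma> p T' c ds assume "apps (Fix \<sigma> p T' c) ds \<in> F s"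
    from F_expand[OF this] obtain m where m: "T m = Some (s, 0)" "fst (X m s ! 0) = apps (Fix \<sigma> p T' c) ds"
      "apps (inst 0 (Fix \<sigma> (p @ [m]) T' c) c) ds \<in> F s" by auto
    then have "\<sigma> = kind (s = Lhs) \<longrightarrow> (p @ [m], p) \<in> W s (kind (s = Lhs))" by (auto simp: W_def)
    then show "\<exists>k. apps (inst 0 (Fix \<sigma> (p @ [k]) T' c) c) ds \<in> F s \<and>
        (\<sigma> = kind (s = Lhs) \<longrightarrow> (p @ [k], p) \<in> W s (kind (s = Lhs)))" using m(3) by blast
  next
    fix n m assume eq: "Eq (num n) (num m) \<in> F s"
    from F_inactive[OF eq] obtain M where M: "erase (Eq (num n) (num m)) \<in> set (occs (sq (st M)) s)" by auto
    have np: "\<not> provable (fst (sq (st M)), snd (sq (st M)))" using unprovable[of M] by simp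
    have ty: "typed_seq (fst (sq (st M)), snd (sq (st M)))" using typed_sq[of M] by simp
    show "(n = m) = (s = Lhs)"
    proof (cases s)
      case Lhs
      then have "Eq (num n) (num m) \<in> set (fst (sq (st M)))" using M by simp
      from provable_eqL[OF this _ ty] np Lhs show ?thesis by auto
    next
      case Rhs
      then have mem: "Eq (num n) (num m) \<in> set (snd (sq (st M)))" using M by simp
      have "n \<noteq> m"
      proof
        assume "n = m"
        then have "Eq (num n) (num n) \<in> set (snd (sq (st M)))" using mem by simp
        from provable_eqR[OF this ty] np show False by blast
      qed
      then show ?thesis using Rhs by simp
    qed
  next
    fix x ns assume x: "snd x = TForm ((TFun TNat ^^ length ns) TOmega)" "apps (FV x) (map num ns) \<in> F s"
    then have "x \<in> V" using F_item by fastforce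
    from atom[OF this x(1)] conflict[of "apps (FV x) (map num ns)"] x(2)
    show "foldl (apply_val U) (\<rho> x) (map Num ns) = Truth (s = Lhs)" by (cases s) auto
  qed
  have "sem U \<rho> [] (fst x) = Truth (s = Lhs)" if x: "x \<in> set (X 0 s)" for s x
  proof (rule branch_side.truth[OF side])
    show mem: "fst x \<in> F s" using x unfolding F_def by blast
    show "has_type [] (fst x) (TForm TOmega)" using F_item[OF mem] by blast
    show "\<forall>B\<in>types_of [] (fst x). full U B" using full[OF x] by blast
    show "\<forall>y\<in>fvs (fst x). first_order y \<and> \<rho> y \<in> dom_ty U (snd y)" using F_item[OF mem] V dom by blast
  qed
  then show ?thesis using dom by blast
qed

end

lemma completeness_first_order:
  fixes U :: "'u universe"
  assumes typed: "typed_seq (\<Gamma>, \<Delta>)" and fo: "\<And>x. x \<in> fvs_seq (\<Gamma>, \<Delta>) \<Longrightarrow> first_order x"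
    and full: "full_seq U (\<Gamma>, \<Delta>)" and valid: "valid U (\<Gamma>, \<Delta>)"
  shows "provable (\<Gamma>, \<Delta>)"
proof -
  define V where "V = fvs_seq (\<Gamma>, \<Delta>)"
  define X0 :: "side \<Rightarrow> item list" where
    "X0 = case_side (rev (map (\<lambda>\<phi>. (eps \<phi>, 0, 0)) \<Gamma>)) (map (\<lambda>\<phi>. (eps \<phi>, 0, 0)) \<Delta>)"
  define st0 :: state where "st0 = (0, None, X0)"
  have X0: "x \<in> set (X0 s) \<longleftrightarrow> (\<exists>\<phi>\<in>set (if s = Lhs then \<Gamma> else \<Delta>). x = (eps \<phi>, 0, 0))" for s x
    by (cases s) (auto simp: X0_def)
  have sq0: "sq st0 = (\<Gamma>, \<Delta>)"
    by (simp add: st0_def sq_def X0_def fms_def rev_map comp_def exp.map_comp)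
  have fvs_V: "x \<in> V" if "x \<in> fvs \<phi>" "\<phi> \<in> set \<Gamma> \<union> set \<Delta>" for x \<phi> using that by (auto simp: V_def fvs_seq_def)
  have inv0: "state_inv V st0"
    using typed fvs_V by (auto simp: st0_def state_inv_def X0 exp.set_map typed_seq_iff split: if_splits)
  have "provable (sq st0)"
  proof (rule provable_search[where I = "state_inv V" and rl = rule_at and nx = succs])
    show "state_inv V st0" by (rule inv0)
    fix s assume s: "state_inv V s"
    obtain n t X where e: "s = (n, t, X)" by (cases s) auto
    show "rule_ok (rule_at s) \<and> typed_seq (sq s) \<and> concl (rule_at s) = sq s \<and>
        map sq (succs s) = prems (rule_at s) \<and> (\<forall>s'\<in>set (succs s). state_inv V s')"
    proof (intro conjI ballI)
      show "rule_ok (rule_at s)" "concl (rule_at s) = sq s" "map sq (succs s) = prems (rule_at s)"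
        using step_rule[of V n t X] s e by simp_all
      show "typed_seq (sq s)"
        using s inv_item[of V n t X] by (auto simp: e typed_seq_iff sq_def fms_def)
      show "state_inv V s'" if "s' \<in> set (succs s)" for s'
        using inv_step[of V n t X s'] s that e by simp
    qed
  next
    fix b :: "nat \<Rightarrow> deriv" and st :: "nat \<Rightarrow> state" and j
    assume st_0: "st 0 = st0" and st: "\<And>i. state_inv V (st i) \<and> \<not> provable (sq (st i)) \<and> root (b i) = rule_at (st i) \<and>
      j i < length (succs (st i)) \<and> st (Suc i) = succs (st i) ! j i"
    interpret search V st j b
    proof
      show "fst (st 0) = 0" by (simp add: st_0 st0_def)
      fix x s assume "x \<in> set (its (st 0) s)"
      then show "fst x = eps (erase (fst x))" by (auto simp: st_0 st0_def X0 exp.map_comp comp_def)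
    qed (use st in blast)+
    show "good b j"
    proof (rule ccontr)
      assume "\<not> good b j"
      have "\<exists>\<rho>. (\<forall>x\<in>V. \<rho> x \<in> dom_ty U (snd x)) \<and>
          (\<forall>s. \<forall>x\<in>set (its (st 0) s). sem U \<rho> [] (fst x) = Truth (s = Lhs))"
      proof (rule countermodel[OF \<open>\<not> good b j\<close>])
        fix x assume x: "x \<in> V"
        then obtain \<phi> where "\<phi> \<in> set \<Gamma> \<union> set \<Delta>" "x \<in> fvs \<phi>" by (auto simp: V_def fvs_seq_def)
        then have "full U (snd x)" using full types_of_fvs[of x \<phi> "[]"] by (auto simp: full_seq_def)
        then show "first_order x \<and> full U (snd x)" using fo x by (simp add: V_def)
      next
        fix s x B assume "x \<in> set (its (st 0) s)" "B \<in> types_of [] (fst x)"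
        then have "\<exists>\<phi>\<in>set \<Gamma> \<union> set \<Delta>. B \<in> types_of [] \<phi>"
          by (cases s) (auto simp: st_0 st0_def X0)
        then show "full U B" using full unfolding full_seq_def by auto
      qed
      then obtain \<rho> where \<rho>: "\<forall>x\<in>V. \<rho> x \<in> dom_ty U (snd x)"
          "\<And>s x. x \<in> set (its (st 0) s) \<Longrightarrow> sem U \<rho> [] (fst x) = Truth (s = Lhs)" by blast
      have "sem U \<rho> [] \<phi> = Truth True" if "\<phi> \<in> set \<Gamma>" for \<phi>
        using \<rho>(2)[of "(eps \<phi>, 0, 0)" Lhs] that by (auto simp: st_0 st0_def X0)
      moreover have "sem U \<rho> [] \<phi> = Truth False" if "\<phi> \<in> set \<Delta>" for \<phi>
        using \<rho>(2)[of "(eps \<phi>, 0, 0)" Rhs] that by (auto simp: st_0 st0_def X0)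
      ultimately show False using valid \<rho>(1) by (fastforce simp: valid_def V_def)
    qed
  qed
  then show ?thesis by (simp add: sq0)
qed


section \<open>Eliminating the free variables of type N\<close>

lemma fvs_subst_num: "fvs (subst1 v (num n) e) = fvs e - {v}"
  by (induction e) (auto split: if_splits)

text \<open>The converse direction serves \<open>types_of\<close> at an abstraction, which collects
  all types of the expression.\<close>

lemma has_type_subst_num:
  "snd v = TNat \<Longrightarrow> has_type \<Theta> (subst1 v (num n) e) A \<longleftrightarrow> has_type \<Theta> e A"
proof
  show "has_type \<Theta> (subst1 v (num n) e) A" if "has_type \<Theta> e A" "snd v = TNat"
    using that by (induction rule: has_type.induct) (auto intro: has_type.intros)
  show "has_type \<Theta> e A" if "has_type \<Theta> (subst1 v (num n) e) A" "snd v = TNat"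
    using that
  proof (induction e arbitrary: \<Theta> A)
    case (FV x)
    have "has_type \<Theta> (num n :: 'a exp) B \<Longrightarrow> B = TNat" for B :: ty
      by (cases n) (auto elim: has_type_Zero has_type_Succ)
    then show ?case using FV has_type.intros(1)[of \<Theta> x] by (auto split: if_splits)
  next
    case (App e1 e2)
    from App.prems(1)[unfolded subst.simps] obtain B T where "A = TForm T" "has_type \<Theta> (subst1 v (num n) e1) (TForm (TFun B T))"
        "has_type \<Theta> (subst1 v (num n) e2) B"
      by (rule has_type_App)
    then show ?case using App.IH App.prems(2) has_type.intros(9) by blast
  qed (auto simp del: fun_upd_apply elim!: has_type_BV has_type_Zero has_type_Succ has_type_Eq has_type_Or has_type_And
      has_type_Lam has_type_Fix intro: has_type.intros)
qed

lemma types_of_subst_num: "snd v = TNat \<Longrightarrow> types_of \<Theta> (subst1 v (num n) e) \<subseteq> types_of \<Theta> e"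
proof (induction e arbitrary: \<Theta>)
  case (FV x)
  have "types_of \<Theta> (num n) = {}" by (induction n) auto
  then show ?case by auto
next
  case (Lam A e)
  have "has_type \<Theta> (Lam A (subst1 v (num n) e)) B \<longleftrightarrow> has_type \<Theta> (Lam A e) B" for B
    using has_type_subst_num[OF Lam.prems, of \<Theta> n "Lam A e" B] by (simp del: fun_upd_apply)
  then show ?case using Lam by (auto simp del: fun_upd_apply)
qed (auto simp del: fun_upd_apply)

lemma sem_subst_num: "sem U \<rho> \<eta> (subst1 v (num n) e) = sem U (\<rho>(v := Num n)) \<eta> e"
  by (induction e arbitrary: \<eta>) (auto cong: if_cong split: fixkind.split)

text \<open>Induction on the number of free variables of type N, each removed by the omega rule.
  Validity passes to numeral instances because substituting a numeral amounts to changing the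
  valuation at that variable.\<close>

theorem theorem21:
  fixes U :: "'u universe" and \<Gamma> \<Delta> :: "fm list"
  assumes "typed_seq (\<Gamma>, \<Delta>)"
    and "no_higher_order_fvs (\<Gamma>, \<Delta>)"
    and "full_seq U (\<Gamma>, \<Delta>)"
    and "valid U (\<Gamma>, \<Delta>)"
  shows "provable (\<Gamma>, \<Delta>)"
  using assms
proof (induction "card {x \<in> fvs_seq (\<Gamma>, \<Delta>). snd x = TNat}" arbitrary: \<Gamma> \<Delta> rule: less_induct)
  case less
  show ?case
  proof (cases "\<exists>v\<in>fvs_seq (\<Gamma>, \<Delta>). snd v = TNat")
    case False
    then show ?thesis
      using less.prems by (intro completeness_first_order[of \<Gamma> \<Delta> U])
        (auto simp: no_higher_order_fvs_def first_order_def)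
  next
    case True
    then obtain v where v: "v \<in> fvs_seq (\<Gamma>, \<Delta>)" "snd v = TNat" by blast
    show ?thesis
    proof (rule omega_rule[OF v(2) less.prems(1)])
      fix n
      let ?f = "subst1 v (num n)"
      have fv: "fvs_seq (map ?f \<Gamma>, map ?f \<Delta>) = fvs_seq (\<Gamma>, \<Delta>) - {v}"
        by (auto simp: fvs_seq_def fvs_subst_num)
      show "provable (map ?f \<Gamma>, map ?f \<Delta>)"
      proof (rule less.hyps)
        show "card {x \<in> fvs_seq (map ?f \<Gamma>, map ?f \<Delta>). snd x = TNat} < card {x \<in> fvs_seq (\<Gamma>, \<Delta>). snd x = TNat}"
          unfolding fv by (rule psubset_card_mono) (use v finite_fvs_seq in auto)
        show "typed_seq (map ?f \<Gamma>, map ?f \<Delta>)"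
          using less.prems(1) by (simp add: typed_seq_iff has_type_subst_num[OF v(2)] del: fun_upd_apply)
        show "no_higher_order_fvs (map ?f \<Gamma>, map ?f \<Delta>)"
          using less.prems(2) unfolding no_higher_order_fvs_def fv by blast
        show "full_seq U (map ?f \<Gamma>, map ?f \<Delta>)"
          using less.prems(3) types_of_subst_num[OF v(2)] unfolding full_seq_def by fastforce
        show "valid U (map ?f \<Gamma>, map ?f \<Delta>)"
          unfolding valid_def
        proof (intro allI impI)
          fix \<rho> assume "\<forall>x\<in>fvs_seq (map ?f \<Gamma>, map ?f \<Delta>). \<rho> x \<in> dom_ty U (snd x)"
          then have "\<forall>x\<in>fvs_seq (\<Gamma>, \<Delta>). (\<rho>(v := Num n)) x \<in> dom_ty U (snd x)" using v(2) by (auto simp: fv)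
          then show "(\<exists>\<phi>\<in>set (fst (map ?f \<Gamma>, map ?f \<Delta>)). sem U \<rho> [] \<phi> = Truth False) \<or>
              (\<exists>\<psi>\<in>set (snd (map ?f \<Gamma>, map ?f \<Delta>)). sem U \<rho> [] \<psi> = Truth True)"
            using less.prems(4) unfolding valid_def by (simp add: sem_subst_num del: fun_upd_apply)
        qed
      qed
    qed
  qed
qed

end
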